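(* Let $\mathcal{G}$ be a small groupoid. The category $\mathbf{Set}^{\mathcal{G}^{\mathrm{op}}}$ of presheaves on $\mathcal{G}$ satisfies: (1) every finitely generated presheaf is finitely presentable if and only if every automorphism group $\mathcal{G}(a,a)$ ($a$ an object of $\mathcal{G}$) is Noetherian; (2) $\mathbf{Set}^{\mathcal{G}^{\mathrm{op}}}$ is a DCC category if and only if every automorphism group $\mathcal{G}(a,a)$ has only finite chains of subgroups; (3) $\mathbf{Set}^{\mathcal{G}^{\mathrm{op}}}$ is graduated if and only if every automorphism group $\mathcal{G}(a,a)$ has a finite longest chain of subgroups.
   Context: A groupoid is a category in which all morphisms are invertible. A group is Noetherian if every ascending chain of subgroups is finite (equivalently, all subgroups are finitely generated). A chain of subgroups is a set of subgroups linearly ordered by inclusion; having a finite longest chain of subgroups means that there is a finite upper bound on the lengths of chains of subgroups. A presheaf $F$ is finitely presentable if $\mathrm{Hom}(F,-)$ preserves directed colimits, and finitely generated if $\mathrm{Hom}(F,-)$ preserves directed colimits of monomorphisms; equivalently, there are finitely many elements $x_i\in Fa_i$ ($i<n$) such that every $x\in Fa$ has the form $Ff(x_i)$ for some $i<n$ and $f\colon a\to a_i$. A locally finitely presentable category is a DCC category if for every finitely presentable object $A$: (a) every subobject of $A$ is finitely presentable, and all (strictly) descending chains of subobjects of $A$ are finite; (b) every strong quotient of $A$ is finitely presentable, and all (strictly) descending chains of strong quotients of $A$ are finite. Quotients are ordered by: $e\le e'$ for $e\colon A\twoheadrightarrow Q$, $e'\colon A\twoheadrightarrow Q'$ iff $e'=h\cdot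 e$ for some $h\colon Q\to Q'$. A locally finitely presentable category is graduated if every finitely presentable object $X$ carries a grade, a natural number, such that all subobjects and all strong quotients of $X$ are also finitely presentable and have grades lower than or equal to that of $X$, and all proper subobjects and all proper strong quotients of $X$ have grades strictly lower than that of $X$. In presheaf categories all quotients (epimorphisms) are strong. *)

theory Defs
  imports "HOL-Algebra.Group" "HOL-Library.FuncSet"
begin

section \<open>Sizes\<close>

text \<open>
  A universe of small sets, all of whose elements come from one type. These are the closure
  properties of a Grothendieck universe (with an infinite member), except that closure under power
  sets is not demanded. Hence the small subsets of any type modelling ZFC form a universe, and so
  do all subsets of an arbitrary infinite type. Pairing comes for free, because the type is
  infinite.
\<close>

locale set_universe =
  fixes small :: "'u set \<Rightarrow> bool"
  assumes small_subset: "\<lbrakk>small Y; X \<subseteq> Y\<rbrakk> \<Longrightarrow> small X"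
    and small_infinite: "\<exists>X. small X \<and> infinite X"
    and small_image: "small X \<Longrightarrow> small (f ` X)"
    and small_Union: "\<lbrakk>small I; \<And>i. i \<in> I \<Longrightarrow> small (A i)\<rbrakk> \<Longrightarrow> small (\<Union>i\<in>I. A i)"

lemma set_universe_UNIV:
  assumes "infinite (UNIV :: 'u set)"
  shows "set_universe (\<lambda>_ :: 'u set. True)"
  using assms by unfold_locales auto

definition small_sized :: "('u set \<Rightarrow> bool) \<Rightarrow> 'a set \<Rightarrow> bool" where
  "small_sized small S \<longleftrightarrow> (\<exists>f :: 'a \<Rightarrow> 'u. inj_on f S \<and> small (f ` S))"


section \<open>Categories and functors\<close>

text \<open>\<open>Comp C g f\<close> is the composite \<open>g \<cdot> f\<close>, first \<open>f\<close> and then \<open>g\<close>.\<close>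

record ('o, 'm) category =
  Obj :: "'o set"
  Arr :: "'m set"
  Dom :: "'m \<Rightarrow> 'o"
  Cod :: "'m \<Rightarrow> 'o"
  Id :: "'o \<Rightarrow> 'm"
  Comp :: "'m \<Rightarrow> 'm \<Rightarrow> 'm"

definition Hom :: "('o, 'm) category \<Rightarrow> 'o \<Rightarrow> 'o \<Rightarrow> 'm set" where
  "Hom C a b = {f \<in> Arr C. Dom C f = a \<and> Cod C f = b}"

definition is_category :: "('o, 'm) category \<Rightarrow> bool" where
  "is_category C \<longleftrightarrow>
     (\<forall>f\<in>Arr C. Dom C f \<in> Obj C \<and> Cod C f \<in> Obj C) \<and>
     (\<forall>a\<in>Obj C. Id C a \<in> Hom C a a) \<and>
     (\<forall>f\<in>Arr C. \<forall>g\<in>Arr C. Cod C f = Dom C g \<longrightarrow> Comp C g f \<in> Hom C (Dom C f) (Cod C g)) \<and>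
     (\<forall>f\<in>Arr C. Comp C f (Id C (Dom C f)) = f \<and> Comp C (Id C (Cod C f)) f = f) \<and>
     (\<forall>f\<in>Arr C. \<forall>g\<in>Arr C. \<forall>h\<in>Arr C. Cod C f = Dom C g \<longrightarrow> Cod C g = Dom C h \<longrightarrow>
        Comp C h (Comp C g f) = Comp C (Comp C h g) f)"

definition small_category :: "('u set \<Rightarrow> bool) \<Rightarrow> ('o, 'm) category \<Rightarrow> bool" where
  "small_category small C \<longleftrightarrow> small_sized small (Obj C) \<and> small_sized small (Arr C)"

definition iso_arr :: "('o, 'm) category \<Rightarrow> 'm \<Rightarrow> bool" where
  "iso_arr C f \<longleftrightarrow> f \<in> Arr C \<and>
     (\<exists>g\<in>Hom C (Cod C f) (Dom C f).
        Comp C g f = Id C (Dom C f) \<and> Comp C f g = Id C (Cod C f))"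

definition monic :: "('o, 'm) category \<Rightarrow> 'm \<Rightarrow> bool" where
  "monic C m \<longleftrightarrow> m \<in> Arr C \<and>
     (\<forall>f\<in>Arr C. \<forall>g\<in>Arr C. Dom C f = Dom C g \<longrightarrow> Cod C f = Dom C m \<longrightarrow> Cod C g = Dom C m \<longrightarrow>
        Comp C m f = Comp C m g \<longrightarrow> f = g)"

definition epic :: "('o, 'm) category \<Rightarrow> 'm \<Rightarrow> bool" where
  "epic C e \<longleftrightarrow> e \<in> Arr C \<and>
     (\<forall>f\<in>Arr C. \<forall>g\<in>Arr C. Cod C f = Cod C g \<longrightarrow> Dom C f = Cod C e \<longrightarrow> Dom C g = Cod C e \<longrightarrow>
        Comp C f e = Comp C g e \<longrightarrow> f = g)"

text \<open>Strong epimorphisms: epimorphisms with the diagonal fill-in property against monomorphisms.\<close>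

definition strong_epic :: "('o, 'm) category \<Rightarrow> 'm \<Rightarrow> bool" where
  "strong_epic C e \<longleftrightarrow> epic C e \<and>
     (\<forall>m. monic C m \<longrightarrow>
        (\<forall>f\<in>Hom C (Dom C e) (Dom C m). \<forall>g\<in>Hom C (Cod C e) (Cod C m).
           Comp C m f = Comp C g e \<longrightarrow>
           (\<exists>d\<in>Hom C (Cod C e) (Dom C m). Comp C d e = f \<and> Comp C m d = g)))"

definition groupoid :: "('o, 'm) category \<Rightarrow> bool" where
  "groupoid C \<longleftrightarrow> is_category C \<and> (\<forall>f\<in>Arr C. iso_arr C f)"

definition opposite :: "('o, 'm) category \<Rightarrow> ('o, 'm) category" where
  "opposite C = \<lparr>Obj = Obj C, Arr = Arr C, Dom = Cod C, Cod = Dom C, Id = Id C,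
                 Comp = (\<lambda>g f. Comp C f g)\<rparr>"

record ('o1, 'm1, 'o2, 'm2) cat_functor =
  FObj :: "'o1 \<Rightarrow> 'o2"
  FArr :: "'m1 \<Rightarrow> 'm2"

definition is_functor ::
  "('o1, 'm1) category \<Rightarrow> ('o2, 'm2) category \<Rightarrow> ('o1, 'm1, 'o2, 'm2) cat_functor \<Rightarrow> bool" where
  "is_functor C D F \<longleftrightarrow> is_category C \<and> is_category D \<and>
     (\<forall>a\<in>Obj C. FObj F a \<in> Obj D) \<and>
     (\<forall>f\<in>Arr C. FArr F f \<in> Hom D (FObj F (Dom C f)) (FObj F (Cod C f))) \<and>
     (\<forall>a\<in>Obj C. FArr F (Id C a) = Id D (FObj F a)) \<and>
     (\<forall>f\<in>Arr C. \<forall>g\<in>Arr C. Cod C f = Dom C g \<longrightarrow>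
        FArr F (Comp C g f) = Comp D (FArr F g) (FArr F f))"

definition functor_comp ::
  "('o2, 'm2, 'o3, 'm3) cat_functor \<Rightarrow> ('o1, 'm1, 'o2, 'm2) cat_functor \<Rightarrow>
   ('o1, 'm1, 'o3, 'm3) cat_functor" where
  "functor_comp F D = \<lparr>FObj = FObj F \<circ> FObj D, FArr = FArr F \<circ> FArr D\<rparr>"

text \<open>
  Arrows of the functor category are triples of source, components and target. Functors and
  families of components are normalised to \<open>undefined\<close> outside \<open>J\<close>, so that equality is equality
  on \<open>J\<close>.
\<close>

definition functor_category ::
  "('i, 'j) category \<Rightarrow> ('o, 'm) category \<Rightarrow>
   (('i, 'j, 'o, 'm) cat_functor,
    ('i, 'j, 'o, 'm) cat_functor \<times> ('i \<Rightarrow> 'm) \<times> ('i, 'j, 'o, 'm) cat_functor) category" where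
  "functor_category J C =
     (let Ob = {F. is_functor J C F \<and> FObj F \<in> extensional (Obj J) \<and> FArr F \<in> extensional (Arr J)}
      in \<lparr>Obj = Ob,
          Arr = {(F, \<eta>, F'). F \<in> Ob \<and> F' \<in> Ob \<and> \<eta> \<in> extensional (Obj J) \<and>
                   (\<forall>a\<in>Obj J. \<eta> a \<in> Hom C (FObj F a) (FObj F' a)) \<and>
                   (\<forall>u\<in>Arr J. Comp C (\<eta> (Cod J u)) (FArr F u) = Comp C (FArr F' u) (\<eta> (Dom J u)))},
          Dom = fst,
          Cod = snd \<circ> snd,
          Id = (\<lambda>F. (F, \<lambda>a\<in>Obj J. Id C (FObj F a), F)),
          Comp = (\<lambda>(F', \<tau>, F'') (F, \<sigma>, _). (F, \<lambda>a\<in>Obj J. Comp C (\<tau> a) (\<sigma> a), F''))\<rparr>)"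

text \<open>The category of those sets over a type that satisfy \<open>small\<close>.\<close>

definition set_category ::
  "('a set \<Rightarrow> bool) \<Rightarrow> ('a set, 'a set \<times> ('a \<Rightarrow> 'a) \<times> 'a set) category" where
  "set_category small =
     \<lparr>Obj = {X. small X},
      Arr = {(X, f, Y). small X \<and> small Y \<and> f \<in> X \<rightarrow>\<^sub>E Y},
      Dom = fst,
      Cod = snd \<circ> snd,
      Id = (\<lambda>X. (X, \<lambda>x\<in>X. x, X)),
      Comp = (\<lambda>(Y, g, Z) (X, f, _). (X, \<lambda>x\<in>X. g (f x), Z))\<rparr>"

definition presheaves ::
  "('u set \<Rightarrow> bool) \<Rightarrow> ('o, 'm) category \<Rightarrow>
   (('o, 'm, 'u set, 'u set \<times> ('u \<Rightarrow> 'u) \<times> 'u set) cat_functor,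
    ('o, 'm, 'u set, 'u set \<times> ('u \<Rightarrow> 'u) \<times> 'u set) cat_functor \<times>
    ('o \<Rightarrow> 'u set \<times> ('u \<Rightarrow> 'u) \<times> 'u set) \<times>
    ('o, 'm, 'u set, 'u set \<times> ('u \<Rightarrow> 'u) \<times> 'u set) cat_functor) category" where
  "presheaves small G = functor_category (opposite G) (set_category small)"

text \<open>
  The covariant hom-functor takes values in the category of all sets of arrows of \<open>C\<close>. Whether a
  cocone of sets is a colimit does not depend on the universe in which it is tested, since test
  sets with two elements suffice.
\<close>

definition hom_functor ::
  "('o, 'm) category \<Rightarrow> 'o \<Rightarrow> ('o, 'm, 'm set, 'm set \<times> ('m \<Rightarrow> 'm) \<times> 'm set) cat_functor" where
  "hom_functor C A =
     \<lparr>FObj = (\<lambda>X. Hom C A X),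
      FArr = (\<lambda>f. (Hom C A (Dom C f), \<lambda>g\<in>Hom C A (Dom C f). Comp C f g, Hom C A (Cod C f)))\<rparr>"


section \<open>Colimits\<close>

definition cocone ::
  "('i, 'j) category \<Rightarrow> ('o, 'm) category \<Rightarrow> ('i, 'j, 'o, 'm) cat_functor \<Rightarrow>
   'o \<Rightarrow> ('i \<Rightarrow> 'm) \<Rightarrow> bool" where
  "cocone J C D L c \<longleftrightarrow> L \<in> Obj C \<and>
     (\<forall>i\<in>Obj J. c i \<in> Hom C (FObj D i) L) \<and>
     (\<forall>u\<in>Arr J. Comp C (c (Cod J u)) (FArr D u) = c (Dom J u))"

definition is_colimit ::
  "('i, 'j) category \<Rightarrow> ('o, 'm) category \<Rightarrow> ('i, 'j, 'o, 'm) cat_functor \<Rightarrow>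
   'o \<Rightarrow> ('i \<Rightarrow> 'm) \<Rightarrow> bool" where
  "is_colimit J C D L c \<longleftrightarrow> is_functor J C D \<and> cocone J C D L c \<and>
     (\<forall>L' c'. cocone J C D L' c' \<longrightarrow>
        (\<exists>!h. h \<in> Hom C L L' \<and> (\<forall>i\<in>Obj J. Comp C h (c i) = c' i)))"

definition preserves_colimits ::
  "('i, 'j) category \<Rightarrow> ('o, 'm) category \<Rightarrow> ('p, 'n) category \<Rightarrow>
   ('o, 'm, 'p, 'n) cat_functor \<Rightarrow> ('i, 'j, 'o, 'm) cat_functor \<Rightarrow> bool" where
  "preserves_colimits J C E F D \<longleftrightarrow>
     (\<forall>L c. is_colimit J C D L c \<longrightarrow>
        is_colimit J E (functor_comp F D) (FObj F L) (\<lambda>i. FArr F (c i)))"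

definition directed_poset :: "'i set \<Rightarrow> ('i \<times> 'i) set \<Rightarrow> bool" where
  "directed_poset I r \<longleftrightarrow> partial_order_on I r \<and> I \<noteq> {} \<and>
     (\<forall>i\<in>I. \<forall>j\<in>I. \<exists>k\<in>I. (i, k) \<in> r \<and> (j, k) \<in> r)"

definition poset_category :: "'i set \<Rightarrow> ('i \<times> 'i) set \<Rightarrow> ('i, 'i \<times> 'i) category" where
  "poset_category I r =
     \<lparr>Obj = I, Arr = r, Dom = fst, Cod = snd, Id = (\<lambda>i. (i, i)),
      Comp = (\<lambda>q p. (fst p, snd q))\<rparr>"

text \<open>Up to isomorphism, every small index category has its objects and arrows in the universe.\<close>

definition cocomplete :: "('u set \<Rightarrow> bool) \<Rightarrow> ('o, 'm) category \<Rightarrow> bool" where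
  "cocomplete small C \<longleftrightarrow>
     (\<forall>(J :: ('u, 'u) category) D. small (Obj J) \<longrightarrow> small (Arr J) \<longrightarrow> is_functor J C D \<longrightarrow>
        (\<exists>L c. is_colimit J C D L c))"


section \<open>Finitely presentable objects\<close>

definition finitely_presentable :: "('u set \<Rightarrow> bool) \<Rightarrow> ('o, 'm) category \<Rightarrow> 'o \<Rightarrow> bool" where
  "finitely_presentable small C A \<longleftrightarrow> A \<in> Obj C \<and>
     (\<forall>(I :: 'u set) r D. small I \<longrightarrow> directed_poset I r \<longrightarrow>
        is_functor (poset_category I r) C D \<longrightarrow>
        preserves_colimits (poset_category I r) C (set_category (\<lambda>_. True)) (hom_functor C A) D)"

definition finitely_generated :: "('u set \<Rightarrow> bool) \<Rightarrow> ('o, 'm) category \<Rightarrow> 'o \<Rightarrow> bool" where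
  "finitely_generated small C A \<longleftrightarrow> A \<in> Obj C \<and>
     (\<forall>(I :: 'u set) r D. small I \<longrightarrow> directed_poset I r \<longrightarrow>
        is_functor (poset_category I r) C D \<longrightarrow> (\<forall>p\<in>r. monic C (FArr D p)) \<longrightarrow>
        preserves_colimits (poset_category I r) C (set_category (\<lambda>_. True)) (hom_functor C A) D)"

definition locally_finitely_presentable ::
  "('u set \<Rightarrow> bool) \<Rightarrow> ('o, 'm) category \<Rightarrow> bool" where
  "locally_finitely_presentable small C \<longleftrightarrow> is_category C \<and> cocomplete small C \<and>
     (\<exists>S. small_sized small S \<and> (\<forall>A\<in>S. finitely_presentable small C A) \<and>
        (\<forall>X\<in>Obj C. \<exists>(I :: 'u set) r D c. small I \<and> directed_poset I r \<and>
           (\<forall>i\<in>I. FObj D i \<in> S) \<and> is_colimit (poset_category I r) C D X c))"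


section \<open>DCC categories and graduated categories\<close>

text \<open>
  Subobjects are represented by monomorphisms and quotients by strong epimorphisms, both preordered
  by factorization; subobjects and quotients proper are the induced equivalence classes.
\<close>

definition subobj_le :: "('o, 'm) category \<Rightarrow> 'm \<Rightarrow> 'm \<Rightarrow> bool" where
  "subobj_le C m m' \<longleftrightarrow> (\<exists>h\<in>Hom C (Dom C m) (Dom C m'). m = Comp C m' h)"

definition quot_le :: "('o, 'm) category \<Rightarrow> 'm \<Rightarrow> 'm \<Rightarrow> bool" where
  "quot_le C e e' \<longleftrightarrow> (\<exists>h\<in>Hom C (Cod C e) (Cod C e'). e' = Comp C h e)"

definition strictly_descending :: "('a \<Rightarrow> 'a \<Rightarrow> bool) \<Rightarrow> (nat \<Rightarrow> 'a) \<Rightarrow> bool" where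
  "strictly_descending R s \<longleftrightarrow> (\<forall>n. R (s (Suc n)) (s n) \<and> \<not> R (s n) (s (Suc n)))"

definition dcc_category :: "('u set \<Rightarrow> bool) \<Rightarrow> ('o, 'm) category \<Rightarrow> bool" where
  "dcc_category small C \<longleftrightarrow> locally_finitely_presentable small C \<and>
     (\<forall>A. finitely_presentable small C A \<longrightarrow>
        (\<forall>m. monic C m \<and> Cod C m = A \<longrightarrow> finitely_presentable small C (Dom C m)) \<and>
        (\<nexists>m. (\<forall>n. monic C (m n) \<and> Cod C (m n) = A) \<and> strictly_descending (subobj_le C) m) \<and>
        (\<forall>e. strong_epic C e \<and> Dom C e = A \<longrightarrow> finitely_presentable small C (Cod C e)) \<and>
        (\<nexists>e. (\<forall>n. strong_epic C (e n) \<and> Dom C (e n) = A) \<and> strictly_descending (quot_le C) e))"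

definition graduated :: "('u set \<Rightarrow> bool) \<Rightarrow> ('o, 'm) category \<Rightarrow> bool" where
  "graduated small C \<longleftrightarrow> locally_finitely_presentable small C \<and>
     (\<exists>grade :: 'o \<Rightarrow> nat. \<forall>X. finitely_presentable small C X \<longrightarrow>
        (\<forall>m. monic C m \<and> Cod C m = X \<longrightarrow>
           finitely_presentable small C (Dom C m) \<and> grade (Dom C m) \<le> grade X \<and>
           (\<not> iso_arr C m \<longrightarrow> grade (Dom C m) < grade X)) \<and>
        (\<forall>e. strong_epic C e \<and> Dom C e = X \<longrightarrow>
           finitely_presentable small C (Cod C e) \<and> grade (Cod C e) \<le> grade X \<and>
           (\<not> iso_arr C e \<longrightarrow> grade (Cod C e) < grade X)))"


section \<open>Automorphism groups and chains of subgroups\<close>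

definition aut_group :: "('o, 'm) category \<Rightarrow> 'o \<Rightarrow> 'm monoid" where
  "aut_group C a = \<lparr>carrier = Hom C a a, mult = Comp C, one = Id C a\<rparr>"

definition noetherian_group :: "'a monoid \<Rightarrow> bool" where
  "noetherian_group K \<longleftrightarrow> \<not> (\<exists>H :: nat \<Rightarrow> 'a set. \<forall>n. subgroup (H n) K \<and> H n \<subset> H (Suc n))"

definition subgroup_chain :: "'a monoid \<Rightarrow> 'a set set \<Rightarrow> bool" where
  "subgroup_chain K \<C> \<longleftrightarrow> subset.chain {H. subgroup H K} \<C>"

definition only_finite_subgroup_chains :: "'a monoid \<Rightarrow> bool" where
  "only_finite_subgroup_chains K \<longleftrightarrow> (\<forall>\<C>. subgroup_chain K \<C> \<longrightarrow> finite \<C>)"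

definition finite_longest_subgroup_chain :: "'a monoid \<Rightarrow> bool" where
  "finite_longest_subgroup_chain K \<longleftrightarrow>
     (\<exists>n. \<forall>\<C>. subgroup_chain K \<C> \<longrightarrow> finite \<C> \<and> card \<C> \<le> n)"

end

theory Submission
  imports Defs "HOL-Algebra.Generated_Groups"
begin

text \<open>
  Over a groupoid a presheaf \<open>X\<close> is the disjoint union of its orbits, and the orbit of \<open>x \<in> X a\<close> is
  determined up to isomorphism by the stabilizer of \<open>x\<close>, a subgroup of \<open>G(a, a)\<close>. Conversely each
  subgroup \<open>H\<close> is the stabilizer of the generator of the coset presheaf \<open>G(-, a)/H\<close>. A presheaf is
  finitely generated iff it has finitely many orbits, and it is finitely presentable if moreover
  its stabilizers are finitely generated. For an ascending sequence of subgroups \<open>H\<^sub>n\<close> with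
  union \<open>H\<close>, the finitely generated presheaf \<open>G(-, a)/H\<close> is the directed colimit of the
  presheaves \<open>G(-, a)/H\<^sub>n\<close> and not finitely presentable.

  Subobjects omit orbits; quotients merge orbits and enlarge stabilizers. So a descending chain of
  subobjects of a presheaf with finitely many orbits stops for a counting reason, a descending chain
  of quotients stops as soon as the number of orbits and the finitely many stabilizers of orbit
  representatives are constant, and the sum over all orbits of the maximal length of a chain of
  subgroups above the stabilizer is a grade. Conversely, the quotients \<open>G(-, a)/H\<close> of \<open>G(-, a)\<close>
  are ordered like the subgroups \<open>H\<close>.

  The groups in question being Noetherian whenever local finite presentability has to be proved,
  every presheaf is then simply the directed union of its finitely generated subpresheaves.
\<close>

section \<open>Small-sized sets\<close>

text \<open>Two constraints of size shape the constructions. The values of a presheaf are sets of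
  elements of the one type \<open>'u\<close>, and directed diagrams are indexed by subsets of
  \<open>'u\<close>. Quotients are therefore formed by naming a class by the code of a
  representative, and the natural index sets (finite sets of points, natural numbers) are copied
  into \<open>'u\<close>. Closure under power sets is not assumed, so subpresheaves are indexed by
  finite generating sets, and the small set of presentable objects comes from finite codes. The
  definitions speak of arbitrary colimits, monomorphisms and strong epimorphisms. Each is translated
  into elements: a colimit is compared with a constructed one, a monomorphism is tested on maps out
  of representables, a strong epimorphism on the inclusion of its image. After that, a map of
  presheaves is handled through the induced map on orbits and the inclusions of stabilizers: a
  surjection is invertible as soon as the orbits are equally many and no stabilizer grows. Since
  stabilizers are inspected at chosen representatives only, conjugation by arrows of
  \<open>G\<close> is what makes the results independent of the choice.\<close>

context set_universe
begin

lemma infinite_type: "infinite (UNIV :: 'u set)"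
  using small_infinite infinite_super[OF subset_UNIV] by metis

text \<open>An infinite set is equinumerous with its square. The pairing codes an element of a union
  by its index together with its code inside that member.\<close>

lemma pairing_exists: "\<exists>p :: 'u \<times> 'u \<Rightarrow> 'u. inj p"
proof -
  obtain f :: "'u \<times> 'u \<Rightarrow> 'u" where "bij_betw f (UNIV \<times> UNIV) UNIV"
    using card_of_Times_same_infinite[OF infinite_type] card_of_ordIso by blast
  then show ?thesis by (auto simp: bij_betw_def)
qed

lemma small_sizedI: "inj_on f S \<Longrightarrow> small (f ` S) \<Longrightarrow> small_sized small S"
  for f :: "'a \<Rightarrow> 'u"
  unfolding small_sized_def by blast

lemma small_imp_small_sized: "small S \<Longrightarrow> small_sized small S"
  by (rule small_sizedI[of id]) auto

lemma small_sized_subset: "small_sized small S \<Longrightarrow> T \<subseteq> S \<Longrightarrow> small_sized small T"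
  unfolding small_sized_def by (meson image_mono inj_on_subset small_subset)

text \<open>A right inverse embeds the image into \<open>S\<close>, so the codes of \<open>S\<close>
  can be reused.\<close>

lemma small_sized_image: "small_sized small S \<Longrightarrow> small_sized small (h ` S)"
proof -
  assume "small_sized small S"
  then obtain f :: "'a \<Rightarrow> 'u" where f: "inj_on f S" "small (f ` S)"
    unfolding small_sized_def by blast
  let ?g = "inv_into S h"
  have "?g ` h ` S \<subseteq> S" by (auto intro: inv_into_into)
  then have "inj_on (f \<circ> ?g) (h ` S)"
    using f(1) by (meson comp_inj_on inj_on_inv_into inj_on_subset order_refl)
  moreover have "small ((f \<circ> ?g) ` h ` S)"
    using f(2) \<open>?g ` h ` S \<subseteq> S\<close> by (metis image_comp image_mono small_subset)
  ultimately show ?thesis by (rule small_sizedI)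
qed

text \<open>After choosing for each \<open>x\<close> one member containing it, \<open>x\<close> is
  coded by the pair of the code of that index and the code of \<open>x\<close> in the
  member.\<close>

lemma small_sized_UN:
  assumes "small_sized small I" and "\<And>i. i \<in> I \<Longrightarrow> small_sized small (A i)"
  shows "small_sized small (\<Union>i\<in>I. A i)"
proof -
  obtain p :: "'u \<times> 'u \<Rightarrow> 'u" where p: "inj p" using pairing_exists by blast
  obtain e :: "'a \<Rightarrow> 'u" where e: "inj_on e I" "small (e ` I)"
    using assms(1) unfolding small_sized_def by blast
  have "\<forall>i\<in>I. \<exists>f :: 'b \<Rightarrow> 'u. inj_on f (A i) \<and> small (f ` A i)"
    using assms(2) unfolding small_sized_def by blast
  then obtain f :: "'a \<Rightarrow> 'b \<Rightarrow> 'u" where f: "\<And>i. i \<in> I \<Longrightarrow> inj_on (f i) (A i) \<and> small (f i ` A i)"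
    by metis
  define c where "c x = (SOME i. i \<in> I \<and> x \<in> A i)" for x
  have c: "c x \<in> I \<and> x \<in> A (c x)" if "x \<in> (\<Union>i\<in>I. A i)" for x
    unfolding c_def using that someI_ex[of "\<lambda>i. i \<in> I \<and> x \<in> A i"] by blast
  let ?g = "\<lambda>x. p (e (c x), f (c x) x)"
  have "inj_on ?g (\<Union>i\<in>I. A i)"
  proof (rule inj_onI)
    fix x y assume xy: "x \<in> (\<Union>i\<in>I. A i)" "y \<in> (\<Union>i\<in>I. A i)" "?g x = ?g y"
    then have "e (c x) = e (c y)" "f (c x) x = f (c y) y"
      using p by (auto dest: injD)
    then show "x = y"
      using c[OF xy(1)] c[OF xy(2)] e(1) f by (metis inj_onD)
  qed
  moreover have "small (?g ` (\<Union>i\<in>I. A i))"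
  proof (rule small_subset)
    \<comment> \<open>\<open>small_Union\<close> accepts only index sets inside \<open>'u\<close>,
      so the family runs over the codes of indices, which are decoded by
      \<open>the_inv_into\<close>.\<close>
    let ?B = "\<lambda>u. \<Union>v \<in> f (the_inv_into I e u) ` A (the_inv_into I e u). {p (u, v)}"
    show "small (\<Union>u\<in>e ` I. ?B u)"
    proof (rule small_Union[OF e(2)])
      fix u assume "u \<in> e ` I"
      then have "the_inv_into I e u \<in> I" using e(1) the_inv_into_into by fastforce
      then have "small (f (the_inv_into I e u) ` A (the_inv_into I e u))" using f by blast
      then have "small ((\<lambda>v. p (u, v)) ` f (the_inv_into I e u) ` A (the_inv_into I e u))"
        by (rule small_image)
      then show "small (?B u)" by (simp add: UNION_singleton_eq_range)
    qed
    show "?g ` (\<Union>i\<in>I. A i) \<subseteq> (\<Union>u\<in>e ` I. ?B u)"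
    proof
      fix y assume "y \<in> ?g ` (\<Union>i\<in>I. A i)"
      then obtain x where x: "x \<in> (\<Union>i\<in>I. A i)" "y = ?g x" by blast
      have "the_inv_into I e (e (c x)) = c x"
        using c[OF x(1)] e(1) the_inv_into_f_f by fast
      then show "y \<in> (\<Union>u\<in>e ` I. ?B u)" using c[OF x(1)] x(2)
        by (auto intro!: bexI[of _ "c x"] bexI[of _ x])
    qed
  qed
  ultimately show ?thesis by (rule small_sizedI)
qed

lemma small_sized_nat: "small_sized small (UNIV :: nat set)"
proof -
  obtain X :: "'u set" where X: "small X" "infinite X" using small_infinite by blast
  then obtain f :: "nat \<Rightarrow> 'u" where "inj f" "range f \<subseteq> X"
    using infinite_countable_subset by blast
  then show ?thesis using X(1) small_subset small_sizedI by blast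
qed

lemma small_sized_finite: "finite S \<Longrightarrow> small_sized small S"
proof -
  assume "finite S"
  then obtain n and f :: "nat \<Rightarrow> 'a" where "S = f ` {i. i < n}"
    by (metis finite_imp_nat_seg_image_inj_on)
  then show ?thesis
    using small_sized_image[OF small_sized_subset[OF small_sized_nat subset_UNIV]] by metis
qed

lemma small_sized_Sigma:
  assumes "small_sized small I" and "\<And>i. i \<in> I \<Longrightarrow> small_sized small (A i)"
  shows "small_sized small (Sigma I A)"
proof -
  have "Sigma I A = (\<Union>i\<in>I. Pair i ` A i)" by auto
  then show ?thesis by (simp add: small_sized_UN small_sized_image assms)
qed

text \<open>Lists of one length form an iterated product; the union over all lengths is countable,
  and \<open>nat\<close> embeds into an infinite small set.\<close>

lemma small_sized_lists: "small_sized small S \<Longrightarrow> small_sized small (lists S)"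
proof -
  assume S: "small_sized small S"
  have "small_sized small {xs \<in> lists S. length xs = n}" for n
  proof (induction n)
    case 0
    have "{xs \<in> lists S. length xs = 0} = {[]}" by auto
    then show ?case using small_sized_finite by (metis finite.emptyI finite_insert)
  next
    case (Suc n)
    have "{xs \<in> lists S. length xs = Suc n} =
      (\<lambda>(x, xs). x # xs) ` (S \<times> {xs \<in> lists S. length xs = n})"
      by (auto simp: length_Suc_conv image_iff)
    then show ?case by (simp add: small_sized_image small_sized_Sigma S Suc)
  qed
  then have "small_sized small (\<Union>n\<in>UNIV. {xs \<in> lists S. length xs = n})"
    by (intro small_sized_UN small_sized_nat)
  moreover have "(\<Union>n\<in>UNIV. {xs \<in> lists S. length xs = n}) = lists S" by auto
  ultimately show ?thesis by metis
qed

text \<open>Finite sets are the ranges of lists. This stands in for power sets when the finitely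
  generated subpresheaves of a presheaf are indexed.\<close>

lemma small_sized_Fpow: "small_sized small S \<Longrightarrow> small_sized small (Fpow S)"
proof -
  assume S: "small_sized small S"
  have "Fpow S \<subseteq> set ` lists S"
    unfolding Fpow_def by (clarsimp simp: image_iff) (metis finite_list in_listsI subsetD)
  then show ?thesis by (rule small_sized_subset[OF small_sized_image[OF small_sized_lists[OF S]]])
qed

end

section \<open>Categories, functors and colimits\<close>

lemma Hom_iff: "f \<in> Hom C a b \<longleftrightarrow> f \<in> Arr C \<and> Dom C f = a \<and> Cod C f = b"
  by (simp add: Hom_def)

lemma Arr_imp_Hom: "f \<in> Arr C \<Longrightarrow> f \<in> Hom C (Dom C f) (Cod C f)"
  by (simp add: Hom_def)

lemma Hom_Obj: "is_category C \<Longrightarrow> f \<in> Hom C a b \<Longrightarrow> a \<in> Obj C \<and> b \<in> Obj C"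
  unfolding is_category_def Hom_def by blast

lemma Id_Hom: "is_category C \<Longrightarrow> a \<in> Obj C \<Longrightarrow> Id C a \<in> Hom C a a"
  unfolding is_category_def by blast

lemma Comp_Hom: "is_category C \<Longrightarrow> f \<in> Hom C a b \<Longrightarrow> g \<in> Hom C b c \<Longrightarrow> Comp C g f \<in> Hom C a c"
  unfolding is_category_def Hom_iff[of f] Hom_iff[of g] by metis

lemma Comp_Id_right: "is_category C \<Longrightarrow> f \<in> Hom C a b \<Longrightarrow> Comp C f (Id C a) = f"
  unfolding is_category_def Hom_iff[of f] by metis

lemma Comp_Id_left: "is_category C \<Longrightarrow> f \<in> Hom C a b \<Longrightarrow> Comp C (Id C b) f = f"
  unfolding is_category_def Hom_iff[of f] by metis

lemma Comp_assoc:
  "is_category C \<Longrightarrow> f \<in> Hom C a b \<Longrightarrow> g \<in> Hom C b c \<Longrightarrow> h \<in> Hom C c d \<Longrightarrow>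
   Comp C h (Comp C g f) = Comp C (Comp C h g) f"
  unfolding is_category_def Hom_iff[of f] Hom_iff[of g] Hom_iff[of h] by metis

lemma is_categoryI:
  assumes "\<And>f. f \<in> Arr C \<Longrightarrow> Dom C f \<in> Obj C \<and> Cod C f \<in> Obj C"
    and "\<And>a. a \<in> Obj C \<Longrightarrow> Id C a \<in> Hom C a a"
    and "\<And>a b c f g. f \<in> Hom C a b \<Longrightarrow> g \<in> Hom C b c \<Longrightarrow> Comp C g f \<in> Hom C a c"
    and "\<And>a b f. f \<in> Hom C a b \<Longrightarrow> Comp C f (Id C a) = f \<and> Comp C (Id C b) f = f"
    and "\<And>a b c d f g h. f \<in> Hom C a b \<Longrightarrow> g \<in> Hom C b c \<Longrightarrow> h \<in> Hom C c d \<Longrightarrow>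
           Comp C h (Comp C g f) = Comp C (Comp C h g) f"
  shows "is_category C"
  unfolding is_category_def using assms by (auto simp: Hom_iff)

lemma is_category_opposite: "is_category C \<Longrightarrow> is_category (opposite C)"
  by (rule is_categoryI)
    (auto simp: opposite_def Hom_iff is_category_def)

lemma is_category_poset:
  assumes "partial_order_on I r"
  shows "is_category (poset_category I r)"
proof -
  have "r \<subseteq> I \<times> I" "refl_on I r" "trans r"
    using assms by (auto simp: partial_order_on_def preorder_on_def)
  then show ?thesis
    by (intro is_categoryI) (auto simp: poset_category_def Hom_iff refl_on_def trans_def)
qed

section \<open>The category of sets\<close>

definition arr_fun :: "'a set \<times> ('a \<Rightarrow> 'a) \<times> 'a set \<Rightarrow> 'a \<Rightarrow> 'a" where
  "arr_fun p = fst (snd p)"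

lemma arr_fun_simp [simp]: "arr_fun (X, f, Y) = f"
  by (simp add: arr_fun_def)

lemma set_category_simps [simp]:
  "Obj (set_category s) = {X. s X}"
  "Dom (set_category s) (X, f, Y) = X"
  "Cod (set_category s) (X, f, Y) = Y"
  "Id (set_category s) X = (X, \<lambda>x\<in>X. x, X)"
  "Comp (set_category s) (Y, g, Z) (X, f, Y') = (X, \<lambda>x\<in>X. g (f x), Z)"
  by (simp_all add: set_category_def)

lemma Hom_set_category:
  "p \<in> Hom (set_category s) X Y \<longleftrightarrow> s X \<and> s Y \<and> (\<exists>f\<in>X \<rightarrow>\<^sub>E Y. p = (X, f, Y))"
  by (auto simp: set_category_def Hom_iff)

lemma set_HomE:
  assumes "p \<in> Hom (set_category s) X Y"
  obtains "p = (X, arr_fun p, Y)" "arr_fun p \<in> X \<rightarrow>\<^sub>E Y" "s X" "s Y"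
  using assms by (auto simp: Hom_set_category)

lemma set_Hom_eqI:
  assumes "p \<in> Hom (set_category s) X Y" "q \<in> Hom (set_category s) X Y"
    and "\<And>x. x \<in> X \<Longrightarrow> arr_fun p x = arr_fun q x"
  shows "p = q"
proof -
  have "arr_fun p = arr_fun q"
    using assms by (intro PiE_ext[of _ X "\<lambda>_. Y"]) (auto elim!: set_HomE)
  then show ?thesis using assms(1,2) by (metis set_HomE)
qed

lemma set_Hom_mem: "p \<in> Hom (set_category s) X Y \<Longrightarrow> x \<in> X \<Longrightarrow> arr_fun p x \<in> Y"
  by (auto simp: Hom_set_category)

lemma arr_fun_Comp:
  assumes "p \<in> Hom (set_category s) X Y" "q \<in> Hom (set_category s) Y Z" "x \<in> X"
  shows "arr_fun (Comp (set_category s) q p) x = arr_fun q (arr_fun p x)"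
  using assms by (auto simp: Hom_set_category)

text \<open>Made for naturality squares, whose two composites pass through different middle sets
  \<open>Y\<close> and \<open>Y'\<close>.\<close>

lemma set_Comp_cong:
  assumes "p \<in> Hom (set_category s) X Y" "q \<in> Hom (set_category s) Y Z"
    "p' \<in> Hom (set_category s) X Y'" "q' \<in> Hom (set_category s) Y' Z"
    and "\<And>x. x \<in> X \<Longrightarrow> arr_fun q (arr_fun p x) = arr_fun q' (arr_fun p' x)"
  shows "Comp (set_category s) q p = Comp (set_category s) q' p'"
  using assms by (auto simp: Hom_set_category intro!: restrict_ext)

lemma is_category_set: "is_category (set_category s)"
proof (rule is_categoryI)
  fix f assume "f \<in> Arr (set_category s)"
  then show "Dom (set_category s) f \<in> Obj (set_category s) \<and> Cod (set_category s) f \<in> Obj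
      (set_category s)"
    by (auto simp: set_category_def)
next
  fix X assume "X \<in> Obj (set_category s)"
  then show "Id (set_category s) X \<in> Hom (set_category s) X X"
    by (auto simp: Hom_set_category)
next
  fix X Y Z f g assume "f \<in> Hom (set_category s) X Y" "g \<in> Hom (set_category s) Y Z"
  then show "Comp (set_category s) g f \<in> Hom (set_category s) X Z"
    by (auto simp: Hom_set_category PiE_iff)
next
  fix X Y f assume f: "f \<in> Hom (set_category s) X Y"
  then have "arr_fun f \<in> X \<rightarrow>\<^sub>E Y" by (auto simp: Hom_set_category)
  \<comment> \<open>The conditional is the composite with the restricted identity of
    \<open>Y\<close> once \<open>restrict\<close> is unfolded; its default branch is never reached
    on \<open>X\<close>.\<close>
  then have "restrict (arr_fun f) X = arr_fun f" "(\<lambda>x\<in>X. if arr_fun f x \<in> Y then arr_fun f x else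
      undefined) = arr_fun f"
    by (auto simp: fun_eq_iff PiE_iff extensional_def)
  with f show "Comp (set_category s) f (Id (set_category s) X) = f \<and>
      Comp (set_category s) (Id (set_category s) Y) f = f"
    by (auto simp: Hom_set_category restrict_def cong: if_cong)
next
  fix W X Y Z f g h
  assume "f \<in> Hom (set_category s) W X" "g \<in> Hom (set_category s) X Y"
      "h \<in> Hom (set_category s) Y Z"
  then show "Comp (set_category s) h (Comp (set_category s) g f) =
      Comp (set_category s) (Comp (set_category s) h g) f"
    by (auto simp: Hom_set_category PiE_iff intro!: restrict_ext)
qed

section \<open>Functor categories\<close>

lemma functor_category_simps:
  "Obj (functor_category J C) =
     {F. is_functor J C F \<and> FObj F \<in> extensional (Obj J) \<and> FArr F \<in> extensional (Arr J)}"
  "Dom (functor_category J C) = fst"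
  "Cod (functor_category J C) = snd \<circ> snd"
  "Id (functor_category J C) F = (F, \<lambda>a\<in>Obj J. Id C (FObj F a), F)"
  "Comp (functor_category J C) (F', \<tau>, F'') (F, \<sigma>, X) = (F, \<lambda>a\<in>Obj J. Comp C (\<tau> a) (\<sigma> a), F'')"
  by (simp_all add: functor_category_def Let_def)

lemma Hom_functor_category:
  "p \<in> Hom (functor_category J C) F F' \<longleftrightarrow>
     F \<in> Obj (functor_category J C) \<and> F' \<in> Obj (functor_category J C) \<and>
     (\<exists>\<eta>\<in>extensional (Obj J). p = (F, \<eta>, F') \<and>
        (\<forall>a\<in>Obj J. \<eta> a \<in> Hom C (FObj F a) (FObj F' a)) \<and>
        (\<forall>u\<in>Arr J. Comp C (\<eta> (Cod J u)) (FArr F u) = Comp C (FArr F' u) (\<eta> (Dom J u))))"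
  by (auto simp: Hom_iff functor_category_def Let_def)

lemma is_functorD:
  assumes "is_functor C D F"
  shows "is_category C" "is_category D"
    "\<And>a. a \<in> Obj C \<Longrightarrow> FObj F a \<in> Obj D"
    "\<And>f a b. f \<in> Hom C a b \<Longrightarrow> FArr F f \<in> Hom D (FObj F a) (FObj F b)"
    "\<And>a. a \<in> Obj C \<Longrightarrow> FArr F (Id C a) = Id D (FObj F a)"
    "\<And>f g a b c. f \<in> Hom C a b \<Longrightarrow> g \<in> Hom C b c \<Longrightarrow>
       FArr F (Comp C g f) = Comp D (FArr F g) (FArr F f)"
  using assms unfolding is_functor_def by (auto simp: Hom_iff[of _ C])

lemma is_functorI:
  assumes "is_category C" "is_category D"
    "\<And>a. a \<in> Obj C \<Longrightarrow> FObj F a \<in> Obj D"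
    "\<And>f a b. f \<in> Hom C a b \<Longrightarrow> FArr F f \<in> Hom D (FObj F a) (FObj F b)"
    "\<And>a. a \<in> Obj C \<Longrightarrow> FArr F (Id C a) = Id D (FObj F a)"
    "\<And>f g a b c. f \<in> Hom C a b \<Longrightarrow> g \<in> Hom C b c \<Longrightarrow>
       FArr F (Comp C g f) = Comp D (FArr F g) (FArr F f)"
  shows "is_functor C D F"
  using assms unfolding is_functor_def by (auto simp: Hom_iff[of _ C])

lemma is_category_functor_category:
  assumes J: "is_category J" and C: "is_category C"
  shows "is_category (functor_category J C)" (is "is_category ?E")
proof (rule is_categoryI)
  fix f assume "f \<in> Arr ?E"
  then show "Dom ?E f \<in> Obj ?E \<and> Cod ?E f \<in> Obj ?E"
    by (auto simp: functor_category_def Let_def)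
next
  fix F assume F: "F \<in> Obj ?E"
  then have fF: "is_functor J C F" by (simp add: functor_category_simps)
  have "Comp C (Id C (FObj F (Cod J u))) (FArr F u) = Comp C (FArr F u) (Id C (FObj F (Dom J u)))"
    if "u \<in> Arr J" for u
    using is_functorD(4)[OF fF Arr_imp_Hom[OF that]] Comp_Id_left[OF C] Comp_Id_right[OF C] by metis
  then show "Id ?E F \<in> Hom ?E F F"
    unfolding Hom_functor_category functor_category_simps(4)
    using F Id_Hom[OF C is_functorD(3)[OF fF]] J
    by (intro conjI bexI[of _ "\<lambda>a\<in>Obj J. Id C (FObj F a)"])
       (auto simp: Hom_Obj[OF J Arr_imp_Hom])
next
  fix F F' F'' f g assume f: "f \<in> Hom ?E F F'" and g: "g \<in> Hom ?E F' F''"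
  obtain \<sigma> where \<sigma>: "f = (F, \<sigma>, F')" "\<And>a. a \<in> Obj J \<Longrightarrow> \<sigma> a \<in> Hom C (FObj F a) (FObj F' a)"
    "\<And>u. u \<in> Arr J \<Longrightarrow> Comp C (\<sigma> (Cod J u)) (FArr F u) = Comp C (FArr F' u) (\<sigma> (Dom J u))"
    using f unfolding Hom_functor_category by blast
  obtain \<tau> where \<tau>: "g = (F', \<tau>, F'')" "\<And>a. a \<in> Obj J \<Longrightarrow> \<tau> a \<in> Hom C (FObj F' a) (FObj F'' a)"
    "\<And>u. u \<in> Arr J \<Longrightarrow> Comp C (\<tau> (Cod J u)) (FArr F' u) = Comp C (FArr F'' u) (\<tau> (Dom J u))"
    using g unfolding Hom_functor_category by blast
  have FF: "F \<in> Obj ?E" "F' \<in> Obj ?E" "F'' \<in> Obj ?E"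
    using f g unfolding Hom_functor_category by blast+
  then have fF: "is_functor J C F" "is_functor J C F'" "is_functor J C F''"
    by (simp_all add: functor_category_simps)
  have "Comp C (Comp C (\<tau> (Cod J u)) (\<sigma> (Cod J u))) (FArr F u) =
        Comp C (FArr F'' u) (Comp C (\<tau> (Dom J u)) (\<sigma> (Dom J u)))" if u: "u \<in> Arr J" for u
  proof -
    note h = Arr_imp_Hom[OF u]
    have o: "Dom J u \<in> Obj J" "Cod J u \<in> Obj J" using Hom_Obj[OF J h] by auto
    note m = is_functorD(4)[OF fF(1) h] is_functorD(4)[OF fF(2) h] is_functorD(4)[OF fF(3) h]
    have "Comp C (Comp C (\<tau> (Cod J u)) (\<sigma> (Cod J u))) (FArr F u) =
          Comp C (\<tau> (Cod J u)) (Comp C (\<sigma> (Cod J u)) (FArr F u))"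
      using Comp_assoc[OF C m(1) \<sigma>(2)[OF o(2)] \<tau>(2)[OF o(2)]] by simp
    also have "\<dots> = Comp C (\<tau> (Cod J u)) (Comp C (FArr F' u) (\<sigma> (Dom J u)))"
      using \<sigma>(3)[OF u] by simp
    also have "\<dots> = Comp C (Comp C (\<tau> (Cod J u)) (FArr F' u)) (\<sigma> (Dom J u))"
      using Comp_assoc[OF C \<sigma>(2)[OF o(1)] m(2) \<tau>(2)[OF o(2)]] by simp
    also have "\<dots> = Comp C (Comp C (FArr F'' u) (\<tau> (Dom J u))) (\<sigma> (Dom J u))"
      using \<tau>(3)[OF u] by simp
    also have "\<dots> = Comp C (FArr F'' u) (Comp C (\<tau> (Dom J u)) (\<sigma> (Dom J u)))"
      using Comp_assoc[OF C \<sigma>(2)[OF o(1)] \<tau>(2)[OF o(1)] m(3)] by simp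
    finally show ?thesis .
  qed
  then show "Comp ?E g f \<in> Hom ?E F F''"
    unfolding Hom_functor_category \<sigma>(1) \<tau>(1) functor_category_simps(5)
    using FF Comp_Hom[OF C \<sigma>(2) \<tau>(2)] J
    by (intro conjI bexI[of _ "\<lambda>a\<in>Obj J. Comp C (\<tau> a) (\<sigma> a)"])
       (auto simp: Hom_Obj[OF J Arr_imp_Hom])
next
  fix F F' f assume f: "f \<in> Hom ?E F F'"
  obtain \<sigma> where \<sigma>: "f = (F, \<sigma>, F')" "\<And>a. a \<in> Obj J \<Longrightarrow> \<sigma> a \<in> Hom C (FObj F a) (FObj F' a)"
    "\<sigma> \<in> extensional (Obj J)"
    using f unfolding Hom_functor_category by blast
  have "(\<lambda>a\<in>Obj J. Comp C (\<sigma> a) ((\<lambda>a\<in>Obj J. Id C (FObj F a)) a)) = \<sigma>"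
       "(\<lambda>a\<in>Obj J. Comp C ((\<lambda>a\<in>Obj J. Id C (FObj F' a)) a) (\<sigma> a)) = \<sigma>"
    using \<sigma>(3) Comp_Id_left[OF C \<sigma>(2)] Comp_Id_right[OF C \<sigma>(2)]
    by (auto simp: fun_eq_iff extensional_def)
  then show "Comp ?E f (Id ?E F) = f \<and> Comp ?E (Id ?E F') f = f"
    unfolding \<sigma>(1) functor_category_simps by simp
next
  fix F0 F1 F2 F3 f g h
  assume f: "f \<in> Hom ?E F0 F1" and g: "g \<in> Hom ?E F1 F2" and h: "h \<in> Hom ?E F2 F3"
  obtain \<sigma> where \<sigma>: "f = (F0, \<sigma>, F1)" "\<And>a. a \<in> Obj J \<Longrightarrow> \<sigma> a \<in> Hom C (FObj F0 a) (FObj F1 a)"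
    using f unfolding Hom_functor_category by blast
  obtain \<tau> where \<tau>: "g = (F1, \<tau>, F2)" "\<And>a. a \<in> Obj J \<Longrightarrow> \<tau> a \<in> Hom C (FObj F1 a) (FObj F2 a)"
    using g unfolding Hom_functor_category by blast
  obtain \<rho> where \<rho>: "h = (F2, \<rho>, F3)" "\<And>a. a \<in> Obj J \<Longrightarrow> \<rho> a \<in> Hom C (FObj F2 a) (FObj F3 a)"
    using h unfolding Hom_functor_category by blast
  show "Comp ?E h (Comp ?E g f) = Comp ?E (Comp ?E h g) f"
    unfolding \<sigma>(1) \<tau>(1) \<rho>(1) functor_category_simps
    using Comp_assoc[OF C \<sigma>(2) \<tau>(2) \<rho>(2)] by (auto intro!: restrict_ext)
qed

section \<open>Hom-functors, cocones and colimits\<close>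

lemma is_functor_hom_functor:
  assumes C: "is_category C"
  shows "is_functor C (set_category (\<lambda>_. True)) (hom_functor C A)"
proof (rule is_functorI[OF C is_category_set])
  fix f a b assume f: "f \<in> Hom C a b"
  then have "Dom C f = a" "Cod C f = b" by (auto simp: Hom_iff)
  then show "FArr (hom_functor C A) f \<in> Hom (set_category (\<lambda>_. True))
      (FObj (hom_functor C A) a) (FObj (hom_functor C A) b)"
    using Comp_Hom[OF C _ f] by (auto simp: hom_functor_def Hom_set_category)
next
  fix a assume a: "a \<in> Obj C"
  then have "Dom C (Id C a) = a" "Cod C (Id C a) = a" using Id_Hom[OF C] by (auto simp: Hom_iff)
  then show "FArr (hom_functor C A) (Id C a) = Id (set_category (\<lambda>_. True)) (FObj (hom_functor C A)
      a)"
    using Comp_Id_left[OF C] by (auto simp: hom_functor_def intro!: restrict_ext)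
next
  fix f g a b c assume f: "f \<in> Hom C a b" and g: "g \<in> Hom C b c"
  have "Dom C f = a" "Cod C f = b" "Dom C g = b" "Cod C g = c" using f g by (auto simp: Hom_iff)
  moreover have "Dom C (Comp C g f) = a" "Cod C (Comp C g f) = c"
    using Comp_Hom[OF C f g] by (auto simp: Hom_iff)
  ultimately show "FArr (hom_functor C A) (Comp C g f) =
      Comp (set_category (\<lambda>_. True)) (FArr (hom_functor C A) g) (FArr (hom_functor C A) f)"
    using Comp_assoc[OF C _ f g] Comp_Hom[OF C _ f]
      by (auto simp: hom_functor_def intro!: restrict_ext)
qed auto

lemma is_functor_comp:
  assumes F: "is_functor C D F" and H: "is_functor D E H"
  shows "is_functor C E (functor_comp H F)"
proof (rule is_functorI[OF is_functorD(1)[OF F] is_functorD(2)[OF H]])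
  fix f g a b c assume f: "f \<in> Hom C a b" and g: "g \<in> Hom C b c"
  then show "FArr (functor_comp H F) (Comp C g f) =
      Comp E (FArr (functor_comp H F) g) (FArr (functor_comp H F) f)"
    using is_functorD(6)[OF F f g] is_functorD(6)[OF H is_functorD(4)[OF F f] is_functorD(4)[OF F
      g]]
    by (simp add: functor_comp_def)
qed (use is_functorD[OF F] is_functorD[OF H] in \<open>auto simp: functor_comp_def\<close>)

lemma cocone_functor:
  assumes H: "is_functor C E H" and D: "is_functor J C D" and c: "cocone J C D L c"
  shows "cocone J E (functor_comp H D) (FObj H L) (\<lambda>i. FArr H (c i))"
proof -
  have "Comp E (FArr H (c (Cod J u))) (FArr H (FArr D u)) = FArr H (c (Dom J u))" if u: "u \<in> Arr J"
      for u
  proof -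
    note h = Arr_imp_Hom[OF u]
    have "Cod J u \<in> Obj J" using Hom_Obj[OF is_functorD(1)[OF D] h] by auto
    then have "c (Cod J u) \<in> Hom C (FObj D (Cod J u)) L" using c unfolding cocone_def by blast
    then have "FArr H (Comp C (c (Cod J u)) (FArr D u)) = Comp E (FArr H (c (Cod J u))) (FArr H
        (FArr D u))"
      by (rule is_functorD(6)[OF H is_functorD(4)[OF D h]])
    then show ?thesis using c u unfolding cocone_def by metis
  qed
  then show ?thesis
    using c is_functorD(3,4)[OF H] unfolding cocone_def by (simp add: functor_comp_def)
qed

lemma is_colimitD:
  assumes "is_colimit J C D L c"
  shows "is_functor J C D" "cocone J C D L c" "is_category J" "is_category C" "L \<in> Obj C"
    "\<And>i. i \<in> Obj J \<Longrightarrow> c i \<in> Hom C (FObj D i) L"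
  using assms by (auto simp: is_colimit_def cocone_def is_functor_def)

lemma colimit_factor:
  assumes "is_colimit J C D L c" and "cocone J C D L' c'"
  obtains h where "h \<in> Hom C L L'" "\<And>i. i \<in> Obj J \<Longrightarrow> Comp C h (c i) = c' i"
proof -
  have "\<exists>!h. h \<in> Hom C L L' \<and> (\<forall>i\<in>Obj J. Comp C h (c i) = c' i)"
    using assms unfolding is_colimit_def by blast
  then show ?thesis using that by blast
qed

text \<open>Both arrows mediate for the cocone obtained by composing \<open>c\<close> with
  \<open>h\<close>, so they agree by uniqueness.\<close>

lemma colimit_eqI:
  assumes L: "is_colimit J C D L c" and h: "h \<in> Hom C L L'" and k: "k \<in> Hom C L L'"
    and e: "\<And>i. i \<in> Obj J \<Longrightarrow> Comp C h (c i) = Comp C k (c i)"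
  shows "h = k"
proof -
  note D = is_colimitD[OF L]
  have "Comp C (Comp C h (c (Cod J u))) (FArr D u) = Comp C h (c (Dom J u))" if u: "u \<in> Arr J" for u
  proof -
    note o = Hom_Obj[OF D(3) Arr_imp_Hom[OF u]]
    have "Comp C (c (Cod J u)) (FArr D u) = c (Dom J u)" using D(2) u unfolding cocone_def by blast
    then show ?thesis
      using Comp_assoc[OF D(4) is_functorD(4)[OF D(1) Arr_imp_Hom[OF u]] D(6) h] o by simp
  qed
  moreover have "L' \<in> Obj C" using Hom_Obj[OF D(4) h] by simp
  ultimately have "cocone J C D L' (\<lambda>i. Comp C h (c i))"
    using Comp_Hom[OF D(4) D(6) h] unfolding cocone_def by blast
  then have "\<exists>!g. g \<in> Hom C L L' \<and> (\<forall>i\<in>Obj J. Comp C g (c i) = Comp C h (c i))"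
    using L unfolding is_colimit_def by blast
  then show ?thesis using h k e by metis
qed

text \<open>The isomorphism respects the two cocones, so whatever is known about the elements of a
  constructed colimit can be carried over to any given one.\<close>

lemma colimit_unique:
  assumes C: "is_category C" and L: "is_colimit J C D L c" and L': "is_colimit J C D L' c'"
  obtains h k where "h \<in> Hom C L L'" "k \<in> Hom C L' L" "Comp C k h = Id C L" "Comp C h k = Id C L'"
    "\<And>i. i \<in> Obj J \<Longrightarrow> Comp C h (c i) = c' i" "\<And>i. i \<in> Obj J \<Longrightarrow> Comp C k (c' i) = c i"
proof -
  have cc: "cocone J C D L c" and cc': "cocone J C D L' c'" using L L'
      by (auto simp: is_colimit_def)
  obtain h where h: "h \<in> Hom C L L'" "\<And>i. i \<in> Obj J \<Longrightarrow> Comp C h (c i) = c' i"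
    using colimit_factor[OF L cc'] by blast
  obtain k where k: "k \<in> Hom C L' L" "\<And>i. i \<in> Obj J \<Longrightarrow> Comp C k (c' i) = c i"
    using colimit_factor[OF L' cc] by blast
  have ci: "c i \<in> Hom C (FObj D i) L" "c' i \<in> Hom C (FObj D i) L'" if "i \<in> Obj J" for i
    using that cc cc' unfolding cocone_def by auto
  have o: "L \<in> Obj C" "L' \<in> Obj C" using cc cc' unfolding cocone_def by auto
  have "Comp C (Comp C k h) (c i) = c i" "Comp C (Comp C h k) (c' i) = c' i" if i: "i \<in> Obj J" for i
    using Comp_assoc[OF C ci(1)[OF i] h(1) k(1)] Comp_assoc[OF C ci(2)[OF i] k(1) h(1)] h(2) k(2) i
    by simp_all
  moreover have "Comp C (Id C L) (c i) = c i" "Comp C (Id C L') (c' i) = c' i" if "i \<in> Obj J" for i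
    using Comp_Id_left[OF C] ci[OF that] by auto
  ultimately have "Comp C k h = Id C L" "Comp C h k = Id C L'"
    using colimit_eqI[OF L Comp_Hom[OF C h(1) k(1)] Id_Hom[OF C o(1)]]
      colimit_eqI[OF L' Comp_Hom[OF C k(1) h(1)] Id_Hom[OF C o(2)]] by simp_all
  then show ?thesis using that h k by blast
qed

section \<open>Directed posets and directed colimits of sets\<close>

lemma poset_category_simps [simp]:
  "Obj (poset_category I r) = I" "Arr (poset_category I r) = r"
  "Dom (poset_category I r) = fst" "Cod (poset_category I r) = snd"
  "Id (poset_category I r) = (\<lambda>i. (i, i))"
  "Comp (poset_category I r) = (\<lambda>q p. (fst p, snd q))"
  by (simp_all add: poset_category_def)

lemma Hom_poset_category: "p \<in> Hom (poset_category I r) i j \<longleftrightarrow> (i, j) \<in> r \<and> p = (i, j)"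
  by (auto simp: Hom_iff)

lemma directed_poset_refl: "directed_poset I r \<Longrightarrow> i \<in> I \<Longrightarrow> (i, i) \<in> r"
  by (auto simp: directed_poset_def partial_order_on_def preorder_on_def refl_on_def)

lemma directed_poset_trans: "directed_poset I r \<Longrightarrow> (i, j) \<in> r \<Longrightarrow> (j, k) \<in> r \<Longrightarrow> (i, k) \<in> r"
  by (auto simp: directed_poset_def partial_order_on_def preorder_on_def dest: transD)

lemma directed_poset_field: "directed_poset I r \<Longrightarrow> (i, j) \<in> r \<Longrightarrow> i \<in> I \<and> j \<in> I"
  by (auto simp: directed_poset_def partial_order_on_def preorder_on_def)

lemma directed_poset_upper:
  "directed_poset I r \<Longrightarrow> i \<in> I \<Longrightarrow> j \<in> I \<Longrightarrow> \<exists>k\<in>I. (i, k) \<in> r \<and> (j, k) \<in> r"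
  by (auto simp: directed_poset_def)

lemma directed_poset_category: "directed_poset I r \<Longrightarrow> is_category (poset_category I r)"
  by (auto simp: directed_poset_def is_category_poset)

text \<open>The cocone can be corestricted to the union \<open>?M\<close> of its images. The
  mediating map into \<open>?M\<close>, followed by the inclusion into \<open>L\<close>, is the
  identity by uniqueness, hence \<open>?M\<close> is all of \<open>L\<close>.\<close>

lemma set_colimit_jointly_surjective:
  fixes D :: "('i, 'j, 'a set, 'a set \<times> ('a \<Rightarrow> 'a) \<times> 'a set) cat_functor"
  assumes col: "is_colimit J (set_category (\<lambda>_. True)) D L c" and x: "x \<in> L"
  obtains i y where "i \<in> Obj J" "y \<in> FObj D i" "arr_fun (c i) y = x"
proof -
  let ?S = "set_category (\<lambda>_ :: 'a set. True)"
  have cc: "cocone J ?S D L c" and D: "is_functor J ?S D" using col by (auto simp: is_colimit_def)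
  have c: "c i \<in> Hom ?S (FObj D i) L" if "i \<in> Obj J" for i
    using that cc unfolding cocone_def by auto
  let ?M = "\<Union>i\<in>Obj J. arr_fun (c i) ` FObj D i"
  have M: "?M \<subseteq> L" using c by (fastforce elim!: set_HomE)
  let ?c = "\<lambda>i. (FObj D i, arr_fun (c i), ?M)"
  have c': "?c i \<in> Hom ?S (FObj D i) ?M" if "i \<in> Obj J" for i
    using c[OF that] that by (auto simp: Hom_set_category PiE_iff)
  have "Comp ?S (?c (Cod J u)) (FArr D u) = ?c (Dom J u)" if u: "u \<in> Arr J" for u
  proof (rule set_Hom_eqI)
    note h = Arr_imp_Hom[OF u]
    note o = Hom_Obj[OF is_functorD(1)[OF D] h] and m = is_functorD(4)[OF D h]
    show "Comp ?S (?c (Cod J u)) (FArr D u) \<in> Hom ?S (FObj D (Dom J u)) ?M"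
      by (rule Comp_Hom[OF is_category_set m]) (use o c' in blast)
    show "?c (Dom J u) \<in> Hom ?S (FObj D (Dom J u)) ?M" using o c' by blast
    fix x assume x: "x \<in> FObj D (Dom J u)"
    have "Comp ?S (c (Cod J u)) (FArr D u) = c (Dom J u)" using cc u unfolding cocone_def by blast
    then show "arr_fun (Comp ?S (?c (Cod J u)) (FArr D u)) x = arr_fun (?c (Dom J u)) x"
      using arr_fun_Comp[OF m c'[of "Cod J u"] x] arr_fun_Comp[OF m c[of "Cod J u"] x] o by simp
  qed
  then have "cocone J ?S D ?M ?c" using c' unfolding cocone_def by simp
  then obtain h where h: "h \<in> Hom ?S L ?M" "\<And>i. i \<in> Obj J \<Longrightarrow> Comp ?S h (c i) = ?c i"
    using colimit_factor[OF col] by blast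
  \<comment> \<open>The same function as \<open>h\<close>, now read as a map into \<open>L\<close>:
    this is \<open>h\<close> followed by the inclusion of \<open>?M\<close>.\<close>
  let ?k = "(L, arr_fun h, L)"
  have k: "?k \<in> Hom ?S L L" using h(1) M by (fastforce simp: Hom_set_category PiE_iff)
  have "Comp ?S ?k (c i) = c i" if i: "i \<in> Obj J" for i
  proof (rule set_Hom_eqI[OF Comp_Hom[OF is_category_set c[OF i] k] c[OF i]])
    fix y assume y: "y \<in> FObj D i"
    have "arr_fun (Comp ?S h (c i)) y = arr_fun (c i) y" using h(2)[OF i] by simp
    then show "arr_fun (Comp ?S ?k (c i)) y = arr_fun (c i) y"
      using arr_fun_Comp[OF c[OF i] k y] arr_fun_Comp[OF c[OF i] h(1) y] by simp
  qed
  moreover have "Comp ?S (Id ?S L) (c i) = c i" if i: "i \<in> Obj J" for i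
    using Comp_Id_left[OF is_category_set c[OF i]] .
  moreover have "Id ?S L \<in> Hom ?S L L" by (rule Id_Hom[OF is_category_set]) simp
  ultimately have "?k = Id ?S L" using colimit_eqI[OF col k] by simp
  then have "arr_fun h x = x" using x by (simp add: restrict_def fun_eq_iff)
  moreover have "arr_fun h x \<in> ?M" using h(1) x by (auto simp: Hom_set_category PiE_iff)
  ultimately show ?thesis using that by auto
qed

text \<open>The injectivity hypothesis compares elements of one stage only. Elements of different
  stages are first moved to a common later stage, which directedness provides.\<close>

lemma set_directed_colimitI:
  fixes D :: "('i, 'i \<times> 'i, 'a set, 'a set \<times> ('a \<Rightarrow> 'a) \<times> 'a set) cat_functor"
  assumes dir: "directed_poset I r"
    and D: "is_functor (poset_category I r) (set_category (\<lambda>_. True)) D"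
    and cc: "cocone (poset_category I r) (set_category (\<lambda>_. True)) D L c"
    and surj: "\<And>x. x \<in> L \<Longrightarrow> \<exists>i\<in>I. \<exists>y\<in>FObj D i. arr_fun (c i) y = x"
    and inj: "\<And>i y y'. i \<in> I \<Longrightarrow> y \<in> FObj D i \<Longrightarrow> y' \<in> FObj D i \<Longrightarrow>
      arr_fun (c i) y = arr_fun (c i) y' \<Longrightarrow>
      \<exists>k. (i, k) \<in> r \<and> arr_fun (FArr D (i, k)) y = arr_fun (FArr D (i, k)) y'"
  shows "is_colimit (poset_category I r) (set_category (\<lambda>_. True)) D L c"
  unfolding is_colimit_def
proof (intro conjI allI impI D cc)
  let ?S = "set_category (\<lambda>_ :: 'a set. True)" and ?J = "poset_category I r"
  fix L' c' assume cc': "cocone ?J ?S D L' c'"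
  have c: "c i \<in> Hom ?S (FObj D i) L" if "i \<in> I" for i using that cc unfolding cocone_def by auto
  have c': "c' i \<in> Hom ?S (FObj D i) L'" if "i \<in> I" for i using that cc' unfolding cocone_def
      by auto
  have d: "FArr D (i, k) \<in> Hom ?S (FObj D i) (FObj D k)" if "(i, k) \<in> r" for i k
    using is_functorD(4)[OF D] that by (simp add: Hom_poset_category)
  have dc: "arr_fun (c k) (arr_fun (FArr D (i, k)) y) = arr_fun (c i) y"
    and dc': "arr_fun (c' k) (arr_fun (FArr D (i, k)) y) = arr_fun (c' i) y"
    and dm: "arr_fun (FArr D (i, k)) y \<in> FObj D k"
    if "(i, k) \<in> r" "y \<in> FObj D i" for i k y
  proof -
    have k: "k \<in> I" using directed_poset_field[OF dir that(1)] by auto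
    have "Comp ?S (c k) (FArr D (i, k)) = c i" "Comp ?S (c' k) (FArr D (i, k)) = c' i"
      using cc cc' that(1) unfolding cocone_def by force+
    then show "arr_fun (c k) (arr_fun (FArr D (i, k)) y) = arr_fun (c i) y"
      "arr_fun (c' k) (arr_fun (FArr D (i, k)) y) = arr_fun (c' i) y"
      using arr_fun_Comp[OF d[OF that(1)] c[OF k] that(2)]
        arr_fun_Comp[OF d[OF that(1)] c'[OF k] that(2)]
      by auto
    show "arr_fun (FArr D (i, k)) y \<in> FObj D k"
      using d[OF that(1)] that(2) by (auto simp: Hom_set_category PiE_iff)
  qed
  \<comment> \<open>The mediating map will be defined through an arbitrary preimage at some stage;
    this shows that the preimage does not matter.\<close>
  have wd: "arr_fun (c' i) y = arr_fun (c' j) z"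
    if i: "i \<in> I" "y \<in> FObj D i" and j: "j \<in> I" "z \<in> FObj D j"
      and e: "arr_fun (c i) y = arr_fun (c j) z" for i j y z
  proof -
    obtain k where k: "k \<in> I" "(i, k) \<in> r" "(j, k) \<in> r"
      using directed_poset_upper[OF dir i(1) j(1)] by blast
    obtain l where l: "(k, l) \<in> r" "arr_fun (FArr D (k, l)) (arr_fun (FArr D (i, k)) y) =
        arr_fun (FArr D (k, l)) (arr_fun (FArr D (j, k)) z)"
      using inj[OF k(1) dm[OF k(2) i(2)] dm[OF k(3) j(2)]] dc[OF k(2) i(2)] dc[OF k(3) j(2)] e
        by auto
    then show ?thesis
      using dc' dm k i j by metis
  qed
  have "\<forall>x\<in>L. \<exists>i y. i \<in> I \<and> y \<in> FObj D i \<and> arr_fun (c i) y = x" using surj by blast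
  then obtain \<iota> \<upsilon> where s: "\<And>x. x \<in> L \<Longrightarrow> \<iota> x \<in> I \<and> \<upsilon> x \<in> FObj D (\<iota> x) \<and> arr_fun (c (\<iota> x)) (\<upsilon> x) = x"
    by metis
  define h where "h x = arr_fun (c' (\<iota> x)) (\<upsilon> x)" for x
  have hc: "h (arr_fun (c i) y) = arr_fun (c' i) y" if "i \<in> I" "y \<in> FObj D i" for i y
    using wd[OF _ _ that] s[OF set_Hom_mem[OF c[OF that(1)] that(2)]] unfolding h_def by blast
  let ?h = "(L, restrict h L, L')"
  have h: "?h \<in> Hom ?S L L'"
  proof -
    have "h x \<in> L'" if "x \<in> L" for x
      using s[OF that] set_Hom_mem[OF c'] unfolding h_def by blast
    then show ?thesis by (auto simp: Hom_set_category)
  qed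
  have hci: "Comp ?S ?h (c i) = c' i" if i: "i \<in> I" for i
  proof (rule set_Hom_eqI[OF Comp_Hom[OF is_category_set c[OF i] h] c'[OF i]])
    fix y assume y: "y \<in> FObj D i"
    then have "arr_fun (c i) y \<in> L" using set_Hom_mem[OF c[OF i]] by blast
    then show "arr_fun (Comp ?S ?h (c i)) y = arr_fun (c' i) y"
      using arr_fun_Comp[OF c[OF i] h y] hc[OF i y] by simp
  qed
  show "\<exists>!h. h \<in> Hom ?S L L' \<and> (\<forall>i\<in>Obj ?J. Comp ?S h (c i) = c' i)"
  proof (rule ex1I[of _ ?h])
    show "?h \<in> Hom ?S L L' \<and> (\<forall>i\<in>Obj ?J. Comp ?S ?h (c i) = c' i)" using h hci by simp
    fix k assume k: "k \<in> Hom ?S L L' \<and> (\<forall>i\<in>Obj ?J. Comp ?S k (c i) = c' i)"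
    show "k = ?h"
    proof (rule set_Hom_eqI[OF conjunct1[OF k] h])
      fix x assume "x \<in> L"
      then obtain i y where i: "i \<in> I" "y \<in> FObj D i" "arr_fun (c i) y = x" using surj by blast
      have "Comp ?S k (c i) = Comp ?S ?h (c i)" using k hci i(1) by simp
      then show "arr_fun k x = arr_fun ?h x"
        using arr_fun_Comp[OF c[OF i(1)] conjunct1[OF k] i(2)] arr_fun_Comp[OF c[OF i(1)] h i(2)]
          i(3)
        by simp
    qed
  qed
qed

lemma hom_functor_preservesI:
  assumes C: "is_category C" and dir: "directed_poset I r"
    and D: "is_functor (poset_category I r) C D"
    and cc: "cocone (poset_category I r) C D L c"
    and surj: "\<And>p. p \<in> Hom C A L \<Longrightarrow> \<exists>i\<in>I. \<exists>q\<in>Hom C A (FObj D i). Comp C (c i) q = p"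
    and inj: "\<And>i q q'. i \<in> I \<Longrightarrow> q \<in> Hom C A (FObj D i) \<Longrightarrow> q' \<in> Hom C A (FObj D i) \<Longrightarrow>
      Comp C (c i) q = Comp C (c i) q' \<Longrightarrow>
      \<exists>k. (i, k) \<in> r \<and> Comp C (FArr D (i, k)) q = Comp C (FArr D (i, k)) q'"
  shows "is_colimit (poset_category I r) (set_category (\<lambda>_. True))
    (functor_comp (hom_functor C A) D) (FObj (hom_functor C A) L) (\<lambda>i. FArr (hom_functor C A) (c
        i))"
proof (rule set_directed_colimitI[OF dir is_functor_comp[OF D is_functor_hom_functor[OF C]]
      cocone_functor[OF is_functor_hom_functor[OF C] D cc]])
  have c: "c i \<in> Hom C (FObj D i) L" if "i \<in> I" for i using that cc unfolding cocone_def by auto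
  have ha: "arr_fun (FArr (hom_functor C A) f) q = Comp C f q" if "q \<in> Hom C A b" "f \<in> Hom C b b'"
      for q f b b'
    using that by (simp add: hom_functor_def Hom_iff[of f])
  {
    fix x assume "x \<in> FObj (hom_functor C A) L"
    then have "x \<in> Hom C A L" by (simp add: hom_functor_def)
    from surj[OF this] obtain i q where "i \<in> I" "q \<in> Hom C A (FObj D i)" "Comp C (c i) q = x"
        by blast
    moreover from this have "arr_fun (FArr (hom_functor C A) (c i)) q = x" using ha[OF _ c] by blast
    ultimately show "\<exists>i\<in>I. \<exists>y\<in>FObj (functor_comp (hom_functor C A) D) i.
        arr_fun (FArr (hom_functor C A) (c i)) y = x"
      by (intro bexI[of _ i] bexI[of _ q]) (simp_all add: functor_comp_def hom_functor_def)
  next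
    fix i q q' assume i: "i \<in> I" and "q \<in> FObj (functor_comp (hom_functor C A) D) i"
      "q' \<in> FObj (functor_comp (hom_functor C A) D) i"
      and e: "arr_fun (FArr (hom_functor C A) (c i)) q = arr_fun (FArr (hom_functor C A) (c i)) q'"
    then have q: "q \<in> Hom C A (FObj D i)" "q' \<in> Hom C A (FObj D i)"
      by (auto simp: functor_comp_def hom_functor_def)
    then obtain k where k: "(i, k) \<in> r" "Comp C (FArr D (i, k)) q = Comp C (FArr D (i, k)) q'"
      using inj[OF i] e ha c[OF i] by metis
    have "FArr D (i, k) \<in> Hom C (FObj D i) (FObj D k)"
      using is_functorD(4)[OF D] k(1) by (simp add: Hom_poset_category)
    then show "\<exists>k. (i, k) \<in> r \<and> arr_fun (FArr (functor_comp (hom_functor C A) D) (i, k)) q =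
        arr_fun (FArr (functor_comp (hom_functor C A) D) (i, k)) q'"
      using ha q k by (intro exI[of _ k]) (simp add: functor_comp_def)
  }
qed

text \<open>Applied with \<open>p\<close> an identity: if \<open>A\<close> itself is the colimit, it
  becomes a retract of some stage of the diagram.\<close>

lemma preserves_colimits_factor:
  assumes C: "is_category C"
    and pres: "preserves_colimits J C (set_category (\<lambda>_. True)) (hom_functor C A) D"
    and col: "is_colimit J C D L c" and p: "p \<in> Hom C A L"
  obtains i q where "i \<in> Obj J" "q \<in> Hom C A (FObj D i)" "Comp C (c i) q = p"
proof -
  have "is_colimit J (set_category (\<lambda>_. True)) (functor_comp (hom_functor C A) D)
      (FObj (hom_functor C A) L) (\<lambda>i. FArr (hom_functor C A) (c i))"
    using pres col unfolding preserves_colimits_def by blast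
  moreover have "p \<in> FObj (hom_functor C A) L" using p by (simp add: hom_functor_def)
  ultimately obtain i q where i: "i \<in> Obj J" "q \<in> FObj (functor_comp (hom_functor C A) D) i"
    "arr_fun (FArr (hom_functor C A) (c i)) q = p"
    by (rule set_colimit_jointly_surjective)
  then have q: "q \<in> Hom C A (FObj D i)" by (simp add: functor_comp_def hom_functor_def)
  have "c i \<in> Hom C (FObj D i) L" using col i(1) by (auto simp: is_colimit_def cocone_def)
  then have "Comp C (c i) q = p" using i(3) q by (simp add: hom_functor_def Hom_iff)
  then show ?thesis using that i(1) q by blast
qed

section \<open>Presheaves on a groupoid, elementwise\<close>

locale groupoid_presheaves = set_universe small
  for small :: "'u set \<Rightarrow> bool" +
  fixes G :: "('o, 'm) category"
  assumes groupoid: "groupoid G" and small_groupoid: "small_category small G"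
begin

abbreviation "PSh \<equiv> presheaves small G"

definition act where "act F f = arr_fun (FArr F f)"

definition app where "app \<eta> a = arr_fun (fst (snd \<eta>) a)"

lemma cat_G: "is_category G" using groupoid by (simp add: groupoid_def)

lemma cat_PSh: "is_category PSh"
  unfolding presheaves_def
  by (rule is_category_functor_category[OF is_category_opposite[OF cat_G] is_category_set])

lemma small_Obj: "small_sized small (Obj G)" and small_Arr: "small_sized small (Arr G)"
  using small_groupoid by (auto simp: small_category_def)

lemma G_Hom_Obj: "f \<in> Hom G a b \<Longrightarrow> a \<in> Obj G \<and> b \<in> Obj G"
  using Hom_Obj[OF cat_G] .

lemmas G_Id = Id_Hom[OF cat_G] and G_Comp = Comp_Hom[OF cat_G]
  and G_Id_right = Comp_Id_right[OF cat_G] and G_Id_left = Comp_Id_left[OF cat_G]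
  and G_assoc = Comp_assoc[OF cat_G]

definition ginv where
  "ginv f = (SOME g. g \<in> Hom G (Cod G f) (Dom G f) \<and>
     Comp G g f = Id G (Dom G f) \<and> Comp G f g = Id G (Cod G f))"

lemma ginv:
  assumes "f \<in> Hom G a b"
  shows "ginv f \<in> Hom G b a" "Comp G (ginv f) f = Id G a" "Comp G f (ginv f) = Id G b"
proof -
  have "\<exists>g. g \<in> Hom G (Cod G f) (Dom G f) \<and>
     Comp G g f = Id G (Dom G f) \<and> Comp G f g = Id G (Cod G f)"
    using groupoid assms unfolding groupoid_def iso_arr_def Hom_iff[of f] by blast
  from someI_ex[OF this] show "ginv f \<in> Hom G b a" "Comp G (ginv f) f = Id G a"
      "Comp G f (ginv f) = Id G b"
    using assms unfolding ginv_def Hom_iff[of f] by auto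
qed

lemma Hom_opposite: "f \<in> Hom (opposite G) a b \<longleftrightarrow> f \<in> Hom G b a"
  by (auto simp: Hom_iff opposite_def)

lemma opposite_simps [simp]:
  "Obj (opposite G) = Obj G" "Arr (opposite G) = Arr G" "Dom (opposite G) = Cod G"
  "Cod (opposite G) = Dom G" "Id (opposite G) = Id G" "Comp (opposite G) g f = Comp G f g"
  by (simp_all add: opposite_def)

lemma PSh_Obj:
  "F \<in> Obj PSh \<longleftrightarrow> is_functor (opposite G) (set_category small) F \<and>
     FObj F \<in> extensional (Obj G) \<and> FArr F \<in> extensional (Arr G)"
  by (simp add: presheaves_def functor_category_simps)

lemma FArr_Hom:
  assumes "F \<in> Obj PSh" "f \<in> Hom G b a"
  shows "FArr F f \<in> Hom (set_category small) (FObj F a) (FObj F b)"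
  using assms is_functorD(4)[of "opposite G" "set_category small" F f a b]
  by (simp add: PSh_Obj Hom_opposite)

lemma small_FObj: "F \<in> Obj PSh \<Longrightarrow> a \<in> Obj G \<Longrightarrow> small (FObj F a)"
  using is_functorD(3)[of "opposite G" "set_category small" F a] by (simp add: PSh_Obj)

lemma act_mem: "F \<in> Obj PSh \<Longrightarrow> f \<in> Hom G b a \<Longrightarrow> x \<in> FObj F a \<Longrightarrow> act F f x \<in> FObj F b"
  unfolding act_def by (rule set_Hom_mem[OF FArr_Hom])

lemma act_Id: "F \<in> Obj PSh \<Longrightarrow> a \<in> Obj G \<Longrightarrow> x \<in> FObj F a \<Longrightarrow> act F (Id G a) x = x"
  using is_functorD(5)[of "opposite G" "set_category small" F a]
  by (simp add: PSh_Obj act_def)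

lemma act_Comp:
  assumes F: "F \<in> Obj PSh" and f: "f \<in> Hom G c b" and g: "g \<in> Hom G b a" and x: "x \<in> FObj F a"
  shows "act F (Comp G g f) x = act F f (act F g x)"
proof -
  have "FArr F (Comp G g f) = Comp (set_category small) (FArr F f) (FArr F g)"
    using is_functorD(6)[of "opposite G" "set_category small" F g a b f c] F f g
    by (simp add: PSh_Obj Hom_opposite)
  then show ?thesis
    unfolding act_def using arr_fun_Comp[OF FArr_Hom[OF F g] FArr_Hom[OF F f] x] by simp
qed

lemma act_ginv:
  assumes F: "F \<in> Obj PSh" and f: "f \<in> Hom G b a"
  shows "x \<in> FObj F a \<Longrightarrow> act F (ginv f) (act F f x) = x"
    and "y \<in> FObj F b \<Longrightarrow> act F f (act F (ginv f) y) = y"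
  using act_Comp[OF F ginv(1)[OF f] f, of x] act_Comp[OF F f ginv(1)[OF f], of y]
    ginv(2,3)[OF f] act_Id[OF F] G_Hom_Obj[OF f] by auto

lemma PSh_HomD:
  assumes "\<eta> \<in> Hom PSh F F'"
  shows "F \<in> Obj PSh" "F' \<in> Obj PSh"
    "\<And>a x. a \<in> Obj G \<Longrightarrow> x \<in> FObj F a \<Longrightarrow> app \<eta> a x \<in> FObj F' a"
    "\<And>f a b x. f \<in> Hom G b a \<Longrightarrow> x \<in> FObj F a \<Longrightarrow> app \<eta> b (act F f x) = act F' f (app \<eta> a x)"
proof -
  obtain \<tau> where \<tau>: "\<eta> = (F, \<tau>, F')" "\<And>a. a \<in> Obj G \<Longrightarrow> \<tau> a \<in> Hom (set_category small) (FObj F a)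
      (FObj F' a)"
    "\<And>u. u \<in> Arr G \<Longrightarrow> Comp (set_category small) (\<tau> (Dom G u)) (FArr F u) =
       Comp (set_category small) (FArr F' u) (\<tau> (Cod G u))"
    and F: "F \<in> Obj PSh" "F' \<in> Obj PSh"
    using assms unfolding presheaves_def Hom_functor_category by auto
  show "F \<in> Obj PSh" "F' \<in> Obj PSh" by fact+
  show "app \<eta> a x \<in> FObj F' a" if "a \<in> Obj G" "x \<in> FObj F a" for a x
    using set_Hom_mem[OF \<tau>(2)] that by (simp add: app_def \<tau>(1))
  fix f a b x assume f: "f \<in> Hom G b a" and x: "x \<in> FObj F a"
  have o: "a \<in> Obj G" "b \<in> Obj G" using G_Hom_Obj[OF f] by auto
  have "Comp (set_category small) (\<tau> b) (FArr F f) = Comp (set_category small) (FArr F' f) (\<tau> a)"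
    using \<tau>(3)[of f] f by (simp add: Hom_iff)
  then show "app \<eta> b (act F f x) = act F' f (app \<eta> a x)"
    using arr_fun_Comp[OF FArr_Hom[OF F(1) f] \<tau>(2)[OF o(2)] x]
      arr_fun_Comp[OF \<tau>(2)[OF o(1)] FArr_Hom[OF F(2) f] x]
    by (simp add: app_def act_def \<tau>(1))
qed

lemma PSh_Hom_eqI:
  assumes "\<eta> \<in> Hom PSh F F'" "\<eta>' \<in> Hom PSh F F'"
    and e: "\<And>a x. a \<in> Obj G \<Longrightarrow> x \<in> FObj F a \<Longrightarrow> app \<eta> a x = app \<eta>' a x"
  shows "\<eta> = \<eta>'"
proof -
  obtain \<tau> where \<tau>: "\<eta> = (F, \<tau>, F')" "\<And>a. a \<in> Obj G \<Longrightarrow> \<tau> a \<in> Hom (set_category small) (FObj F a)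
      (FObj F' a)"
    "\<tau> \<in> extensional (Obj G)"
    using assms(1) unfolding presheaves_def Hom_functor_category by auto
  obtain \<tau>' where \<tau>': "\<eta>' = (F, \<tau>', F')" "\<And>a. a \<in> Obj G \<Longrightarrow> \<tau>' a \<in> Hom (set_category small) (FObj F a)
      (FObj F' a)"
    "\<tau>' \<in> extensional (Obj G)"
    using assms(2) unfolding presheaves_def Hom_functor_category by auto
  have "\<tau> a = \<tau>' a" if "a \<in> Obj G" for a
    using set_Hom_eqI[OF \<tau>(2)[OF that] \<tau>'(2)[OF that]] e[OF that] by (simp add: app_def \<tau>(1) \<tau>'(1))
  then have "\<tau> = \<tau>'" by (rule extensionalityI[OF \<tau>(3) \<tau>'(3)])
  then show ?thesis using \<tau>(1) \<tau>'(1) by simp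
qed

lemma app_Comp:
  assumes f: "f \<in> Hom PSh F F'" and g: "g \<in> Hom PSh F' F''" and a: "a \<in> Obj G" and x: "x \<in> FObj F a"
  shows "app (Comp PSh g f) a x = app g a (app f a x)"
proof -
  obtain \<sigma> where \<sigma>: "f = (F, \<sigma>, F')" "\<And>a. a \<in> Obj G \<Longrightarrow> \<sigma> a \<in> Hom (set_category small) (FObj F a)
      (FObj F' a)"
    using f unfolding presheaves_def Hom_functor_category by auto
  obtain \<tau> where \<tau>: "g = (F', \<tau>, F'')" "\<And>a. a \<in> Obj G \<Longrightarrow> \<tau> a \<in> Hom (set_category small) (FObj F' a)
      (FObj F'' a)"
    using g unfolding presheaves_def Hom_functor_category by auto
  show ?thesis
    using arr_fun_Comp[OF \<sigma>(2)[OF a] \<tau>(2)[OF a] x] a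
    by (simp add: app_def \<sigma>(1) \<tau>(1) presheaves_def functor_category_simps)
qed

lemma app_Id: "F \<in> Obj PSh \<Longrightarrow> a \<in> Obj G \<Longrightarrow> x \<in> FObj F a \<Longrightarrow> app (Id PSh F) a x = x"
  by (simp add: presheaves_def functor_category_simps app_def)

section \<open>Presheaves and their maps built from elements\<close>

definition mk_arr where
  "mk_arr F t F' = (F, \<lambda>a\<in>Obj G. (FObj F a, \<lambda>x\<in>FObj F a. t a x, FObj F' a), F')"

lemma app_mk_arr [simp]: "a \<in> Obj G \<Longrightarrow> x \<in> FObj F a \<Longrightarrow> app (mk_arr F t F') a x = t a x"
  by (simp add: mk_arr_def app_def)

lemma mk_arr_Hom:
  assumes F: "F \<in> Obj PSh" and F': "F' \<in> Obj PSh"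
    and t: "\<And>a x. a \<in> Obj G \<Longrightarrow> x \<in> FObj F a \<Longrightarrow> t a x \<in> FObj F' a"
    and n: "\<And>f a b x. f \<in> Hom G b a \<Longrightarrow> x \<in> FObj F a \<Longrightarrow> t b (act F f x) = act F' f (t a x)"
  shows "mk_arr F t F' \<in> Hom PSh F F'"
proof -
  let ?t = "\<lambda>a\<in>Obj G. (FObj F a, \<lambda>x\<in>FObj F a. t a x, FObj F' a)"
  have H: "?t a \<in> Hom (set_category small) (FObj F a) (FObj F' a)" if "a \<in> Obj G" for a
    using that t small_FObj F F' by (auto simp: Hom_set_category)
  have "Comp (set_category small) (?t (Dom G u)) (FArr F u) =
        Comp (set_category small) (FArr F' u) (?t (Cod G u))" if u: "u \<in> Arr G" for u
  proof -
    note h = Arr_imp_Hom[OF u]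
    have o: "Dom G u \<in> Obj G" "Cod G u \<in> Obj G" using G_Hom_Obj[OF h] by auto
    show ?thesis
    proof (rule set_Comp_cong[OF FArr_Hom[OF F h] H[OF o(1)] H[OF o(2)] FArr_Hom[OF F' h]])
      fix x assume x: "x \<in> FObj F (Cod G u)"
      then show "arr_fun (?t (Dom G u)) (arr_fun (FArr F u) x) =
          arr_fun (FArr F' u) (arr_fun (?t (Cod G u)) x)"
        using n[OF h x] act_mem[OF F h x] o by (simp add: act_def)
    qed
  qed
  then show ?thesis
    unfolding mk_arr_def using H F F' unfolding presheaves_def Hom_functor_category
    by (intro conjI bexI[of _ ?t]) auto
qed

definition mk_psh where
  "mk_psh X \<alpha> = \<lparr>FObj = \<lambda>a\<in>Obj G. X a,
     FArr = \<lambda>f\<in>Arr G. (X (Cod G f), \<lambda>x\<in>X (Cod G f). \<alpha> f x, X (Dom G f))\<rparr>"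

lemma FObj_mk_psh [simp]: "a \<in> Obj G \<Longrightarrow> FObj (mk_psh X \<alpha>) a = X a"
  by (simp add: mk_psh_def)

lemma act_mk_psh [simp]: "f \<in> Hom G b a \<Longrightarrow> x \<in> X a \<Longrightarrow> act (mk_psh X \<alpha>) f x = \<alpha> f x"
  by (simp add: mk_psh_def act_def Hom_iff)

lemma mk_psh_Obj:
  assumes s: "\<And>a. a \<in> Obj G \<Longrightarrow> small (X a)"
    and m: "\<And>f a b x. f \<in> Hom G b a \<Longrightarrow> x \<in> X a \<Longrightarrow> \<alpha> f x \<in> X b"
    and i: "\<And>a x. a \<in> Obj G \<Longrightarrow> x \<in> X a \<Longrightarrow> \<alpha> (Id G a) x = x"
    and c: "\<And>f g a b c x. f \<in> Hom G c b \<Longrightarrow> g \<in> Hom G b a \<Longrightarrow> x \<in> X a \<Longrightarrow> \<alpha> (Comp G g f) x = \<alpha> f (\<alpha> g x)"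
  shows "mk_psh X \<alpha> \<in> Obj PSh"
proof -
  let ?F = "mk_psh X \<alpha>"
  have H: "FArr ?F f = (X a, \<lambda>x\<in>X a. \<alpha> f x, X b)" if f: "f \<in> Hom G b a" for f a b
    using that by (auto simp: mk_psh_def Hom_iff)
  have "is_functor (opposite G) (set_category small) ?F"
  proof (rule is_functorI[OF is_category_opposite[OF cat_G] is_category_set])
    show "FObj ?F a \<in> Obj (set_category small)" if "a \<in> Obj (opposite G)" for a
      using that s by simp
    show "FArr ?F f \<in> Hom (set_category small) (FObj ?F a) (FObj ?F b)"
      if f: "f \<in> Hom (opposite G) a b" for f a b
    proof -
      have f: "f \<in> Hom G b a" using f by (simp add: Hom_opposite)
      show ?thesis unfolding H[OF f] using s m[OF f] G_Hom_Obj[OF f]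
          by (auto simp: Hom_set_category)
    qed
    show "FArr ?F (Id (opposite G) a) = Id (set_category small) (FObj ?F a)"
        if "a \<in> Obj (opposite G)" for a
      using that H[OF G_Id[of a]] i by (auto intro!: restrict_ext)
    show "FArr ?F (Comp (opposite G) g f) = Comp (set_category small) (FArr ?F g) (FArr ?F f)"
      if "f \<in> Hom (opposite G) a b" "g \<in> Hom (opposite G) b c" for f g a b c
    proof -
      have f: "f \<in> Hom G b a" and g: "g \<in> Hom G c b" using that by (simp_all add: Hom_opposite)
      show ?thesis
        using H[OF f] H[OF g] H[OF G_Comp[OF g f]] c[OF g f] m[OF f] by (auto intro!: restrict_ext)
    qed
  qed
  then show ?thesis unfolding PSh_Obj by (simp add: mk_psh_def)
qed

text \<open>The elements of \<open>Y a\<close> have an arbitrary type, while a presheaf takes its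
  values in \<open>'u\<close>. A class is therefore named by the code of one chosen member, and
  \<open>q\<close> sends an element to the name of its class. Colimits and coset presheaves are both
  obtained this way.\<close>

lemma quotient_presheaf:
  fixes Y :: "'o \<Rightarrow> 'x set" and \<alpha> :: "'m \<Rightarrow> 'x \<Rightarrow> 'x" and E :: "'o \<Rightarrow> ('x \<times> 'x) set"
  assumes s: "\<And>a. a \<in> Obj G \<Longrightarrow> small_sized small (Y a)"
    and m: "\<And>f a b x. f \<in> Hom G b a \<Longrightarrow> x \<in> Y a \<Longrightarrow> \<alpha> f x \<in> Y b"
    and eq: "\<And>a. a \<in> Obj G \<Longrightarrow> equiv (Y a) (E a)"
    and comp: "\<And>f a b x y. f \<in> Hom G b a \<Longrightarrow> (x, y) \<in> E a \<Longrightarrow> (\<alpha> f x, \<alpha> f y) \<in> E b"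
    and i: "\<And>a x. a \<in> Obj G \<Longrightarrow> x \<in> Y a \<Longrightarrow> (\<alpha> (Id G a) x, x) \<in> E a"
    and c: "\<And>f g a b c x. f \<in> Hom G c b \<Longrightarrow> g \<in> Hom G b a \<Longrightarrow> x \<in> Y a \<Longrightarrow>
              (\<alpha> (Comp G g f) x, \<alpha> f (\<alpha> g x)) \<in> E c"
  obtains P q where "P \<in> Obj PSh"
    "\<And>a. a \<in> Obj G \<Longrightarrow> FObj P a = q a ` Y a"
    "\<And>a x y. a \<in> Obj G \<Longrightarrow> x \<in> Y a \<Longrightarrow> y \<in> Y a \<Longrightarrow> q a x = q a y \<longleftrightarrow> (x, y) \<in> E a"
    "\<And>f a b x. f \<in> Hom G b a \<Longrightarrow> x \<in> Y a \<Longrightarrow> act P f (q a x) = q b (\<alpha> f x)"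
proof -
  have "\<forall>a\<in>Obj G. \<exists>e :: 'x \<Rightarrow> 'u. inj_on e (Y a) \<and> small (e ` Y a)"
    using s unfolding small_sized_def by blast
  then obtain e :: "'o \<Rightarrow> 'x \<Rightarrow> 'u" where e: "\<And>a. a \<in> Obj G \<Longrightarrow> inj_on (e a) (Y a)"
    "\<And>a. a \<in> Obj G \<Longrightarrow> small (e a ` Y a)" by metis
  \<comment> \<open>The choice depends on the class as a set and not on \<open>x\<close>, so
    equivalent elements get the same representative.\<close>
  define r where "r a x = (SOME y. y \<in> E a `` {x})" for a x
  define q where "q a x = e a (r a x)" for a x
  have r: "(x, r a x) \<in> E a" if "a \<in> Obj G" "x \<in> Y a" for a x
  proof -
    have "x \<in> E a `` {x}" using eq[OF that(1)] that(2) by (auto simp: equiv_def refl_on_def)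
    then have "r a x \<in> E a `` {x}" unfolding r_def by (rule someI)
    then show ?thesis by simp
  qed
  have rY: "r a x \<in> Y a" if "a \<in> Obj G" "x \<in> Y a" for a x
    using r[OF that] equiv_type[OF eq[OF that(1)]] by blast
  have q: "q a x = q a y \<longleftrightarrow> (x, y) \<in> E a" if "a \<in> Obj G" "x \<in> Y a" "y \<in> Y a" for a x y
  proof
    assume "q a x = q a y"
    then have "r a x = r a y" using inj_onD[OF e(1)[OF that(1)]] rY that unfolding q_def by blast
    then show "(x, y) \<in> E a"
      using r[OF that(1,2)] r[OF that(1,3)] eq[OF that(1)] by (metis equivE symE transE)
  next
    assume "(x, y) \<in> E a"
    then have "E a `` {x} = E a `` {y}" by (rule equiv_class_eq[OF eq[OF that(1)]])
    then show "q a x = q a y" unfolding q_def r_def by simp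
  qed
  \<comment> \<open>Recovers some element from the name of its class, in order to let arrows act on
    names; compatibility of \<open>\<alpha>\<close> with \<open>E\<close> makes the choice
    irrelevant.\<close>
  define p where "p a u = (SOME x. x \<in> Y a \<and> q a x = u)" for a u
  have p: "p a (q a x) \<in> Y a \<and> q a (p a (q a x)) = q a x" if "x \<in> Y a" for a x
    unfolding p_def by (rule someI[of "\<lambda>z. z \<in> Y a \<and> q a z = q a x" x]) (use that in simp)
  have pE: "(p a (q a x), x) \<in> E a" if "a \<in> Obj G" "x \<in> Y a" for a x
    using p[OF that(2)] q[OF that(1) _ that(2)] by blast
  define \<beta> where "\<beta> f u = q (Dom G f) (\<alpha> f (p (Cod G f) u))" for f u
  have \<beta>: "\<beta> f (q a x) = q b (\<alpha> f x)" if f: "f \<in> Hom G b a" and x: "x \<in> Y a" for f a b x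
  proof -
    have o: "a \<in> Obj G" "b \<in> Obj G" using G_Hom_Obj[OF f] by auto
    have "q b (\<alpha> f (p a (q a x))) = q b (\<alpha> f x)"
      using q[OF o(2) m[OF f conjunct1[OF p[OF x]]] m[OF f x]] comp[OF f pE[OF o(1) x]] by simp
    then show ?thesis using f unfolding \<beta>_def by (simp add: Hom_iff)
  qed
  let ?P = "mk_psh (\<lambda>a. q a ` Y a) \<beta>"
  have "?P \<in> Obj PSh"
  proof (rule mk_psh_Obj)
    fix a assume a: "a \<in> Obj G"
    have "q a ` Y a \<subseteq> e a ` Y a" using rY[OF a] unfolding q_def by auto
    then show "small (q a ` Y a)" using e(2)[OF a] small_subset by blast
    show "\<beta> (Id G a) x = x" if "x \<in> q a ` Y a" for x
      using that \<beta>[OF G_Id[OF a]] q[OF a m[OF G_Id[OF a]]] i[OF a] by auto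
  next
    fix f a b x assume "f \<in> Hom G b a" "x \<in> q a ` Y a"
    then show "\<beta> f x \<in> q b ` Y b" using \<beta> m by auto
  next
    fix f g a b c x assume f: "f \<in> Hom G c b" and g: "g \<in> Hom G b a" and x: "x \<in> q a ` Y a"
    have c': "c \<in> Obj G" using G_Hom_Obj[OF f] by simp
    from x obtain y where y: "y \<in> Y a" "x = q a y" by blast
    show "\<beta> (Comp G g f) x = \<beta> f (\<beta> g x)"
      unfolding y(2) \<beta>[OF G_Comp[OF f g] y(1)] \<beta>[OF g y(1)] \<beta>[OF f m[OF g y(1)]]
      using q[OF c' m[OF G_Comp[OF f g] y(1)] m[OF f m[OF g y(1)]]] c[OF f g y(1)] by blast
  qed
  then show ?thesis
    using that[of ?P q] q \<beta> by simp
qed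

section \<open>Monomorphisms, isomorphisms and factorizations, pointwise\<close>

lemma monicI:
  assumes m: "m \<in> Hom PSh F F'" and inj: "\<And>a. a \<in> Obj G \<Longrightarrow> inj_on (app m a) (FObj F a)"
  shows "monic PSh m"
  unfolding monic_def
proof (intro conjI ballI impI)
  show "m \<in> Arr PSh" using m by (simp add: Hom_iff)
  fix f g assume "f \<in> Arr PSh" "g \<in> Arr PSh" "Dom PSh f = Dom PSh g" "Cod PSh f = Dom PSh m"
    "Cod PSh g = Dom PSh m" and e: "Comp PSh m f = Comp PSh m g"
  then have f: "f \<in> Hom PSh (Dom PSh f) F" and g: "g \<in> Hom PSh (Dom PSh f) F"
    using m by (simp_all add: Hom_iff)
  show "f = g"
  proof (rule PSh_Hom_eqI[OF f g])
    fix a x assume a: "a \<in> Obj G" and x: "x \<in> FObj (Dom PSh f) a"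
    show "app f a x = app g a x"
      using app_Comp[OF f m a x] app_Comp[OF g m a x] e inj_onD[OF inj[OF a]]
        PSh_HomD(3)[OF f a x] PSh_HomD(3)[OF g a x] by metis
  qed
qed

lemma iso_arrI:
  assumes m: "m \<in> Hom PSh F F'" and bij: "\<And>a. a \<in> Obj G \<Longrightarrow> bij_betw (app m a) (FObj F a) (FObj F' a)"
  obtains k where "k \<in> Hom PSh F' F" "Comp PSh k m = Id PSh F" "Comp PSh m k = Id PSh F'"
proof -
  note D = PSh_HomD[OF m]
  let ?t = "\<lambda>a. the_inv_into (FObj F a) (app m a)"
  have t1: "?t a y \<in> FObj F a" "app m a (?t a y) = y" if "a \<in> Obj G" "y \<in> FObj F' a" for a y
    using bij[OF that(1)] that(2) the_inv_into_into[of "app m a" "FObj F a" y "FObj F a"]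
      f_the_inv_into_f[of "app m a" "FObj F a" y] by (auto simp: bij_betw_def)
  have t2: "?t a (app m a x) = x" if "a \<in> Obj G" "x \<in> FObj F a" for a x
    using bij[OF that(1)] that(2) the_inv_into_f_f by (fastforce simp: bij_betw_def)
  have k: "mk_arr F' ?t F \<in> Hom PSh F' F" (is "?k \<in> _")
  proof (rule mk_arr_Hom[OF D(2) D(1) t1(1)])
    fix f a b y assume f: "f \<in> Hom G b a" and y: "y \<in> FObj F' a"
    have o: "a \<in> Obj G" "b \<in> Obj G" using G_Hom_Obj[OF f] by auto
    have "act F f (?t a y) \<in> FObj F b" using act_mem[OF D(1) f t1(1)[OF o(1) y]] .
    from t2[OF o(2) this] show "?t b (act F' f y) = act F f (?t a y)"
      using D(4)[OF f t1(1)[OF o(1) y]] t1(2)[OF o(1) y] by simp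
  qed
  have "Comp PSh ?k m = Id PSh F"
    by (rule PSh_Hom_eqI[OF Comp_Hom[OF cat_PSh m k] Id_Hom[OF cat_PSh D(1)]])
       (simp add: app_Comp[OF m k] app_Id[OF D(1)] D(3) t2)
  moreover have "Comp PSh m ?k = Id PSh F'"
    by (rule PSh_Hom_eqI[OF Comp_Hom[OF cat_PSh k m] Id_Hom[OF cat_PSh D(2)]])
       (simp add: app_Comp[OF k m] app_Id[OF D(2)] t1)
  ultimately show ?thesis using that k by blast
qed

lemma inverse_imp_bij:
  assumes m: "m \<in> Hom PSh F F'" and k: "k \<in> Hom PSh F' F"
    and i: "Comp PSh k m = Id PSh F" "Comp PSh m k = Id PSh F'" and a: "a \<in> Obj G"
  shows "bij_betw (app m a) (FObj F a) (FObj F' a)"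
proof (rule bij_betw_byWitness[where f' = "app k a"])
  show "\<forall>x\<in>FObj F a. app k a (app m a x) = x"
    using app_Comp[OF m k a] i(1) app_Id[OF PSh_HomD(1)[OF m] a] by auto
  show "\<forall>x\<in>FObj F' a. app m a (app k a x) = x"
    using app_Comp[OF k m a] i(2) app_Id[OF PSh_HomD(2)[OF m] a] by auto
qed (use PSh_HomD(3)[OF m a] PSh_HomD(3)[OF k a] in auto)

lemma iso_arr_iff:
  assumes m: "m \<in> Hom PSh F F'"
  shows "iso_arr PSh m \<longleftrightarrow> (\<forall>a\<in>Obj G. bij_betw (app m a) (FObj F a) (FObj F' a))"
proof
  assume "iso_arr PSh m"
  then obtain k where "k \<in> Hom PSh F' F" "Comp PSh k m = Id PSh F" "Comp PSh m k = Id PSh F'"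
    using m unfolding iso_arr_def Hom_iff[of m] by auto
  then show "\<forall>a\<in>Obj G. bij_betw (app m a) (FObj F a) (FObj F' a)"
    using inverse_imp_bij[OF m] by blast
next
  assume "\<forall>a\<in>Obj G. bij_betw (app m a) (FObj F a) (FObj F' a)"
  then obtain k where "k \<in> Hom PSh F' F" "Comp PSh k m = Id PSh F" "Comp PSh m k = Id PSh F'"
    using iso_arrI[OF m] by blast
  then show "iso_arr PSh m" using m unfolding iso_arr_def Hom_iff[of m] by auto
qed

text \<open>The factorization is forced pointwise by the inverse of \<open>n\<close> on its image,
  and it is natural because \<open>n\<close> reflects equality.\<close>

lemma factor_through_inj:
  assumes m: "m \<in> Hom PSh F L" and n: "n \<in> Hom PSh F' L"
    and inj: "\<And>a. a \<in> Obj G \<Longrightarrow> inj_on (app n a) (FObj F' a)"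
    and sub: "\<And>a x. a \<in> Obj G \<Longrightarrow> x \<in> FObj F a \<Longrightarrow> app m a x \<in> app n a ` FObj F' a"
  obtains h where "h \<in> Hom PSh F F'" "Comp PSh n h = m"
proof -
  let ?t = "\<lambda>a x. the_inv_into (FObj F' a) (app n a) (app m a x)"
  have t: "?t a x \<in> FObj F' a" "app n a (?t a x) = app m a x" if "a \<in> Obj G" "x \<in> FObj F a" for a x
    using inj[OF that(1)] sub[OF that] the_inv_into_into[of "app n a" "FObj F' a" _ "FObj F' a"]
      f_the_inv_into_f[of "app n a" "FObj F' a"] by auto
  have h: "mk_arr F ?t F' \<in> Hom PSh F F'" (is "?h \<in> _")
  proof (rule mk_arr_Hom[OF PSh_HomD(1)[OF m] PSh_HomD(1)[OF n] t(1)])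
    fix f a b x assume f: "f \<in> Hom G b a" and x: "x \<in> FObj F a"
    have o: "a \<in> Obj G" "b \<in> Obj G" using G_Hom_Obj[OF f] by auto
    have fx: "act F f x \<in> FObj F b" using act_mem[OF PSh_HomD(1)[OF m] f x] .
    have "app n b (?t b (act F f x)) = app n b (act F' f (?t a x))"
      using t(2)[OF o(2) fx] PSh_HomD(4)[OF m f x] PSh_HomD(4)[OF n f t(1)[OF o(1) x]]
        t(2)[OF o(1) x] by simp
    then show "?t b (act F f x) = act F' f (?t a x)"
      using inj_onD[OF inj[OF o(2)]] t(1)[OF o(2) fx]
        act_mem[OF PSh_HomD(1)[OF n] f t(1)[OF o(1) x]] by blast
  qed
  have "Comp PSh n ?h = m"
    by (rule PSh_Hom_eqI[OF Comp_Hom[OF cat_PSh h n] m]) (simp add: app_Comp[OF h n] t(2))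
  then show ?thesis using that h by blast
qed

text \<open>Dual to \<open>factor_through_inj\<close>, with inclusion of kernels in place of
  inclusion of images.\<close>

lemma factor_through_surj:
  assumes e: "e \<in> Hom PSh F Q" and f: "f \<in> Hom PSh F L"
    and surj: "\<And>a. a \<in> Obj G \<Longrightarrow> app e a ` FObj F a = FObj Q a"
    and ker: "\<And>a x y. a \<in> Obj G \<Longrightarrow> x \<in> FObj F a \<Longrightarrow> y \<in> FObj F a \<Longrightarrow>
      app e a x = app e a y \<Longrightarrow> app f a x = app f a y"
  obtains h where "h \<in> Hom PSh Q L" "Comp PSh h e = f"
proof -
  let ?t = "\<lambda>a y. app f a (SOME x. x \<in> FObj F a \<and> app e a x = y)"
  have t: "?t a (app e a x) = app f a x" if a: "a \<in> Obj G" and x: "x \<in> FObj F a" for a x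
  proof -
    have "(SOME x'. x' \<in> FObj F a \<and> app e a x' = app e a x) \<in> FObj F a \<and>
        app e a (SOME x'. x' \<in> FObj F a \<and> app e a x' = app e a x) = app e a x"
      by (rule someI[of "\<lambda>x'. x' \<in> FObj F a \<and> app e a x' = app e a x" x]) (use x in simp)
    then show ?thesis using ker[OF a _ x] by blast
  qed
  have h: "mk_arr Q ?t L \<in> Hom PSh Q L" (is "?h \<in> _")
  proof (rule mk_arr_Hom[OF PSh_HomD(2)[OF e] PSh_HomD(2)[OF f]])
    fix a y assume a: "a \<in> Obj G" and y: "y \<in> FObj Q a"
    then obtain x where "x \<in> FObj F a" "y = app e a x" using surj by blast
    then show "?t a y \<in> FObj L a" using t[OF a] PSh_HomD(3)[OF f a] by simp
  next
    fix g a b y assume g: "g \<in> Hom G b a" and y: "y \<in> FObj Q a"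
    have o: "a \<in> Obj G" "b \<in> Obj G" using G_Hom_Obj[OF g] by auto
    obtain x where x: "x \<in> FObj F a" "y = app e a x" using y surj[OF o(1)] by blast
    have "?t b (act Q g y) = ?t b (app e b (act F g x))"
      using PSh_HomD(4)[OF e g x(1)] x(2) by simp
    also have "\<dots> = act L g (app f a x)"
      using t[OF o(2) act_mem[OF PSh_HomD(1)[OF e] g x(1)]] PSh_HomD(4)[OF f g x(1)] by simp
    finally show "?t b (act Q g y) = act L g (?t a y)" using t[OF o(1) x(1)] x(2) by simp
  qed
  have "app (Comp PSh ?h e) a x = app f a x" if "a \<in> Obj G" "x \<in> FObj F a" for a x
  proof -
    have "app ?h a (app e a x) = ?t a (app e a x)"
      by (rule app_mk_arr[OF that(1) PSh_HomD(3)[OF e that]])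
    then show ?thesis using app_Comp[OF e h that] t[OF that] by metis
  qed
  then have "Comp PSh ?h e = f"
    by (rule PSh_Hom_eqI[OF Comp_Hom[OF cat_PSh e h] f])
  then show ?thesis using that h by blast
qed

lemma subpresheaf:
  assumes F: "F \<in> Obj PSh" and sub: "\<And>a. a \<in> Obj G \<Longrightarrow> X a \<subseteq> FObj F a"
    and closed: "\<And>f a b x. f \<in> Hom G b a \<Longrightarrow> x \<in> X a \<Longrightarrow> act F f x \<in> X b"
  obtains S m where "m \<in> Hom PSh S F" "\<And>a. a \<in> Obj G \<Longrightarrow> FObj S a = X a"
    "\<And>a x. a \<in> Obj G \<Longrightarrow> x \<in> X a \<Longrightarrow> app m a x = x"
proof -
  let ?S = "mk_psh X (act F)"
  have S: "?S \<in> Obj PSh"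
  proof (rule mk_psh_Obj)
    show "small (X a)" if "a \<in> Obj G" for a
        using small_subset[OF small_FObj[OF F that] sub[OF that]] .
    show "act F (Id G a) x = x" if "a \<in> Obj G" "x \<in> X a" for a x
      using act_Id[OF F that(1)] sub[OF that(1)] that(2) by blast
    show "act F (Comp G g f) x = act F f (act F g x)"
      if "f \<in> Hom G c b" "g \<in> Hom G b a" "x \<in> X a" for f g a b c x
      using act_Comp[OF F that(1,2)] sub[of a] that(3) G_Hom_Obj[OF that(2)] by blast
  qed (rule closed)
  have "mk_arr ?S (\<lambda>a x. x) F \<in> Hom PSh ?S F"
  proof (rule mk_arr_Hom[OF S F])
    show "x \<in> FObj F a" if "a \<in> Obj G" "x \<in> FObj ?S a" for a x using that sub by auto
    show "act ?S f x = act F f x" if "f \<in> Hom G b a" "x \<in> FObj ?S a" for f a b x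
      using that G_Hom_Obj[OF that(1)] by simp
  qed
  then show ?thesis using that[of "mk_arr ?S (\<lambda>a x. x) F" ?S] by simp
qed

text \<open>The image of \<open>e\<close> is a subobject of \<open>Q\<close> through which
  \<open>e\<close> factors. The diagonal of the resulting square with the identity of
  \<open>Q\<close> is a section of the inclusion, so the image exhausts \<open>Q\<close>.\<close>

lemma strong_epic_surj:
  assumes e: "e \<in> Hom PSh F Q" and se: "strong_epic PSh e" and a: "a \<in> Obj G"
  shows "app e a ` FObj F a = FObj Q a"
proof -
  have de: "Dom PSh e = F" "Cod PSh e = Q" using e by (simp_all add: Hom_iff)
  obtain S m where m: "m \<in> Hom PSh S Q" "\<And>a. a \<in> Obj G \<Longrightarrow> FObj S a = app e a ` FObj F a"
    "\<And>a x. a \<in> Obj G \<Longrightarrow> x \<in> app e a ` FObj F a \<Longrightarrow> app m a x = x"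
  proof (rule subpresheaf[OF PSh_HomD(2)[OF e], of "\<lambda>a. app e a ` FObj F a"])
    show "app e a ` FObj F a \<subseteq> FObj Q a" if "a \<in> Obj G" for a using PSh_HomD(3)[OF e that] by blast
    show "act Q f x \<in> app e b ` FObj F b" if f: "f \<in> Hom G b a" and x: "x \<in> app e a ` FObj F a"
        for f a b x
      using x PSh_HomD(4)[OF e f] act_mem[OF PSh_HomD(1)[OF e] f] by (auto simp: image_iff) metis
  qed blast
  have inj: "inj_on (app m a) (FObj S a)" if "a \<in> Obj G" for a
    using m(2,3)[OF that] by (simp add: inj_on_def)
  have dm: "Dom PSh m = S" "Cod PSh m = Q" using m(1) by (simp_all add: Hom_iff)
  obtain f where f: "f \<in> Hom PSh F S" "Comp PSh m f = e"
  proof (rule factor_through_inj[OF e m(1) inj])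
    show "app e a x \<in> app m a ` FObj S a" if "a \<in> Obj G" "x \<in> FObj F a" for a x
      using m(2,3)[OF that(1)] that(2) by (intro image_eqI[of _ _ "app e a x"]) auto
  qed
  have "Comp PSh m f = Comp PSh (Id PSh Q) e" using f(2) Comp_Id_left[OF cat_PSh e] by simp
  then obtain d where d: "d \<in> Hom PSh Q S" "Comp PSh m d = Id PSh Q"
    using se monicI[OF m(1) inj] f(1) Id_Hom[OF cat_PSh PSh_HomD(2)[OF e]]
    unfolding strong_epic_def de by (metis dm)
  have "y \<in> app e a ` FObj F a" if y: "y \<in> FObj Q a" for y
  proof -
    have "app d a y \<in> app e a ` FObj F a" using PSh_HomD(3)[OF d(1) a y] m(2)[OF a] by simp
    then have "app m a (app d a y) = app d a y" by (rule m(3)[OF a])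
    then have "app d a y = y" using app_Comp[OF d(1) m(1) a y] d(2) app_Id[OF PSh_HomD(2)[OF e] a y]
        by simp
    then show ?thesis using \<open>app d a y \<in> _\<close> by simp
  qed
  then show ?thesis using PSh_HomD(3)[OF e a] by blast
qed

end

section \<open>Colimits of presheaves\<close>

context groupoid_presheaves
begin

text \<open>Edges of a graph on the disjoint union of all stages: its connected components are to
  become the elements of the colimit.\<close>

definition transition :: "('i, 'j) category \<Rightarrow> ('i, 'j, _, _) cat_functor \<Rightarrow> 'o \<Rightarrow> (('i \<times> 'u) \<times> ('i \<times>
    'u)) set"
  where "transition J D a = {((Dom J u, x), (Cod J u, app (FArr D u) a x)) | u x.
     u \<in> Arr J \<and> x \<in> FObj (FObj D (Dom J u)) a}"

text \<open>Connectedness by zigzags. The closure \<open>rtrancl\<close> is reflexive on the whole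
  type, so it is cut down to the disjoint union, on which it has to be an equivalence
  relation.\<close>

definition glue where
  "glue J D a = (transition J D a \<union> (transition J D a)\<inverse>)\<^sup>* \<inter>
     (SIGMA i:Obj J. FObj (FObj D i) a) \<times> (SIGMA i:Obj J. FObj (FObj D i) a)"

lemma transition_act:
  assumes D: "is_functor J PSh D" and f: "f \<in> Hom G b a"
      and p: "((i, x), (j, y)) \<in> transition J D a"
  shows "((i, act (FObj D i) f x), (j, act (FObj D j) f y)) \<in> transition J D b"
proof -
  obtain u where u: "u \<in> Arr J" "i = Dom J u" "j = Cod J u" "y = app (FArr D u) a x"
    "x \<in> FObj (FObj D (Dom J u)) a"
    using p unfolding transition_def by blast
  note H = is_functorD(4)[OF D Arr_imp_Hom[OF u(1)]]
  have "act (FObj D j) f y = app (FArr D u) b (act (FObj D i) f x)"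
    using PSh_HomD(4)[OF H f u(5)] u by simp
  moreover have "act (FObj D i) f x \<in> FObj (FObj D (Dom J u)) b"
    using act_mem[OF PSh_HomD(1)[OF H] f u(5)] u(2) by simp
  ultimately show ?thesis using u unfolding transition_def by blast
qed

lemma transition_rtrancl_act:
  assumes D: "is_functor J PSh D" and f: "f \<in> Hom G b a"
    and p: "(p, q) \<in> (transition J D a \<union> (transition J D a)\<inverse>)\<^sup>*"
  shows "((fst p, act (FObj D (fst p)) f (snd p)), (fst q, act (FObj D (fst q)) f (snd q)))
    \<in> (transition J D b \<union> (transition J D b)\<inverse>)\<^sup>*"
  using p
proof (induction rule: rtrancl_induct)
  case (step q r)
  obtain i x j y where "q = (i, x)" "r = (j, y)" by fastforce
  then have "((fst q, act (FObj D (fst q)) f (snd q)), (fst r, act (FObj D (fst r)) f (snd r)))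
    \<in> transition J D b \<union> (transition J D b)\<inverse>"
    using step(2) transition_act[OF D f] by auto
  then show ?case using step(3) by (meson rtrancl.rtrancl_into_rtrancl)
qed simp

text \<open>Colimits of presheaves are pointwise: disjoint unions modulo zigzags, on which arrows of
  \<open>G\<close> act because they map zigzags to zigzags. The description of elements and of their
  equality is kept in the conclusion, since the universal property alone does not display
  it.\<close>

lemma colimit_construction:
  fixes J :: "('i, 'j) category"
  assumes J: "small_sized small (Obj J)" and D: "is_functor J PSh D"
  obtains L c where "is_colimit J PSh D L c"
    "\<And>a y. a \<in> Obj G \<Longrightarrow> y \<in> FObj L a \<Longrightarrow> \<exists>i\<in>Obj J. \<exists>x\<in>FObj (FObj D i) a. app (c i) a x = y"
    "\<And>a i j x y. a \<in> Obj G \<Longrightarrow> i \<in> Obj J \<Longrightarrow> j \<in> Obj J \<Longrightarrow> x \<in> FObj (FObj D i) a \<Longrightarrow>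
       y \<in> FObj (FObj D j) a \<Longrightarrow> app (c i) a x = app (c j) a y \<Longrightarrow>
       ((i, x), (j, y)) \<in> (transition J D a \<union> (transition J D a)\<inverse>)\<^sup>*"
proof -
  define Y where "Y a = (SIGMA i:Obj J. FObj (FObj D i) a)" for a
  define \<alpha> where "\<alpha> f p = (fst p, act (FObj D (fst p)) f (snd p))" for f p
  let ?R = "\<lambda>a. (transition J D a \<union> (transition J D a)\<inverse>)\<^sup>*"
  have O: "FObj D i \<in> Obj PSh" if "i \<in> Obj J" for i using is_functorD(3)[OF D that] .
  obtain P q where P: "P \<in> Obj PSh" and FP: "\<And>a. a \<in> Obj G \<Longrightarrow> FObj P a = q a ` Y a"
    and q: "\<And>a x y. a \<in> Obj G \<Longrightarrow> x \<in> Y a \<Longrightarrow> y \<in> Y a \<Longrightarrow> q a x = q a y \<longleftrightarrow> (x, y) \<in> glue J D a"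
    and aP: "\<And>f a b x. f \<in> Hom G b a \<Longrightarrow> x \<in> Y a \<Longrightarrow> act P f (q a x) = q b (\<alpha> f x)"
  proof (rule quotient_presheaf[of Y \<alpha> "glue J D"])
    fix a assume a: "a \<in> Obj G"
    show "small_sized small (Y a)"
      unfolding Y_def by (rule small_sized_Sigma[OF J small_imp_small_sized[OF small_FObj[OF O a]]])
    have "sym (?R a)" by (intro sym_rtrancl sym_Un_converse)
    then show "equiv (Y a) (glue J D a)"
      unfolding glue_def Y_def[symmetric]
      by (intro equivI) (auto simp: refl_on_def sym_def trans_def intro: rtrancl_trans)
    fix x assume x: "x \<in> Y a"
    have "\<alpha> (Id G a) x = x" using x act_Id[OF O a] unfolding \<alpha>_def Y_def by auto
    then show "(\<alpha> (Id G a) x, x) \<in> glue J D a"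
      using x unfolding glue_def Y_def[symmetric] by auto
  next
    fix f a b x assume f: "f \<in> Hom G b a" and x: "x \<in> Y a"
    then show "\<alpha> f x \<in> Y b" using act_mem[OF O f] unfolding \<alpha>_def Y_def by auto
  next
    fix f a b x y assume f: "f \<in> Hom G b a" and xy: "(x, y) \<in> glue J D a"
    have "\<alpha> f x \<in> Y b" "\<alpha> f y \<in> Y b"
      using act_mem[OF O f] xy unfolding \<alpha>_def Y_def glue_def by auto
    then show "(\<alpha> f x, \<alpha> f y) \<in> glue J D b"
      using transition_rtrancl_act[OF D f] xy unfolding glue_def \<alpha>_def Y_def[symmetric] by auto
  next
    fix f g a b c x assume f: "f \<in> Hom G c b" and g: "g \<in> Hom G b a" and x: "x \<in> Y a"
    have "\<alpha> (Comp G g f) x = \<alpha> f (\<alpha> g x)" using x act_Comp[OF O f g] unfolding \<alpha>_def Y_def by auto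
    moreover have "\<alpha> f (\<alpha> g x) \<in> Y c" using x act_mem[OF O f act_mem[OF O g]] unfolding \<alpha>_def Y_def
        by auto
    ultimately show "(\<alpha> (Comp G g f) x, \<alpha> f (\<alpha> g x)) \<in> glue J D c"
      unfolding glue_def Y_def[symmetric] by auto
  qed blast
  define c where "c i = mk_arr (FObj D i) (\<lambda>a x. q a (i, x)) P" for i
  have c: "c i \<in> Hom PSh (FObj D i) P" if i: "i \<in> Obj J" for i
    unfolding c_def
  proof (rule mk_arr_Hom[OF O[OF i] P])
    show "q a (i, x) \<in> FObj P a" if "a \<in> Obj G" "x \<in> FObj (FObj D i) a" for a x
      using that i FP unfolding Y_def by auto
    show "q b (i, act (FObj D i) f x) = act P f (q a (i, x))"
        if "f \<in> Hom G b a" "x \<in> FObj (FObj D i) a" for f a b x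
      using aP[OF that(1), of "(i, x)"] that(2) i unfolding Y_def \<alpha>_def by simp
  qed
  have ac: "app (c i) a x = q a (i, x)" if "a \<in> Obj G" "x \<in> FObj (FObj D i) a" for i a x
    using that unfolding c_def by simp
  have cc: "cocone J PSh D P c"
    unfolding cocone_def
  proof (intro conjI ballI P c)
    fix u assume u: "u \<in> Arr J"
    note h = Arr_imp_Hom[OF u]
    note o = Hom_Obj[OF is_functorD(1)[OF D] h] and H = is_functorD(4)[OF D h]
    note cD = c[OF conjunct1[OF o]] and cC = c[OF conjunct2[OF o]]
    show "Comp PSh (c (Cod J u)) (FArr D u) = c (Dom J u)"
    proof (rule PSh_Hom_eqI[OF Comp_Hom[OF cat_PSh H cC] cD])
      fix a x assume a: "a \<in> Obj G" and x: "x \<in> FObj (FObj D (Dom J u)) a"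
      have y: "app (FArr D u) a x \<in> FObj (FObj D (Cod J u)) a" using PSh_HomD(3)[OF H a x] .
      have "((Dom J u, x), (Cod J u, app (FArr D u) a x)) \<in> transition J D a"
        using u x unfolding transition_def by blast
      then have "((Cod J u, app (FArr D u) a x), (Dom J u, x)) \<in> glue J D a"
        using o x y unfolding glue_def by auto
      then show "app (Comp PSh (c (Cod J u)) (FArr D u)) a x = app (c (Dom J u)) a x"
        using q[OF a] o x y unfolding app_Comp[OF H cC a x] ac[OF a x] ac[OF a y] Y_def by auto
    qed
  qed
  have "is_colimit J PSh D P c"
    unfolding is_colimit_def
  proof (intro conjI D cc allI impI)
    fix L' c' assume cc': "cocone J PSh D L' c'"
    have c': "c' i \<in> Hom PSh (FObj D i) L'" if "i \<in> Obj J" for i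
      using cc' that unfolding cocone_def by blast
    have L': "L' \<in> Obj PSh" using cc' unfolding cocone_def by blast
    have tr: "app (c' i) a x = app (c' j) a y"
      if a: "a \<in> Obj G" and t: "((i, x), (j, y)) \<in> transition J D a" for a i j x y
    proof -
      obtain u where u: "u \<in> Arr J" "i = Dom J u" "j = Cod J u" "y = app (FArr D u) a x"
        "x \<in> FObj (FObj D (Dom J u)) a"
        using t unfolding transition_def by blast
      note h = Arr_imp_Hom[OF u(1)]
      have "j \<in> Obj J" using Hom_Obj[OF is_functorD(1)[OF D] h] u(3) by simp
      moreover have "Comp PSh (c' j) (FArr D u) = c' i" using cc' u unfolding cocone_def by blast
      ultimately show ?thesis
        using app_Comp[OF is_functorD(4)[OF D h], of "c' j" L' a x] c' u a by simp
    qed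
    \<comment> \<open>A cocone takes the same value at the two ends of an edge, hence along any
      zigzag.\<close>
    have wd: "app (c' (fst p)) a (snd p) = app (c' (fst p')) a (snd p')"
      if a: "a \<in> Obj G" and p: "(p, p') \<in> ?R a" for a p p'
      using p
    proof (induction rule: rtrancl_induct)
      case (step p' p'')
      have "app (c' (fst p')) a (snd p') = app (c' (fst p'')) a (snd p'')"
        using step(2) tr[OF a, of "fst p'" "snd p'" "fst p''" "snd p''"]
          tr[OF a, of "fst p''" "snd p''" "fst p'" "snd p'"] by auto
      then show ?case using step(3) by simp
    qed simp
    let ?s = "\<lambda>a u. SOME p. p \<in> Y a \<and> q a p = u"
    let ?t = "\<lambda>a u. app (c' (fst (?s a u))) a (snd (?s a u))"
    have t: "?t a (q a (i, x)) = app (c' i) a x"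
      if a: "a \<in> Obj G" and i: "i \<in> Obj J" and x: "x \<in> FObj (FObj D i) a" for a i x
    proof -
      have ix: "(i, x) \<in> Y a" using i x unfolding Y_def by auto
      have "?s a (q a (i, x)) \<in> Y a \<and> q a (?s a (q a (i, x))) = q a (i, x)"
        by (rule someI[of "\<lambda>p. p \<in> Y a \<and> q a p = q a (i, x)" "(i, x)"]) (use ix in simp)
      then have "(?s a (q a (i, x)), (i, x)) \<in> glue J D a" using q[OF a _ ix] by blast
      then show ?thesis using wd[OF a] unfolding glue_def by fastforce
    qed
    define h where "h = mk_arr P ?t L'"
    have h: "h \<in> Hom PSh P L'"
      unfolding h_def
    proof (rule mk_arr_Hom[OF P L'])
      fix a y assume a: "a \<in> Obj G" and "y \<in> FObj P a"
      then obtain i x where ix: "i \<in> Obj J" "x \<in> FObj (FObj D i) a" "y = q a (i, x)"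
        using FP[OF a] unfolding Y_def by auto
      show "?t a y \<in> FObj L' a" unfolding ix(3) t[OF a ix(1,2)]
          by (rule PSh_HomD(3)[OF c'[OF ix(1)] a ix(2)])
    next
      fix f a b y assume f: "f \<in> Hom G b a" and y: "y \<in> FObj P a"
      have o: "a \<in> Obj G" "b \<in> Obj G" using G_Hom_Obj[OF f] by auto
      obtain i x where ix: "i \<in> Obj J" "x \<in> FObj (FObj D i) a" "y = q a (i, x)"
        using FP[OF o(1)] y unfolding Y_def by auto
      have "act P f y = q b (i, act (FObj D i) f x)"
        using aP[OF f, of "(i, x)"] ix unfolding Y_def \<alpha>_def by simp
      then show "?t b (act P f y) = act L' f (?t a y)"
        using t[OF o(2) ix(1) act_mem[OF O[OF ix(1)] f ix(2)]] t[OF o(1) ix(1,2)]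
          PSh_HomD(4)[OF c'[OF ix(1)] f ix(2)] ix(3) by simp
    qed
    have hc: "Comp PSh h (c i) = c' i" if i: "i \<in> Obj J" for i
    proof (rule PSh_Hom_eqI[OF Comp_Hom[OF cat_PSh c[OF i] h] c'[OF i]])
      fix a x assume a: "a \<in> Obj G" and x: "x \<in> FObj (FObj D i) a"
      have "app h a (q a (i, x)) = ?t a (q a (i, x))"
        unfolding h_def by (rule app_mk_arr[OF a]) (use a i x FP in \<open>auto simp: Y_def\<close>)
      then show "app (Comp PSh h (c i)) a x = app (c' i) a x"
        using app_Comp[OF c[OF i] h a x] ac[OF a x] t[OF a i x] by simp
    qed
    show "\<exists>!h. h \<in> Hom PSh P L' \<and> (\<forall>i\<in>Obj J. Comp PSh h (c i) = c' i)"
    proof (rule ex1I[of _ h])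
      show "h \<in> Hom PSh P L' \<and> (\<forall>i\<in>Obj J. Comp PSh h (c i) = c' i)" using h hc by simp
      fix k assume k: "k \<in> Hom PSh P L' \<and> (\<forall>i\<in>Obj J. Comp PSh k (c i) = c' i)"
      show "k = h"
      proof (rule PSh_Hom_eqI[OF conjunct1[OF k] h])
        fix a y assume a: "a \<in> Obj G" and "y \<in> FObj P a"
        then obtain i x where ix: "i \<in> Obj J" "x \<in> FObj (FObj D i) a" "y = q a (i, x)"
          using FP[OF a] unfolding Y_def by auto
        have "Comp PSh k (c i) = Comp PSh h (c i)" using k hc[OF ix(1)] ix(1) by simp
        then show "app k a y = app h a y"
          using app_Comp[OF c[OF ix(1)] conjunct1[OF k] a ix(2)] app_Comp[OF c[OF ix(1)] h a ix(2)]
            ac[OF a ix(2)] ix(3) by metis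
      qed
    qed
  qed
  then show ?thesis
  proof (rule that)
    fix a y assume a: "a \<in> Obj G" and "y \<in> FObj P a"
    then obtain i x where ix: "i \<in> Obj J" "x \<in> FObj (FObj D i) a" "y = q a (i, x)"
      using FP[OF a] unfolding Y_def by auto
    then show "\<exists>i\<in>Obj J. \<exists>x\<in>FObj (FObj D i) a. app (c i) a x = y" using ac[OF a] by blast
  next
    fix a i j x y assume a: "a \<in> Obj G" and i: "i \<in> Obj J" "j \<in> Obj J"
      and x: "x \<in> FObj (FObj D i) a" "y \<in> FObj (FObj D j) a" and "app (c i) a x = app (c j) a y"
    then have "((i, x), (j, y)) \<in> glue J D a" using q[OF a] ac[OF a] unfolding Y_def by auto
    then show "((i, x), (j, y)) \<in> ?R a" unfolding glue_def by simp
  qed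
qed

lemma cocomplete_PSh: "cocomplete small PSh"
  unfolding cocomplete_def
proof (intro allI impI)
  fix J :: "('u, 'u) category" and D
  assume J: "small (Obj J)" and D: "is_functor J PSh D"
  show "\<exists>L c. is_colimit J PSh D L c"
    by (rule colimit_construction[OF small_imp_small_sized[OF J] D]) blast
qed

section \<open>Directed colimits of presheaves, elementwise\<close>

context
  fixes I :: "'i set" and r D L c
  assumes dir: "directed_poset I r" and I: "small_sized small I"
    and col: "is_colimit (poset_category I r) PSh D L c"
begin

lemma poset_transition_Hom: "(i, j) \<in> r \<Longrightarrow> FArr D (i, j) \<in> Hom PSh (FObj D i) (FObj D j)"
  using is_functorD(4)[OF is_colimitD(1)[OF col]] by (simp add: Hom_poset_category)

lemma poset_transition_Comp:
  assumes ij: "(i, j) \<in> r" and jk: "(j, k) \<in> r" and a: "a \<in> Obj G" and x: "x \<in> FObj (FObj D i) a"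
  shows "app (FArr D (i, k)) a x = app (FArr D (j, k)) a (app (FArr D (i, j)) a x)"
proof -
  have "FArr D (i, k) = Comp PSh (FArr D (j, k)) (FArr D (i, j))"
    using is_functorD(6)[OF is_colimitD(1)[OF col], of "(i, j)" i j "(j, k)" k] ij jk
    by (simp add: Hom_poset_category)
  then show ?thesis
    using app_Comp[OF poset_transition_Hom[OF ij] poset_transition_Hom[OF jk] a x] by simp
qed

text \<open>In a directed diagram a zigzag collapses to a meeting at one later stage. By induction
  along the zigzag, a backward edge keeps the meeting stage, while a forward edge moves it to a
  larger one.\<close>

lemma directed_transition_rtrancl:
  assumes a: "a \<in> Obj G" and i: "i \<in> I" and x: "x \<in> FObj (FObj D i) a"
    and p: "((i, x), p) \<in> (transition (poset_category I r) D a \<union> (transition (poset_category I r) D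
        a)\<inverse>)\<^sup>*"
  shows "fst p \<in> I \<and> snd p \<in> FObj (FObj D (fst p)) a \<and>
    (\<exists>k. (i, k) \<in> r \<and> (fst p, k) \<in> r \<and> app (FArr D (i, k)) a x = app (FArr D (fst p, k)) a (snd p))"
  using p
proof (induction rule: rtrancl_induct)
  case base
  then show ?case using i x directed_poset_refl[OF dir i] by auto
next
  case (step p p')
  then obtain k where k: "fst p \<in> I" "snd p \<in> FObj (FObj D (fst p)) a" "(i, k) \<in> r" "(fst p, k) \<in> r"
    "app (FArr D (i, k)) a x = app (FArr D (fst p, k)) a (snd p)" by blast
  from step(2) consider "(p, p') \<in> transition (poset_category I r) D a"
    | "(p', p) \<in> transition (poset_category I r) D a" by blast
  then show ?case
  proof cases
    case 1
    then have p': "(fst p, fst p') \<in> r" "snd p' = app (FArr D (fst p, fst p')) a (snd p)"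
      unfolding transition_def by auto
    have I': "fst p' \<in> I" using directed_poset_field[OF dir p'(1)] by simp
    have m': "snd p' \<in> FObj (FObj D (fst p')) a"
      unfolding p'(2) by (rule PSh_HomD(3)[OF poset_transition_Hom[OF p'(1)] a k(2)])
    \<comment> \<open>The old meeting stage \<open>k\<close> need not lie above the end of the new
      edge, so a common bound of both is taken.\<close>
    obtain l where l: "l \<in> I" "(k, l) \<in> r" "(fst p', l) \<in> r"
      using directed_poset_upper[OF dir _ I'] directed_poset_field[OF dir k(3)] by blast
    have "app (FArr D (i, l)) a x = app (FArr D (k, l)) a (app (FArr D (fst p, k)) a (snd p))"
      using poset_transition_Comp[OF k(3) l(2) a x] k(5) by simp
    also have "\<dots> = app (FArr D (fst p, l)) a (snd p)"
      using poset_transition_Comp[OF k(4) l(2) a k(2)] by simp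
    also have "\<dots> = app (FArr D (fst p', l)) a (snd p')"
      using poset_transition_Comp[OF p'(1) l(3) a k(2)] p'(2) by simp
    finally show ?thesis
      using I' m' l(3) directed_poset_trans[OF dir k(3) l(2)] by blast
  next
    case 2
    then have p': "(fst p', fst p) \<in> r" "snd p = app (FArr D (fst p', fst p)) a (snd p')"
      "snd p' \<in> FObj (FObj D (fst p')) a"
      unfolding transition_def by auto
    have "app (FArr D (i, k)) a x = app (FArr D (fst p', k)) a (snd p')"
      using poset_transition_Comp[OF p'(1) k(4) a p'(3)] p'(2) k(5) by simp
    then show ?thesis
      using p' directed_poset_field[OF dir p'(1)] k(3) directed_poset_trans[OF dir p'(1) k(4)]
        by blast
  qed
qed

text \<open>Both properties hold for the constructed colimit and pass to \<open>L\<close> along the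
  isomorphism of colimits.\<close>

lemma
  shows directed_colimit_surj: "\<And>a y. a \<in> Obj G \<Longrightarrow> y \<in> FObj L a \<Longrightarrow>
      \<exists>i\<in>I. \<exists>x\<in>FObj (FObj D i) a. app (c i) a x = y"
    and directed_colimit_inj: "\<And>a i j x y. a \<in> Obj G \<Longrightarrow> i \<in> I \<Longrightarrow> j \<in> I \<Longrightarrow>
      x \<in> FObj (FObj D i) a \<Longrightarrow> y \<in> FObj (FObj D j) a \<Longrightarrow> app (c i) a x = app (c j) a y \<Longrightarrow>
      \<exists>k. (i, k) \<in> r \<and> (j, k) \<in> r \<and> app (FArr D (i, k)) a x = app (FArr D (j, k)) a y"
proof -
  let ?J = "poset_category I r"
  have "small_sized small (Obj ?J)" using I by simp
  then obtain P d where P: "is_colimit ?J PSh D P d"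
    and surj: "\<And>a y. a \<in> Obj G \<Longrightarrow> y \<in> FObj P a \<Longrightarrow> \<exists>i\<in>Obj ?J. \<exists>x\<in>FObj (FObj D i) a. app (d i) a x = y"
    and inj: "\<And>a i j x y. a \<in> Obj G \<Longrightarrow> i \<in> Obj ?J \<Longrightarrow> j \<in> Obj ?J \<Longrightarrow> x \<in> FObj (FObj D i) a \<Longrightarrow>
       y \<in> FObj (FObj D j) a \<Longrightarrow> app (d i) a x = app (d j) a y \<Longrightarrow>
       ((i, x), (j, y)) \<in> (transition ?J D a \<union> (transition ?J D a)\<inverse>)\<^sup>*"
    by (rule colimit_construction[OF _ is_colimitD(1)[OF col]]) blast+
  obtain h k where h: "h \<in> Hom PSh P L" and k: "k \<in> Hom PSh L P"
    and kh: "Comp PSh k h = Id PSh P" "Comp PSh h k = Id PSh L"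
    and hd: "\<And>i. i \<in> I \<Longrightarrow> Comp PSh h (d i) = c i" and kc: "\<And>i. i \<in> I \<Longrightarrow> Comp PSh k (c i) = d i"
    by (rule colimit_unique[OF cat_PSh P col]) auto
  note ci = is_colimitD(6)[OF col, unfolded poset_category_simps]
  note di = is_colimitD(6)[OF P, unfolded poset_category_simps]
  show "\<exists>i\<in>I. \<exists>x\<in>FObj (FObj D i) a. app (c i) a x = y" if a: "a \<in> Obj G" and y: "y \<in> FObj L a"
      for a y
  proof -
    obtain i x where i: "i \<in> I" "x \<in> FObj (FObj D i) a" "app (d i) a x = app k a y"
      using surj[OF a PSh_HomD(3)[OF k a y]] by auto
    have "app h a (app k a y) = y" using app_Comp[OF k h a y] kh(2) app_Id[OF PSh_HomD(1)[OF k] a y]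
        by simp
    then have "app (c i) a x = y" using app_Comp[OF di[OF i(1)] h a i(2)] hd[OF i(1)] i(3) by simp
    then show ?thesis using i by blast
  qed
  show "\<exists>k. (i, k) \<in> r \<and> (j, k) \<in> r \<and> app (FArr D (i, k)) a x = app (FArr D (j, k)) a y"
    if a: "a \<in> Obj G" and i: "i \<in> I" and j: "j \<in> I" and x: "x \<in> FObj (FObj D i) a"
      and y: "y \<in> FObj (FObj D j) a" and e: "app (c i) a x = app (c j) a y" for a i j x y
  proof -
    have "app (d i) a x = app (d j) a y"
      using app_Comp[OF ci[OF i] k a x] app_Comp[OF ci[OF j] k a y] kc[OF i] kc[OF j] e by simp
    then have "((i, x), (j, y)) \<in> (transition ?J D a \<union> (transition ?J D a)\<inverse>)\<^sup>*"
      using inj[OF a _ _ x y] i j by simp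
    then show ?thesis using directed_transition_rtrancl[OF a i x] by force
  qed
qed

end

text \<open>The pointwise analogue of \<open>set_directed_colimitI\<close>. Naturality of the
  mediating map follows because the action on an element of \<open>L\<close> may be computed on any
  of its preimages.\<close>

lemma presheaf_directed_colimitI:
  assumes dir: "directed_poset I r" and D: "is_functor (poset_category I r) PSh D"
    and cc: "cocone (poset_category I r) PSh D L c"
    and surj: "\<And>a y. a \<in> Obj G \<Longrightarrow> y \<in> FObj L a \<Longrightarrow> \<exists>i\<in>I. \<exists>x\<in>FObj (FObj D i) a. app (c i) a x = y"
    and inj: "\<And>a i x y. a \<in> Obj G \<Longrightarrow> i \<in> I \<Longrightarrow> x \<in> FObj (FObj D i) a \<Longrightarrow> y \<in> FObj (FObj D i) a \<Longrightarrow>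
      app (c i) a x = app (c i) a y \<Longrightarrow>
      \<exists>k. (i, k) \<in> r \<and> app (FArr D (i, k)) a x = app (FArr D (i, k)) a y"
  shows "is_colimit (poset_category I r) PSh D L c"
  unfolding is_colimit_def
proof (intro conjI allI impI D cc)
  let ?J = "poset_category I r"
  fix L' c' assume cc': "cocone ?J PSh D L' c'"
  have c: "c i \<in> Hom PSh (FObj D i) L" if "i \<in> I" for i using that cc unfolding cocone_def by auto
  have c': "c' i \<in> Hom PSh (FObj D i) L'" if "i \<in> I" for i using that cc' unfolding cocone_def
      by auto
  have L: "L \<in> Obj PSh" and L': "L' \<in> Obj PSh" using cc cc' unfolding cocone_def by auto
  have O: "FObj D i \<in> Obj PSh" if "i \<in> I" for i using is_functorD(3)[OF D] that by simp
  have d: "FArr D (i, k) \<in> Hom PSh (FObj D i) (FObj D k)" if "(i, k) \<in> r" for i k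
    using is_functorD(4)[OF D] that by (simp add: Hom_poset_category)
  have dc: "app (c k) a (app (FArr D (i, k)) a y) = app (c i) a y"
    and dc': "app (c' k) a (app (FArr D (i, k)) a y) = app (c' i) a y"
    if "(i, k) \<in> r" "a \<in> Obj G" "y \<in> FObj (FObj D i) a" for i k a y
  proof -
    have k: "k \<in> I" using directed_poset_field[OF dir that(1)] by auto
    have "Comp PSh (c k) (FArr D (i, k)) = c i" "Comp PSh (c' k) (FArr D (i, k)) = c' i"
      using cc cc' that(1) unfolding cocone_def by force+
    then show "app (c k) a (app (FArr D (i, k)) a y) = app (c i) a y"
      "app (c' k) a (app (FArr D (i, k)) a y) = app (c' i) a y"
      using app_Comp[OF d[OF that(1)] c[OF k] that(2,3)]
        app_Comp[OF d[OF that(1)] c'[OF k] that(2,3)]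
      by auto
  qed
  have wd: "app (c' i) a y = app (c' j) a z"
    if a: "a \<in> Obj G" and i: "i \<in> I" "y \<in> FObj (FObj D i) a" and j: "j \<in> I" "z \<in> FObj (FObj D j) a"
      and e: "app (c i) a y = app (c j) a z" for a i j y z
  proof -
    obtain k where k: "k \<in> I" "(i, k) \<in> r" "(j, k) \<in> r"
      using directed_poset_upper[OF dir i(1) j(1)] by blast
    note m = PSh_HomD(3)[OF d[OF k(2)] a i(2)] PSh_HomD(3)[OF d[OF k(3)] a j(2)]
    obtain l where l: "(k, l) \<in> r" "app (FArr D (k, l)) a (app (FArr D (i, k)) a y) =
        app (FArr D (k, l)) a (app (FArr D (j, k)) a z)"
      using inj[OF a k(1) m] dc[OF k(2) a i(2)] dc[OF k(3) a j(2)] e by auto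
    then have "app (c' k) a (app (FArr D (i, k)) a y) = app (c' k) a (app (FArr D (j, k)) a z)"
      using dc'[OF l(1) a m(1)] dc'[OF l(1) a m(2)] by simp
    then show ?thesis using dc'[OF k(2) a i(2)] dc'[OF k(3) a j(2)] by simp
  qed
  have "\<forall>a y. \<exists>i x. a \<in> Obj G \<longrightarrow> y \<in> FObj L a \<longrightarrow> i \<in> I \<and> x \<in> FObj (FObj D i) a \<and> app (c i) a x = y"
    using surj by blast
  then obtain \<iota> \<upsilon> where s: "\<And>a y. a \<in> Obj G \<Longrightarrow> y \<in> FObj L a \<Longrightarrow>
      \<iota> a y \<in> I \<and> \<upsilon> a y \<in> FObj (FObj D (\<iota> a y)) a \<and> app (c (\<iota> a y)) a (\<upsilon> a y) = y"
    by metis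
  define t where "t a y = app (c' (\<iota> a y)) a (\<upsilon> a y)" for a y
  have t: "t a (app (c i) a x) = app (c' i) a x" if "a \<in> Obj G" "i \<in> I" "x \<in> FObj (FObj D i) a"
      for a i x
    using wd[OF that(1) _ _ that(2,3)] s[OF that(1) PSh_HomD(3)[OF c[OF that(2)] that(1,3)]]
    unfolding t_def by blast
  define h where "h = mk_arr L t L'"
  have h: "h \<in> Hom PSh L L'"
    unfolding h_def
  proof (rule mk_arr_Hom[OF L L'])
    fix a y assume a: "a \<in> Obj G" and y: "y \<in> FObj L a"
    show "t a y \<in> FObj L' a" using s[OF a y] PSh_HomD(3)[OF c' a] unfolding t_def by blast
  next
    fix f a b y assume f: "f \<in> Hom G b a" and y: "y \<in> FObj L a"
    have o: "a \<in> Obj G" "b \<in> Obj G" using G_Hom_Obj[OF f] by auto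
    obtain i x where ix: "i \<in> I" "x \<in> FObj (FObj D i) a" "app (c i) a x = y" using surj[OF o(1) y]
        by blast
    have "act L f y = app (c i) b (act (FObj D i) f x)"
        using PSh_HomD(4)[OF c[OF ix(1)] f ix(2)] ix(3) by simp
    then show "t b (act L f y) = act L' f (t a y)"
      using t[OF o(2) ix(1) act_mem[OF O[OF ix(1)] f ix(2)]] t[OF o(1) ix(1,2)]
        PSh_HomD(4)[OF c'[OF ix(1)] f ix(2)] ix(3) by simp
  qed
  have hc: "Comp PSh h (c i) = c' i" if i: "i \<in> I" for i
  proof (rule PSh_Hom_eqI[OF Comp_Hom[OF cat_PSh c[OF i] h] c'[OF i]])
    fix a x assume a: "a \<in> Obj G" and x: "x \<in> FObj (FObj D i) a"
    show "app (Comp PSh h (c i)) a x = app (c' i) a x"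
      using app_Comp[OF c[OF i] h a x] t[OF a i x] app_mk_arr[OF a PSh_HomD(3)[OF c[OF i] a x],
        of t L']
      unfolding h_def by simp
  qed
  show "\<exists>!h. h \<in> Hom PSh L L' \<and> (\<forall>i\<in>Obj ?J. Comp PSh h (c i) = c' i)"
  proof (rule ex1I[of _ h])
    show "h \<in> Hom PSh L L' \<and> (\<forall>i\<in>Obj ?J. Comp PSh h (c i) = c' i)" using h hc by simp
    fix k assume k: "k \<in> Hom PSh L L' \<and> (\<forall>i\<in>Obj ?J. Comp PSh k (c i) = c' i)"
    show "k = h"
    proof (rule PSh_Hom_eqI[OF conjunct1[OF k] h])
      fix a y assume a: "a \<in> Obj G" and "y \<in> FObj L a"
      then obtain i x where ix: "i \<in> I" "x \<in> FObj (FObj D i) a" "app (c i) a x = y" using surj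
          by blast
      have "Comp PSh k (c i) = Comp PSh h (c i)" using k hc[OF ix(1)] ix(1) by simp
      then show "app k a y = app h a y"
        using app_Comp[OF c[OF ix(1)] conjunct1[OF k] a ix(2)] app_Comp[OF c[OF ix(1)] h a ix(2)]
          ix(3) by metis
    qed
  qed
qed

text \<open>Finite presentability quantifies over posets inside \<open>'u\<close>, whereas the
  diagrams arising below are indexed by finite sets of points or by natural numbers. The order on
  \<open>T\<close> is transported along an injection into \<open>'u\<close>, and the conclusion
  remembers which stages and transition maps were used.\<close>

lemma directed_diagram:
  fixes T :: "'t set" and le :: "'t \<Rightarrow> 't \<Rightarrow> bool"
  assumes T: "small_sized small T" "T \<noteq> {}"
    and refl: "\<And>s. s \<in> T \<Longrightarrow> le s s"
    and trans: "\<And>s t u. s \<in> T \<Longrightarrow> t \<in> T \<Longrightarrow> u \<in> T \<Longrightarrow> le s t \<Longrightarrow> le t u \<Longrightarrow> le s u"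
    and antisym: "\<And>s t. s \<in> T \<Longrightarrow> t \<in> T \<Longrightarrow> le s t \<Longrightarrow> le t s \<Longrightarrow> s = t"
    and upper: "\<And>s t. s \<in> T \<Longrightarrow> t \<in> T \<Longrightarrow> \<exists>u\<in>T. le s u \<and> le t u"
    and A: "\<And>s. s \<in> T \<Longrightarrow> A s \<in> Obj PSh"
    and d: "\<And>s t. s \<in> T \<Longrightarrow> t \<in> T \<Longrightarrow> le s t \<Longrightarrow> d s t \<in> Hom PSh (A s) (A t)"
    and d_Id: "\<And>s. s \<in> T \<Longrightarrow> d s s = Id PSh (A s)"
    and d_Comp: "\<And>s t u. s \<in> T \<Longrightarrow> t \<in> T \<Longrightarrow> u \<in> T \<Longrightarrow> le s t \<Longrightarrow> le t u \<Longrightarrow>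
      d s u = Comp PSh (d t u) (d s t)"
    and c: "\<And>s. s \<in> T \<Longrightarrow> c s \<in> Hom PSh (A s) L"
    and cd: "\<And>s t. s \<in> T \<Longrightarrow> t \<in> T \<Longrightarrow> le s t \<Longrightarrow> Comp PSh (c t) (d s t) = c s"
    and surj: "\<And>a y. a \<in> Obj G \<Longrightarrow> y \<in> FObj L a \<Longrightarrow> \<exists>s\<in>T. y \<in> app (c s) a ` FObj (A s) a"
    and inj: "\<And>a s x y. a \<in> Obj G \<Longrightarrow> s \<in> T \<Longrightarrow> x \<in> FObj (A s) a \<Longrightarrow> y \<in> FObj (A s) a \<Longrightarrow>
      app (c s) a x = app (c s) a y \<Longrightarrow> \<exists>t\<in>T. le s t \<and> app (d s t) a x = app (d s t) a y"
  obtains I :: "'u set" and r D c' where "small I" "directed_poset I r"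
    "is_colimit (poset_category I r) PSh D L c'"
    "\<And>i. i \<in> I \<Longrightarrow> \<exists>s\<in>T. FObj D i = A s \<and> c' i = c s"
    "\<And>p. p \<in> r \<Longrightarrow> \<exists>s\<in>T. \<exists>t\<in>T. le s t \<and> FArr D p = d s t"
proof -
  obtain e :: "'t \<Rightarrow> 'u" where e: "inj_on e T" "small (e ` T)"
    using T(1) unfolding small_sized_def by blast
  define v where "v = the_inv_into T e"
  have v: "v (e t) = t" if "t \<in> T" for t using the_inv_into_f_f[OF e(1) that] by (simp add: v_def)
  let ?I = "e ` T" and ?r = "{(e s, e t) | s t. s \<in> T \<and> t \<in> T \<and> le s t}"
  let ?J = "poset_category ?I ?r"
  define D where "D = \<lparr>FObj = \<lambda>i. A (v i), FArr = \<lambda>p. d (v (fst p)) (v (snd p))\<rparr>"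
  have D1: "FObj D (e t) = A t" if "t \<in> T" for t using v[OF that] by (simp add: D_def)
  have D2: "FArr D (e s, e t) = d s t" if "s \<in> T" "t \<in> T" for s t using v that by (simp add: D_def)
  have dir: "directed_poset ?I ?r"
    unfolding directed_poset_def partial_order_on_def preorder_on_def
  proof (intro conjI ballI)
    show "refl_on ?I ?r" using refl by (auto simp: refl_on_def)
    show "trans ?r"
    proof (rule transI)
      fix x y z assume "(x, y) \<in> ?r" "(y, z) \<in> ?r"
      then obtain s t t' u where h: "x = e s" "y = e t" "y = e t'" "z = e u" "s \<in> T" "t \<in> T"
          "t' \<in> T" "u \<in> T"
        "le s t" "le t' u" by blast
      then have "t' = t" using v by metis
      then show "(x, z) \<in> ?r" using h trans by blast
    qed
    show "antisym ?r"
    proof (rule antisymI)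
      fix x y assume "(x, y) \<in> ?r" "(y, x) \<in> ?r"
      then obtain s t s' t' where h: "x = e s" "y = e t" "y = e t'" "x = e s'" "s \<in> T" "t \<in> T"
          "t' \<in> T" "s' \<in> T"
        "le s t" "le t' s'" by blast
      then have "t' = t" "s' = s" using v by metis+
      then show "x = y" using h antisym by metis
    qed
    show "\<exists>k\<in>?I. (i, k) \<in> ?r \<and> (j, k) \<in> ?r" if "i \<in> ?I" "j \<in> ?I" for i j
      using that upper by blast
  qed (use T in auto)
  have J: "is_category ?J" by (rule directed_poset_category[OF dir])
  have F: "is_functor ?J PSh D"
  proof (rule is_functorI[OF J cat_PSh])
    show "FObj D i \<in> Obj PSh" if "i \<in> Obj ?J" for i using that D1 A by auto
    show "FArr D p \<in> Hom PSh (FObj D i) (FObj D j)" if "p \<in> Hom ?J i j" for p i j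
      using that unfolding Hom_poset_category by (auto simp: D1 D2 d)
    show "FArr D (Id ?J i) = Id PSh (FObj D i)" if "i \<in> Obj ?J" for i
      using that D1 D2 d_Id by auto
    show "FArr D (Comp ?J q p) = Comp PSh (FArr D q) (FArr D p)"
      if pq: "p \<in> Hom ?J i j" "q \<in> Hom ?J j k" for p q i j k
    proof -
      obtain s t t' u where h: "i = e s" "j = e t" "j = e t'" "k = e u" "s \<in> T" "t \<in> T" "t' \<in> T"
          "u \<in> T"
        "le s t" "le t' u" "p = (i, j)" "q = (j, k)" using pq unfolding Hom_poset_category by blast
      have "t' = t" using h(3,2,6,7) v by metis
      then show ?thesis using h d_Comp[of s t u] D2 by simp
    qed
  qed
  let ?c = "\<lambda>i. c (v i)"
  have cc: "cocone ?J PSh D L ?c"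
    unfolding cocone_def
  proof (intro conjI ballI)
    obtain s where "s \<in> T" using T(2) by blast
    then show "L \<in> Obj PSh" using PSh_HomD(2)[OF c] by blast
    show "c (v i) \<in> Hom PSh (FObj D i) L" if "i \<in> Obj ?J" for i using that v D1 c by auto
    show "Comp PSh (c (v (Cod ?J u))) (FArr D u) = c (v (Dom ?J u))" if "u \<in> Arr ?J" for u
      using that D2 v cd by auto
  qed
  have "is_colimit ?J PSh D L ?c"
  proof (rule presheaf_directed_colimitI[OF dir F cc])
    fix a y assume "a \<in> Obj G" "y \<in> FObj L a"
    from surj[OF this] show "\<exists>i\<in>?I. \<exists>x\<in>FObj (FObj D i) a. app (c (v i)) a x = y"
      using v D1 by fastforce
  next
    fix a i x y assume a: "a \<in> Obj G" and i: "i \<in> ?I" and x: "x \<in> FObj (FObj D i) a"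
      and y: "y \<in> FObj (FObj D i) a" and eq: "app (c (v i)) a x = app (c (v i)) a y"
    from i obtain s where s: "s \<in> T" "i = e s" by blast
    have "x \<in> FObj (A s) a" "y \<in> FObj (A s) a" "app (c s) a x = app (c s) a y"
      using x y eq s D1 v by auto
    from inj[OF a s(1) this]
    obtain t where t: "t \<in> T" "le s t" "app (d s t) a x = app (d s t) a y" by blast
    then show "\<exists>k. (i, k) \<in> ?r \<and> app (FArr D (i, k)) a x = app (FArr D (i, k)) a y"
      using s D2 by (intro exI[of _ "e t"]) auto
  qed
  then show ?thesis
  proof (rule that[OF e(2) dir])
    show "\<exists>s\<in>T. FObj D i = A s \<and> c (v i) = c s" if "i \<in> ?I" for i using that D1 v by auto
    show "\<exists>s\<in>T. \<exists>t\<in>T. le s t \<and> FArr D p = d s t" if "p \<in> ?r" for p using that D2 by auto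
  qed
qed

end

section \<open>Orbits and stabilizers\<close>

context groupoid_presheaves
begin

definition pts :: "('o, _, 'u set, _) cat_functor \<Rightarrow> ('o \<times> 'u) set" where
  "pts F = Sigma (Obj G) (FObj F)"

text \<open>A connected component of the category of elements of \<open>F\<close>. Points carry
  their object, so an orbit may meet the values of \<open>F\<close> at several objects.\<close>

definition orbit where "orbit F p = {(b, act F f (snd p)) | b f. f \<in> Hom G b (fst p)}"

definition orbits where "orbits F = orbit F ` pts F"

definition stab where "stab F p = {g \<in> Hom G (fst p) (fst p). act F g (snd p) = snd p}"

definition lift where "lift \<eta> p = (fst p, app \<eta> (fst p) (snd p))"

lemma pts_iff: "(a, x) \<in> pts F \<longleftrightarrow> a \<in> Obj G \<and> x \<in> FObj F a"
  by (simp add: pts_def)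

lemma ptsD: "p \<in> pts F \<Longrightarrow> fst p \<in> Obj G" "p \<in> pts F \<Longrightarrow> snd p \<in> FObj F (fst p)"
  by (auto simp: pts_def)

lemma orbit_iff: "(b, y) \<in> orbit F (a, x) \<longleftrightarrow> (\<exists>f\<in>Hom G b a. y = act F f x)"
  by (auto simp: orbit_def)

lemma orbitE:
  assumes "q \<in> orbit F p"
  obtains f where "f \<in> Hom G (fst q) (fst p)" "snd q = act F f (snd p)"
  using assms by (auto simp: orbit_def)

lemma orbitI: "f \<in> Hom G b (fst p) \<Longrightarrow> (b, act F f (snd p)) \<in> orbit F p"
  by (auto simp: orbit_def)

lemma orbit_self: "F \<in> Obj PSh \<Longrightarrow> p \<in> pts F \<Longrightarrow> p \<in> orbit F p"
  using orbitI[OF G_Id, of p F] act_Id[of F "fst p" "snd p"] ptsD[of p F] by simp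

lemma orbit_subset_pts: "F \<in> Obj PSh \<Longrightarrow> p \<in> pts F \<Longrightarrow> orbit F p \<subseteq> pts F"
  by (auto simp: orbit_def pts_def act_mem dest: G_Hom_Obj)

lemma orbit_subset:
  assumes F: "F \<in> Obj PSh" and p: "p \<in> pts F" and q: "q \<in> orbit F p"
  shows "orbit F q \<subseteq> orbit F p"
proof
  fix r assume "r \<in> orbit F q"
  then obtain g where g: "g \<in> Hom G (fst r) (fst q)" "snd r = act F g (snd q)" by (rule orbitE)
  obtain f where f: "f \<in> Hom G (fst q) (fst p)" "snd q = act F f (snd p)" using q by (rule orbitE)
  have "snd r = act F (Comp G f g) (snd p)"
    using act_Comp[OF F g(1) f(1) ptsD(2)[OF p]] f(2) g(2) by simp
  then show "r \<in> orbit F p" using orbitI[OF G_Comp[OF g(1) f(1)], of F] by (metis prod.collapse)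
qed

lemma orbit_sym:
  assumes F: "F \<in> Obj PSh" and p: "p \<in> pts F" and q: "q \<in> orbit F p"
  shows "p \<in> orbit F q"
proof -
  obtain f where f: "f \<in> Hom G (fst q) (fst p)" "snd q = act F f (snd p)" using q by (rule orbitE)
  have "snd p = act F (ginv f) (snd q)" using act_ginv(1)[OF F f(1) ptsD(2)[OF p]] f(2) by simp
  then show ?thesis using orbitI[OF ginv(1)[OF f(1)], of F] by (metis prod.collapse)
qed

lemma orbit_eq: "F \<in> Obj PSh \<Longrightarrow> p \<in> pts F \<Longrightarrow> q \<in> orbit F p \<Longrightarrow> orbit F q = orbit F p"
  using orbit_subset orbit_sym orbit_subset_pts by (meson subset_antisym subsetD)

lemma orbits_subset_Pow: "F \<in> Obj PSh \<Longrightarrow> orbits F \<subseteq> Pow (pts F)"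
  using orbit_subset_pts by (auto simp: orbits_def)

lemma lift_pts: "\<eta> \<in> Hom PSh F F' \<Longrightarrow> p \<in> pts F \<Longrightarrow> lift \<eta> p \<in> pts F'"
  using PSh_HomD(3) ptsD[of p F] by (auto simp: lift_def pts_def)

lemma fst_lift [simp]: "fst (lift \<eta> p) = fst p"
  by (simp add: lift_def)

text \<open>Orbits are mapped onto whole orbits, so \<open>image (lift \<eta>)\<close> is the
  induced map on sets of orbits; every counting argument goes through it.\<close>

lemma lift_orbit:
  assumes h: "\<eta> \<in> Hom PSh F F'" and p: "p \<in> pts F"
  shows "lift \<eta> ` orbit F p = orbit F' (lift \<eta> p)"
proof -
  have "lift \<eta> (b, act F f (snd p)) = (b, act F' f (snd (lift \<eta> p)))" if "f \<in> Hom G b (fst p)"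
      for b f
    using PSh_HomD(4)[OF h that ptsD(2)[OF p]] by (simp add: lift_def)
  then show ?thesis unfolding orbit_def by (auto simp: image_iff) metis+
qed

lemma lift_orbits: "\<eta> \<in> Hom PSh F F' \<Longrightarrow> image (lift \<eta>) ` orbits F \<subseteq> orbits F'"
  using lift_orbit[of \<eta> F F'] lift_pts[of \<eta> F F'] unfolding orbits_def by blast

lemma lift_inj:
  assumes "\<And>a. a \<in> Obj G \<Longrightarrow> inj_on (app \<eta> a) (FObj F a)"
  shows "inj_on (lift \<eta>) (pts F)"
  using assms by (auto simp: inj_on_def lift_def pts_def)

lemma lift_orbits_inj:
  assumes "\<eta> \<in> Hom PSh F F'" and "\<And>a. a \<in> Obj G \<Longrightarrow> inj_on (app \<eta> a) (FObj F a)"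
  shows "inj_on (image (lift \<eta>)) (orbits F)"
  using inj_on_subset[OF inj_on_image_Pow[OF lift_inj[OF assms(2)]] orbits_subset_Pow[OF
    PSh_HomD(1)[OF assms(1)]]] .

lemma lift_orbits_surj:
  assumes e: "e \<in> Hom PSh F Q" and surj: "\<And>a. a \<in> Obj G \<Longrightarrow> app e a ` FObj F a = FObj Q a"
  shows "image (lift e) ` orbits F = orbits Q"
proof
  show "orbits Q \<subseteq> image (lift e) ` orbits F"
  proof
    fix W assume "W \<in> orbits Q"
    then obtain a y where y: "a \<in> Obj G" "y \<in> FObj Q a" "W = orbit Q (a, y)"
      by (auto simp: orbits_def pts_def)
    then obtain x where x: "x \<in> FObj F a" "y = app e a x" using surj by blast
    then have "W = lift e ` orbit F (a, x)" using lift_orbit[OF e, of "(a, x)"] y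
        by (simp add: pts_iff lift_def)
    then show "W \<in> image (lift e) ` orbits F" using x y by (auto simp: orbits_def pts_iff)
  qed
qed (rule lift_orbits[OF e])

section \<open>Automorphism groups and stabilizers\<close>

lemma group_aut: "a \<in> Obj G \<Longrightarrow> group (aut_group G a)"
proof (rule groupI)
  assume a: "a \<in> Obj G"
  show "\<exists>y\<in>carrier (aut_group G a). y \<otimes>\<^bsub>aut_group G a\<^esub> x = \<one>\<^bsub>aut_group G a\<^esub>"
    if "x \<in> carrier (aut_group G a)" for x
    using that ginv[of x a a] by (auto simp: aut_group_def)
qed (auto simp: aut_group_def G_Comp G_Id G_Id_left G_assoc)

lemma aut_inv: "a \<in> Obj G \<Longrightarrow> g \<in> Hom G a a \<Longrightarrow> inv\<^bsub>aut_group G a\<^esub> g = ginv g"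
  using group.inv_equality[OF group_aut, of a "ginv g" g] ginv[of g a a]
    by (simp add: aut_group_def)

lemma aut_subgroupD:
  assumes H: "subgroup H (aut_group G a)" and a: "a \<in> Obj G"
  shows "H \<subseteq> Hom G a a" "Id G a \<in> H" "\<And>g h. g \<in> H \<Longrightarrow> h \<in> H \<Longrightarrow> Comp G g h \<in> H"
    "\<And>g. g \<in> H \<Longrightarrow> ginv g \<in> H"
proof -
  show s: "H \<subseteq> Hom G a a" using subgroup.subset[OF H] by (simp add: aut_group_def)
  show "Id G a \<in> H" using subgroup.one_closed[OF H] by (simp add: aut_group_def)
  show "Comp G g h \<in> H" if "g \<in> H" "h \<in> H" for g h
    using subgroup.m_closed[OF H that] by (simp add: aut_group_def)
  show "ginv g \<in> H" if "g \<in> H" for g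
    using subgroup.m_inv_closed[OF H that] aut_inv[OF a, of g] that s by auto
qed

lemma aut_subgroupI:
  assumes a: "a \<in> Obj G" and "H \<subseteq> Hom G a a" "Id G a \<in> H" "\<And>g h. g \<in> H \<Longrightarrow> h \<in> H \<Longrightarrow> Comp G g h \<in> H"
    "\<And>g. g \<in> H \<Longrightarrow> ginv g \<in> H"
  shows "subgroup H (aut_group G a)"
proof (rule group.subgroupI[OF group_aut[OF a]])
  show "inv\<^bsub>aut_group G a\<^esub> g \<in> H" if "g \<in> H" for g
    using assms(2,5) that aut_inv[OF a, of g] by auto
qed (use assms in \<open>auto simp: aut_group_def\<close>)

lemma stab_subgroup:
  assumes F: "F \<in> Obj PSh" and p: "p \<in> pts F"
  shows "subgroup (stab F p) (aut_group G (fst p))"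
proof (rule aut_subgroupI)
  note x = ptsD(2)[OF p]
  show "Id G (fst p) \<in> stab F p" using act_Id[OF F ptsD[OF p]] G_Id[OF ptsD(1)[OF p]]
      by (simp add: stab_def)
  show "Comp G g h \<in> stab F p" if "g \<in> stab F p" "h \<in> stab F p" for g h
    using that act_Comp[OF F, of h "fst p" "fst p" g "fst p" "snd p"] x G_Comp
      by (auto simp: stab_def)
  show "ginv g \<in> stab F p" if "g \<in> stab F p" for g
    using that act_ginv(1)[OF F, of g "fst p" "fst p" "snd p"] x ginv(1)[of g]
      by (auto simp: stab_def)
qed (use ptsD[OF p] in \<open>auto simp: stab_def\<close>)

lemma stab_lift:
  assumes h: "\<eta> \<in> Hom PSh F F'" and p: "p \<in> pts F"
  shows "stab F p \<subseteq> stab F' (lift \<eta> p)"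
proof
  fix g assume "g \<in> stab F p"
  then have g: "g \<in> Hom G (fst p) (fst p)" "act F g (snd p) = snd p" by (auto simp: stab_def)
  then show "g \<in> stab F' (lift \<eta> p)"
    using PSh_HomD(4)[OF h g(1) ptsD(2)[OF p]] by (simp add: stab_def lift_def)
qed

text \<open>An automorphism that fixes the image moves the point within one fibre of
  \<open>\<eta>\<close>, and this fibre has a single element.\<close>

lemma stab_lift_inj:
  assumes h: "\<eta> \<in> Hom PSh F F'" and p: "p \<in> pts F"
      and inj: "inj_on (app \<eta> (fst p)) (FObj F (fst p))"
  shows "stab F' (lift \<eta> p) = stab F p"
proof (intro subset_antisym subsetI)
  fix g assume "g \<in> stab F' (lift \<eta> p)"
  then have g: "g \<in> Hom G (fst p) (fst p)" "act F' g (snd (lift \<eta> p)) = snd (lift \<eta> p)"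
      by (auto simp: stab_def)
  then have "app \<eta> (fst p) (act F g (snd p)) = app \<eta> (fst p) (snd p)"
    using PSh_HomD(4)[OF h g(1) ptsD(2)[OF p]] by (simp add: lift_def)
  then show "g \<in> stab F p"
    using inj_onD[OF inj] act_mem[OF PSh_HomD(1)[OF h] g(1)] ptsD(2)[OF p] g(1)
      by (simp add: stab_def)
qed (use stab_lift[OF h p] in blast)

text \<open>Along an orbit stabilizers change by conjugation. This carries a comparison of
  stabilizers made at a representative to every point of its orbit.\<close>

lemma stab_conj:
  assumes F: "F \<in> Obj PSh" and f: "f \<in> Hom G b a" and x: "x \<in> FObj F a" and g: "g \<in> Hom G b b"
  shows "g \<in> stab F (b, act F f x) \<longleftrightarrow> Comp G f (Comp G g (ginv f)) \<in> stab F (a, x)"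
proof -
  have fx: "act F f x \<in> FObj F b" using act_mem[OF F f x] .
  have gi: "Comp G g (ginv f) \<in> Hom G a b" using G_Comp[OF ginv(1)[OF f] g] .
  have "act F (Comp G f (Comp G g (ginv f))) x = act F (ginv f) (act F g (act F f x))"
    using act_Comp[OF F gi f x] act_Comp[OF F ginv(1)[OF f] g fx] by simp
  moreover have "act F (ginv f) (act F g (act F f x)) = x \<longleftrightarrow> act F g (act F f x) = act F f x"
    using act_ginv[OF F f] x fx act_mem[OF F g fx] by metis
  ultimately show ?thesis using g G_Comp[OF gi f] by (simp add: stab_def)
qed

text \<open>Every point is \<open>act X f\<close> of a representative and must go to
  \<open>act Y f\<close> of its prescribed value. Two such expressions of the same point differ by
  an element of the stabilizer of the representative, so the inclusion of stabilizers is exactly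
  what well-definedness requires. The representatives are given as a family, which allows single
  points, sets and list positions as indices.\<close>

lemma extend_map:
  assumes X: "X \<in> Obj PSh" and Y: "Y \<in> Obj PSh"
    and K: "\<And>k. k \<in> K \<Longrightarrow> pt k \<in> pts X"
    and distinct: "\<And>k l. k \<in> K \<Longrightarrow> l \<in> K \<Longrightarrow> orbit X (pt k) = orbit X (pt l) \<Longrightarrow> k = l"
    and cover: "\<And>p. p \<in> pts X \<Longrightarrow> \<exists>k\<in>K. p \<in> orbit X (pt k)"
    and y: "\<And>k. k \<in> K \<Longrightarrow> y k \<in> FObj Y (fst (pt k))"
    and st: "\<And>k. k \<in> K \<Longrightarrow> stab X (pt k) \<subseteq> stab Y (fst (pt k), y k)"
  obtains h where "h \<in> Hom PSh X Y" "\<And>k. k \<in> K \<Longrightarrow> app h (fst (pt k)) (snd (pt k)) = y k"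
proof -
  have "\<forall>a x. \<exists>k f. (a, x) \<in> pts X \<longrightarrow> k \<in> K \<and> f \<in> Hom G a (fst (pt k)) \<and> x = act X f (snd (pt k))"
  proof (intro allI)
    fix a x
    show "\<exists>k f. (a, x) \<in> pts X \<longrightarrow> k \<in> K \<and> f \<in> Hom G a (fst (pt k)) \<and> x = act X f (snd (pt k))"
    proof (cases "(a, x) \<in> pts X")
      case True
      then obtain k where k: "k \<in> K" "(a, x) \<in> orbit X (pt k)" using cover by blast
      obtain f where "f \<in> Hom G a (fst (pt k))" "x = act X f (snd (pt k))"
        using orbitE[OF k(2)] by auto
      then show ?thesis using k(1) by blast
    qed blast
  qed
  then obtain \<kappa> \<phi> where s: "\<And>a x. (a, x) \<in> pts X \<Longrightarrow>
     \<kappa> a x \<in> K \<and> \<phi> a x \<in> Hom G a (fst (pt (\<kappa> a x))) \<and> x = act X (\<phi> a x) (snd (pt (\<kappa> a x)))"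
    by metis
  define t where "t a x = act Y (\<phi> a x) (y (\<kappa> a x))" for a x
  have t: "t a (act X f (snd (pt k))) = act Y f (y k)" if k: "k \<in> K"
      and f: "f \<in> Hom G a (fst (pt k))" for a k f
  proof -
    let ?x = "act X f (snd (pt k))" and ?a = "fst (pt k)" and ?u = "snd (pt k)"
    have u: "?u \<in> FObj X ?a" "?a \<in> Obj G" using ptsD[OF K[OF k]] by auto
    have x: "(a, ?x) \<in> pts X" using act_mem[OF X f u(1)] G_Hom_Obj[OF f] by (simp add: pts_iff)
    define k' f' where "k' = \<kappa> a ?x" and "f' = \<phi> a ?x"
    have s': "k' \<in> K" "f' \<in> Hom G a (fst (pt k'))" "?x = act X f' (snd (pt k'))"
      using s[OF x] unfolding k'_def f'_def by auto
    have "(a, ?x) \<in> orbit X (pt k)" using orbitI[OF f] .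
    moreover have "(a, ?x) \<in> orbit X (pt k')" using orbitI[OF s'(2)] s'(3) by metis
    ultimately have "orbit X (pt k) = orbit X (pt k')" using orbit_eq[OF X] K[OF k] K[OF s'(1)]
        by metis
    then have kk: "k' = k" using distinct k s'(1) by metis
    note f' = s'(2)[unfolded kk]
    \<comment> \<open>The two arrows that express the same point differ by an automorphism fixing
      the representative; by hypothesis it also fixes \<open>y k\<close>.\<close>
    have "act X (Comp G f' (ginv f)) ?u = ?u"
      using act_Comp[OF X ginv(1)[OF f] f' u(1)] s'(3) act_ginv(1)[OF X f u(1)] unfolding kk by simp
    then have "Comp G f' (ginv f) \<in> stab X (pt k)"
      using G_Comp[OF ginv(1)[OF f] f'] by (simp add: stab_def)
    then have "act Y (Comp G f' (ginv f)) (y k) = y k" using st[OF k] by (auto simp: stab_def)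
    then have "act Y (ginv f) (act Y f' (y k)) = y k" using act_Comp[OF Y ginv(1)[OF f] f' y[OF k]]
        by simp
    then have "act Y f' (y k) = act Y f (y k)" using act_ginv(2)[OF Y f act_mem[OF Y f' y[OF k]]]
        by simp
    then show ?thesis unfolding t_def k'_def[symmetric] f'_def[symmetric] kk by simp
  qed
  have h: "mk_arr X t Y \<in> Hom PSh X Y"
  proof (rule mk_arr_Hom[OF X Y])
    fix a x assume "a \<in> Obj G" "x \<in> FObj X a"
    then have "(a, x) \<in> pts X" by (simp add: pts_iff)
    from s[OF this] show "t a x \<in> FObj Y a" unfolding t_def using act_mem[OF Y] y by blast
  next
    fix g a b x assume g: "g \<in> Hom G b a" and x: "x \<in> FObj X a"
    have "(a, x) \<in> pts X" using G_Hom_Obj[OF g] x by (simp add: pts_iff)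
    then obtain k where k: "k \<in> K" "(a, x) \<in> orbit X (pt k)" using cover by blast
    obtain f where f: "f \<in> Hom G a (fst (pt k))" "x = act X f (snd (pt k))" using orbitE[OF k(2)]
        by auto
    have "act X g x = act X (Comp G f g) (snd (pt k))"
      using act_Comp[OF X g f(1) ptsD(2)[OF K[OF k(1)]]] f(2) by simp
    then have "t b (act X g x) = act Y (Comp G f g) (y k)" using t[OF k(1) G_Comp[OF g f(1)]]
        by simp
    also have "\<dots> = act Y g (t a x)" using act_Comp[OF Y g f(1) y[OF k(1)]] t[OF k(1) f(1)] f(2)
        by simp
    finally show "t b (act X g x) = act Y g (t a x)" .
  qed
  moreover have "app (mk_arr X t Y) (fst (pt k)) (snd (pt k)) = y k" if k: "k \<in> K" for k
  proof -
    note u = ptsD[OF K[OF k]]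
    have "t (fst (pt k)) (snd (pt k)) = y k"
      using t[OF k G_Id[OF u(1)]] act_Id[OF X u] act_Id[OF Y u(1) y[OF k]] by simp
    then show ?thesis using app_mk_arr[OF u] by metis
  qed
  ultimately show ?thesis using that by blast
qed

text \<open>The uniqueness belonging to \<open>extend_map\<close>: naturality spreads agreement from
  the representatives over their orbits.\<close>

lemma Hom_eq_on_cover:
  assumes h: "h \<in> Hom PSh X Y" and k: "k \<in> Hom PSh X Y" and B: "B \<subseteq> pts X"
    and cover: "\<And>p. p \<in> pts X \<Longrightarrow> \<exists>b\<in>B. p \<in> orbit X b"
    and eq: "\<And>b. b \<in> B \<Longrightarrow> app h (fst b) (snd b) = app k (fst b) (snd b)"
  shows "h = k"
proof (rule PSh_Hom_eqI[OF h k])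
  fix a x assume "a \<in> Obj G" "x \<in> FObj X a"
  then have "(a, x) \<in> pts X" by (simp add: pts_iff)
  from cover[OF this] obtain b where b: "b \<in> B" "(a, x) \<in> orbit X b" by blast
  then obtain f where f: "f \<in> Hom G a (fst b)" "x = act X f (snd b)" by (auto elim: orbitE)
  have "snd b \<in> FObj X (fst b)" using b(1) B ptsD by blast
  then show "app h a x = app k a x"
    using PSh_HomD(4)[OF h f(1)] PSh_HomD(4)[OF k f(1)] eq[OF b(1)] f(2) by simp
qed

section \<open>Orbit representatives and coset presheaves\<close>

lemma transversal:
  assumes X: "X \<in> Obj PSh"
  obtains B where "B \<subseteq> pts X" "\<And>p. p \<in> pts X \<Longrightarrow> \<exists>b\<in>B. p \<in> orbit X b"
    "\<And>b c. b \<in> B \<Longrightarrow> c \<in> B \<Longrightarrow> orbit X b = orbit X c \<Longrightarrow> b = c"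
    "finite (orbits X) \<Longrightarrow> finite B"
proof -
  define s where "s W = (SOME p. p \<in> pts X \<and> orbit X p = W)" for W
  have s: "s W \<in> pts X \<and> orbit X (s W) = W" if "W \<in> orbits X" for W
    unfolding s_def by (rule someI_ex) (use that in \<open>auto simp: orbits_def\<close>)
  show ?thesis
  proof (rule that[of "s ` orbits X"])
    show "\<exists>b\<in>s ` orbits X. p \<in> orbit X b" if "p \<in> pts X" for p
      using s[of "orbit X p"] that orbit_self[OF X that] by (auto simp: orbits_def)
    show "b = c" if "b \<in> s ` orbits X" "c \<in> s ` orbits X" "orbit X b = orbit X c" for b c
      using that s by fastforce
  qed (use s in auto)
qed

text \<open>Arrows into \<open>a\<close> are identified when they differ by an element of
  \<open>H\<close> applied afterwards; arrows of \<open>G\<close> act by precomposition. The point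
  \<open>u\<close> is the class of the identity, and \<open>g\<close> fixes it iff \<open>g\<close>
  is equivalent to the identity, that is, iff \<open>g\<close> lies in \<open>H\<close>.\<close>

lemma coset_presheaf:
  assumes a: "a \<in> Obj G" and H: "subgroup H (aut_group G a)"
  obtains P u where "P \<in> Obj PSh" "u \<in> FObj P a" "stab P (a, u) = H" "pts P = orbit P (a, u)"
proof -
  note Hs = aut_subgroupD[OF H a]
  define Y where "Y b = Hom G b a" for b
  define \<alpha> where "\<alpha> f x = Comp G x f" for f x
  define E where "E b = {(x, y). x \<in> Y b \<and> y \<in> Y b \<and> (\<exists>h\<in>H. y = Comp G h x)}" for b
  have Hh: "h \<in> Hom G a a" if "h \<in> H" for h using Hs(1) that by blast
  have refl: "(x, x) \<in> E b" if "x \<in> Y b" for b x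
    using that Hs(2) G_Id_left[of x b a] unfolding E_def Y_def by force
  obtain P q where P: "P \<in> Obj PSh" and FP: "\<And>b. b \<in> Obj G \<Longrightarrow> FObj P b = q b ` Y b"
    and q: "\<And>b x y. b \<in> Obj G \<Longrightarrow> x \<in> Y b \<Longrightarrow> y \<in> Y b \<Longrightarrow> q b x = q b y \<longleftrightarrow> (x, y) \<in> E b"
    and aP: "\<And>f b c x. f \<in> Hom G c b \<Longrightarrow> x \<in> Y b \<Longrightarrow> act P f (q b x) = q c (\<alpha> f x)"
  proof (rule quotient_presheaf[of Y \<alpha> E])
    fix b assume b: "b \<in> Obj G"
    show "small_sized small (Y b)" by (rule small_sized_subset[OF small_Arr]) (auto simp: Y_def
        Hom_iff)
    show "equiv (Y b) (E b)"
    proof (rule equivI)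
      show "E b \<subseteq> Y b \<times> Y b" unfolding E_def by auto
      show "refl_on (Y b) (E b)" using refl by (auto simp: refl_on_def)
      show "sym (E b)"
      proof (rule symI)
        fix x y assume xy: "(x, y) \<in> E b"
        then obtain h where h: "x \<in> Hom G b a" "h \<in> H" "y = Comp G h x" unfolding E_def Y_def
            by blast
        have "Comp G (ginv h) y = x"
          using G_assoc[OF h(1) Hh[OF h(2)] ginv(1)[OF Hh[OF h(2)]]] ginv(2)[OF Hh[OF h(2)]]
            G_Id_left[OF h(1)] h(3)
          by simp
        then show "(y, x) \<in> E b" using xy Hs(4)[OF h(2)] unfolding E_def by auto
      qed
      show "trans (E b)"
      proof (rule transI)
        fix x y z assume xy: "(x, y) \<in> E b" and yz: "(y, z) \<in> E b"
        then obtain h k where h: "x \<in> Hom G b a" "h \<in> H" "y = Comp G h x" "k \<in> H" "z = Comp G k y"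
          unfolding E_def Y_def by blast
        have "z = Comp G (Comp G k h) x" using G_assoc[OF h(1) Hh[OF h(2)] Hh[OF h(4)]] h by simp
        then show "(x, z) \<in> E b" using xy yz Hs(3)[OF h(4,2)] unfolding E_def by auto
      qed
    qed
    fix x assume "x \<in> Y b"
    then show "(\<alpha> (Id G b) x, x) \<in> E b" using refl[of x b] G_Id_right[of x b a]
        unfolding \<alpha>_def Y_def by simp
  next
    fix f b c x assume "f \<in> Hom G c b" "x \<in> Y b"
    then show "\<alpha> f x \<in> Y c" using G_Comp unfolding \<alpha>_def Y_def by blast
  next
    fix f b c x y assume f: "f \<in> Hom G c b" and xy: "(x, y) \<in> E b"
    then obtain h where h: "x \<in> Hom G b a" "y \<in> Hom G b a" "h \<in> H" "y = Comp G h x"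
        unfolding E_def Y_def by blast
    have "Comp G y f = Comp G h (Comp G x f)" using G_assoc[OF f h(1) Hh[OF h(3)]] h(4) by simp
    then show "(\<alpha> f x, \<alpha> f y) \<in> E c" using G_Comp[OF f h(1)] G_Comp[OF f h(2)] h(3)
        unfolding E_def \<alpha>_def Y_def by auto
  next
    fix f g b c d x assume f: "f \<in> Hom G d c" and g: "g \<in> Hom G c b" and x: "x \<in> Y b"
    have "\<alpha> (Comp G g f) x = \<alpha> f (\<alpha> g x)" "\<alpha> f (\<alpha> g x) \<in> Y d"
      using G_assoc[OF f g, of x a] G_Comp[OF f G_Comp[OF g]] x unfolding \<alpha>_def Y_def by auto
    then show "(\<alpha> (Comp G g f) x, \<alpha> f (\<alpha> g x)) \<in> E d" using refl by simp
  qed blast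
  let ?u = "q a (Id G a)"
  have I: "Id G a \<in> Y a" using G_Id[OF a] unfolding Y_def .
  have act: "act P f ?u = q b f" if "f \<in> Hom G b a" for f b
    using aP[OF that I] G_Id_left[OF that] unfolding \<alpha>_def by simp
  have "stab P (a, ?u) = {g \<in> Hom G a a. q a (Id G a) = q a g}"
    using act unfolding stab_def by auto
  also have "\<dots> = {g \<in> Hom G a a. (Id G a, g) \<in> E a}" using q[OF a I] unfolding Y_def by auto
  also have "\<dots> = H" unfolding E_def Y_def using G_Id[OF a] Hh G_Id_right[OF Hh] by auto
  finally have "stab P (a, ?u) = H" .
  moreover have "pts P = orbit P (a, ?u)"
  proof (intro subset_antisym subsetI)
    fix p assume "p \<in> pts P"
    then obtain b f where f: "f \<in> Hom G b a" "p = (b, q b f)" using FP unfolding pts_def Y_def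
        by auto
    then show "p \<in> orbit P (a, ?u)" using act orbitI[of f b "(a, ?u)" P] by simp
  next
    fix p assume "p \<in> orbit P (a, ?u)"
    then show "p \<in> pts P" using orbit_subset_pts[OF P] FP[OF a] I a by (force simp: pts_iff)
  qed
  ultimately show ?thesis using that P FP[OF a] I by blast
qed

lemma coset_map:
  assumes P: "P \<in> Obj PSh" and u: "u \<in> FObj P a" and pts: "pts P = orbit P (a, u)"
      and a: "a \<in> Obj G"
    and Y: "Y \<in> Obj PSh" and y: "y \<in> FObj Y a" and st: "stab P (a, u) \<subseteq> stab Y (a, y)"
  obtains h where "h \<in> Hom PSh P Y" "app h a u = y"
proof -
  \<comment> \<open>There is a single orbit, so its representatives are indexed by the unit
    type.\<close>
  obtain h where h: "h \<in> Hom PSh P Y" "\<And>k. k \<in> {()} \<Longrightarrow> app h (fst (a, u)) (snd (a, u)) = y"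
  proof (rule extend_map[OF P Y, of "{()}" "\<lambda>_. (a, u)" "\<lambda>_. y"])
    show "(a, u) \<in> pts P" using a u by (simp add: pts_iff)
    show "\<exists>k\<in>{()}. p \<in> orbit P (a, u)" if "p \<in> pts P" for p using that pts by simp
    show "y \<in> FObj Y (fst (a, u))" using y by simp
    show "stab P (a, u) \<subseteq> stab Y (fst (a, u), y)" using st by simp
  qed simp_all
  show ?thesis by (rule that[OF h(1)]) (use h(2) in simp)
qed

lemma coset_Hom_eq:
  assumes h: "h \<in> Hom PSh P Y" and k: "k \<in> Hom PSh P Y" and pts: "pts P = orbit P (a, u)"
    and a: "a \<in> Obj G" and u: "u \<in> FObj P a" and eq: "app h a u = app k a u"
  shows "h = k"
proof (rule Hom_eq_on_cover[OF h k, of "{(a, u)}"])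
  show "{(a, u)} \<subseteq> pts P" using a u by (simp add: pts_iff)
  show "\<exists>b\<in>{(a, u)}. p \<in> orbit P b" if "p \<in> pts P" for p using that pts by simp
qed (use eq in simp)

text \<open>The trivial subgroup lies in every stabilizer, so the generator may be sent anywhere.
  This is the existence half of the Yoneda lemma, obtained from \<open>coset_map\<close>.\<close>

lemma representable:
  assumes a: "a \<in> Obj G"
  obtains P u where "P \<in> Obj PSh" "u \<in> FObj P a" "stab P (a, u) = {Id G a}" "pts P = orbit P (a, u)"
    "\<And>Y y. Y \<in> Obj PSh \<Longrightarrow> y \<in> FObj Y a \<Longrightarrow> \<exists>h\<in>Hom PSh P Y. app h a u = y"
proof -
  have "subgroup {Id G a} (aut_group G a)"
    using group.triv_subgroup[OF group_aut[OF a]] by (simp add: aut_group_def)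
  then obtain P u where P: "P \<in> Obj PSh" "u \<in> FObj P a" "stab P (a, u) = {Id G a}"
      "pts P = orbit P (a, u)"
    using coset_presheaf[OF a] by metis
  have "\<exists>h\<in>Hom PSh P Y. app h a u = y" if Y: "Y \<in> Obj PSh" and y: "y \<in> FObj Y a" for Y y
  proof -
    have "stab P (a, u) \<subseteq> stab Y (a, y)"
      using P(3) aut_subgroupD(2)[OF stab_subgroup[OF Y]] y a by (force simp: pts_iff)
    then show ?thesis using coset_map[OF P(1,2,4) a Y y] by blast
  qed
  then show ?thesis using that P by blast
qed

text \<open>Elements at \<open>a\<close> are maps out of the representable presheaf of
  \<open>a\<close>, and a monomorphism can be cancelled from these.\<close>

lemma monic_inj:
  assumes m: "m \<in> Hom PSh X Y" and mono: "monic PSh m" and a: "a \<in> Obj G"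
  shows "inj_on (app m a) (FObj X a)"
proof (rule inj_onI)
  fix x y assume x: "x \<in> FObj X a" and y: "y \<in> FObj X a" and e: "app m a x = app m a y"
  obtain P u where P: "u \<in> FObj P a" "pts P = orbit P (a, u)"
    and ex: "\<And>Y y. Y \<in> Obj PSh \<Longrightarrow> y \<in> FObj Y a \<Longrightarrow> \<exists>h\<in>Hom PSh P Y. app h a u = y"
    by (rule representable[OF a]) blast
  obtain f g where f: "f \<in> Hom PSh P X" "app f a u = x" and g: "g \<in> Hom PSh P X" "app g a u = y"
    using ex[OF PSh_HomD(1)[OF m]] x y by blast
  have "Comp PSh m f = Comp PSh m g"
    by (rule coset_Hom_eq[OF Comp_Hom[OF cat_PSh f(1) m] Comp_Hom[OF cat_PSh g(1) m] P(2) a P(1)])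
       (use app_Comp[OF f(1) m a P(1)] app_Comp[OF g(1) m a P(1)] f g e in simp)
  then have "f = g" using mono f(1) g(1) m unfolding monic_def by (auto simp: Hom_iff)
  then show "x = y" using f g by simp
qed

text \<open>In a square with a monomorphism \<open>m\<close> on the other side, \<open>f\<close>
  identifies whatever \<open>e\<close> identifies because \<open>m\<close> is pointwise injective;
  hence \<open>f\<close> factors through the surjection \<open>e\<close>.\<close>

lemma strong_epicI:
  assumes e: "e \<in> Hom PSh F Q" and surj: "\<And>a. a \<in> Obj G \<Longrightarrow> app e a ` FObj F a = FObj Q a"
  shows "strong_epic PSh e"
  unfolding strong_epic_def epic_def
proof (intro conjI ballI impI allI)
  show "e \<in> Arr PSh" using e by (simp add: Hom_iff)
  fix f g assume "f \<in> Arr PSh" "g \<in> Arr PSh" "Cod PSh f = Cod PSh g" "Dom PSh f = Cod PSh e"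
    "Dom PSh g = Cod PSh e" and eq: "Comp PSh f e = Comp PSh g e"
  then have f: "f \<in> Hom PSh Q (Cod PSh f)" and g: "g \<in> Hom PSh Q (Cod PSh f)"
    using e by (simp_all add: Hom_iff)
  show "f = g"
  proof (rule PSh_Hom_eqI[OF f g])
    fix a y assume a: "a \<in> Obj G" and "y \<in> FObj Q a"
    then obtain x where x: "x \<in> FObj F a" "y = app e a x" using surj by blast
    then show "app f a y = app g a y" using app_Comp[OF e f a x(1)] app_Comp[OF e g a x(1)] eq
        by simp
  qed
next
  fix m f g assume m: "monic PSh m" and f: "f \<in> Hom PSh (Dom PSh e) (Dom PSh m)"
    and g: "g \<in> Hom PSh (Cod PSh e) (Cod PSh m)" and eq: "Comp PSh m f = Comp PSh g e"
  have m': "m \<in> Hom PSh (Dom PSh m) (Cod PSh m)" using m by (simp add: Hom_iff monic_def)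
  have de: "Dom PSh e = F" "Cod PSh e = Q" using e by (simp_all add: Hom_iff)
  note f = f[unfolded de] and g = g[unfolded de]
  obtain d where d: "d \<in> Hom PSh Q (Dom PSh m)" "Comp PSh d e = f"
  proof (rule factor_through_surj[OF e f surj])
    fix a x y assume a: "a \<in> Obj G" and x: "x \<in> FObj F a" and y: "y \<in> FObj F a"
      and "app e a x = app e a y"
    then have "app m a (app f a x) = app m a (app f a y)"
      using app_Comp[OF f m' a x] app_Comp[OF f m' a y] app_Comp[OF e g a x] app_Comp[OF e g a y] eq
        by simp
    then show "app f a x = app f a y"
      using inj_onD[OF monic_inj[OF m' m a]] PSh_HomD(3)[OF f a x] PSh_HomD(3)[OF f a y] by blast
  qed
  have "Comp PSh m d = g"
  proof (rule PSh_Hom_eqI[OF Comp_Hom[OF cat_PSh d(1) m'] g])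
    fix a y assume a: "a \<in> Obj G" and y: "y \<in> FObj Q a"
    then obtain x where x: "x \<in> FObj F a" "y = app e a x" using surj by blast
    have "app m a (app d a y) = app m a (app f a x)" using app_Comp[OF e d(1) a x(1)] d(2) x(2)
        by simp
    also have "\<dots> = app g a y" using app_Comp[OF f m' a x(1)] app_Comp[OF e g a x(1)] eq x(2) by simp
    finally show "app (Comp PSh m d) a y = app g a y" using app_Comp[OF d(1) m' a y] by simp
  qed
  then show "\<exists>d\<in>Hom PSh (Cod PSh e) (Dom PSh m). Comp PSh d e = f \<and> Comp PSh m d = g"
    using d de by auto
qed

end

section \<open>Finitely generated and finitely presentable presheaves\<close>

lemma directed_poset_finite_upper:
  assumes dir: "directed_poset I r" and S: "finite S" "S \<subseteq> I"
  shows "\<exists>k\<in>I. \<forall>i\<in>S. (i, k) \<in> r"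
  using S
proof (induction S rule: finite_induct)
  case empty
  then show ?case using dir by (auto simp: directed_poset_def)
next
  case (insert j S)
  then obtain k where k: "k \<in> I" "\<forall>i\<in>S. (i, k) \<in> r" by auto
  then obtain l where l: "l \<in> I" "(k, l) \<in> r" "(j, l) \<in> r"
    using directed_poset_upper[OF dir k(1), of j] insert by auto
  then show ?case using k directed_poset_trans[OF dir] by blast
qed

text \<open>Generation is expressed by minimality among subgroups. In this form it applies directly
  to the stabilizer of an image at a stage of a colimit, which is a subgroup containing
  \<open>M\<close>.\<close>

definition fin_gen_subgroup where
  "fin_gen_subgroup K H \<longleftrightarrow> (\<exists>M. finite M \<and> M \<subseteq> H \<and> (\<forall>H'. subgroup H' K \<longrightarrow> M \<subseteq> H' \<longrightarrow> H \<subseteq> H'))"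

context groupoid_presheaves
begin

text \<open>
  A map from \<open>X\<close> to the colimit is lifted to a stage on representatives of the finitely many
  orbits; the last hypothesis makes their images acquire the required stabilizers at a later stage.
  It holds trivially if the transition maps are monic.
\<close>

lemma hom_preserves_directed_colimit:
  fixes I :: "'u set"
  assumes X: "X \<in> Obj PSh" and fin: "finite (orbits X)" and I: "small I"
      and dir: "directed_poset I r"
    and col: "is_colimit (poset_category I r) PSh D L c"
    and st: "\<And>p i y. p \<in> pts X \<Longrightarrow> i \<in> I \<Longrightarrow> y \<in> FObj (FObj D i) (fst p) \<Longrightarrow>
      stab X p \<subseteq> stab L (fst p, app (c i) (fst p) y) \<Longrightarrow>
      \<exists>k. (i, k) \<in> r \<and> stab X p \<subseteq> stab (FObj D k) (fst p, app (FArr D (i, k)) (fst p) y)"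
  shows "is_colimit (poset_category I r) (set_category (\<lambda>_. True))
    (functor_comp (hom_functor PSh X) D) (FObj (hom_functor PSh X) L) (\<lambda>i. FArr (hom_functor PSh X)
        (c i))"
proof -
  note I' = small_imp_small_sized[OF I]
  note D = is_colimitD[OF col, unfolded poset_category_simps]
  note trans_Hom = poset_transition_Hom[OF dir I' col]
  note trans_Comp = poset_transition_Comp[OF dir I' col]
  obtain B where B: "B \<subseteq> pts X" "\<And>p. p \<in> pts X \<Longrightarrow> \<exists>b\<in>B. p \<in> orbit X b"
    "\<And>b c. b \<in> B \<Longrightarrow> c \<in> B \<Longrightarrow> orbit X b = orbit X c \<Longrightarrow> b = c" and finB: "finite B"
    using transversal[OF X] fin by metis
  have BO: "fst b \<in> Obj G" "snd b \<in> FObj X (fst b)" if "b \<in> B" for b using B(1) ptsD that by blast+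
  have cd: "app (c k) a (app (FArr D (i, k)) a y) = app (c i) a y"
    if "(i, k) \<in> r" "a \<in> Obj G" "y \<in> FObj (FObj D i) a" for i k a y
  proof -
    have k: "k \<in> I" using directed_poset_field[OF dir that(1)] by simp
    have "Comp PSh (c k) (FArr D (i, k)) = c i" using D(2) that(1) unfolding cocone_def by force
    then show ?thesis using app_Comp[OF trans_Hom[OF that(1)] D(6)[OF k] that(2,3)] by simp
  qed
  have surj: "\<exists>i\<in>I. \<exists>q\<in>Hom PSh X (FObj D i). Comp PSh (c i) q = p" if p: "p \<in> Hom PSh X L" for p
  proof -
    have "\<exists>i y. i \<in> I \<and> y \<in> FObj (FObj D i) (fst b) \<and> app (c i) (fst b) y = app p (fst b) (snd b) \<and>
        stab X b \<subseteq> stab (FObj D i) (fst b, y)" if b: "b \<in> B" for b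
    proof -
      note o = BO[OF b]
      obtain i y where i: "i \<in> I" "y \<in> FObj (FObj D i) (fst b)"
          "app (c i) (fst b) y = app p (fst b) (snd b)"
        using directed_colimit_surj[OF dir I' col o(1) PSh_HomD(3)[OF p o]] by blast
      have "stab X b \<subseteq> stab L (fst b, app (c i) (fst b) y)"
        using stab_lift[OF p, of b] b B(1) i(3) by (auto simp: lift_def)
      then obtain k where k: "(i, k) \<in> r" "stab X b \<subseteq> stab (FObj D k) (fst b, app (FArr D (i,
          k)) (fst b) y)"
        using st[of b i y] b B(1) i(1,2) by blast
      then show ?thesis
        using directed_poset_field[OF dir k(1)] PSh_HomD(3)[OF trans_Hom[OF k(1)] o(1) i(2)]
          cd[OF k(1) o(1) i(2)] i(3) by metis
    qed
    then obtain \<iota> \<upsilon> where s: "\<And>b. b \<in> B \<Longrightarrow> \<iota> b \<in> I \<and> \<upsilon> b \<in> FObj (FObj D (\<iota> b)) (fst b) \<and>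
        app (c (\<iota> b)) (fst b) (\<upsilon> b) = app p (fst b) (snd b) \<and> stab X b \<subseteq> stab (FObj D (\<iota> b)) (fst b,
            \<upsilon> b)"
      by metis
    \<comment> \<open>Finitely many representatives, so one stage lies above all the stages found
      for them. Stabilizers only grow on the way, so the inclusions survive.\<close>
    obtain k where k: "k \<in> I" "\<And>b. b \<in> B \<Longrightarrow> (\<iota> b, k) \<in> r"
      using directed_poset_finite_upper[OF dir, of "\<iota> ` B"] finB s by blast
    let ?y = "\<lambda>b. app (FArr D (\<iota> b, k)) (fst b) (\<upsilon> b)"
    obtain q where q: "q \<in> Hom PSh X (FObj D k)" "\<And>b. b \<in> B \<Longrightarrow> app q (fst b) (snd b) = ?y b"
    proof (rule extend_map[OF X, of "FObj D k" B "\<lambda>b. b" ?y])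
      show "FObj D k \<in> Obj PSh" using PSh_HomD(1)[OF D(6)[OF k(1)]] .
      show "\<exists>b\<in>B. z \<in> orbit X b" if "z \<in> pts X" for z using B(2)[OF that] .
      show "?y b \<in> FObj (FObj D k) (fst b)" if "b \<in> B" for b
        using PSh_HomD(3)[OF trans_Hom[OF k(2)[OF that]] BO(1)[OF that]] s[OF that] by blast
      show "stab X b \<subseteq> stab (FObj D k) (fst b, ?y b)" if b: "b \<in> B" for b
        using stab_lift[OF trans_Hom[OF k(2)[OF b]], of "(fst b, \<upsilon> b)"] s[OF b] BO(1)[OF b]
        by (auto simp: lift_def pts_iff)
    qed (use B in auto)
    have "Comp PSh (c k) q = p"
    proof (rule Hom_eq_on_cover[OF Comp_Hom[OF cat_PSh q(1) D(6)[OF k(1)]] p B(1,2)])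
      fix b assume b: "b \<in> B"
      show "app (Comp PSh (c k) q) (fst b) (snd b) = app p (fst b) (snd b)"
        using app_Comp[OF q(1) D(6)[OF k(1)] BO[OF b]] q(2)[OF b]
          cd[OF k(2)[OF b] BO(1)[OF b], of "\<upsilon> b"] s[OF b] by simp
    qed
    then show ?thesis using k(1) q(1) by blast
  qed
  have inj: "\<exists>k. (i, k) \<in> r \<and> Comp PSh (FArr D (i, k)) q = Comp PSh (FArr D (i, k)) q'"
    if i: "i \<in> I" and q: "q \<in> Hom PSh X (FObj D i)" and q': "q' \<in> Hom PSh X (FObj D i)"
      and e: "Comp PSh (c i) q = Comp PSh (c i) q'" for i q q'
  proof -
    have "\<exists>k. (i, k) \<in> r \<and> app (FArr D (i, k)) (fst b) (app q (fst b) (snd b)) =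
        app (FArr D (i, k)) (fst b) (app q' (fst b) (snd b))" if b: "b \<in> B" for b
    proof -
      note o = BO[OF b]
      have "app (c i) (fst b) (app q (fst b) (snd b)) = app (c i) (fst b) (app q' (fst b) (snd b))"
        using app_Comp[OF q D(6)[OF i] o] app_Comp[OF q' D(6)[OF i] o] e by simp
      from directed_colimit_inj[OF dir I' col o(1) i i PSh_HomD(3)[OF q o] PSh_HomD(3)[OF q' o]
          this]
      show ?thesis by blast
    qed
    then obtain \<kappa> where \<kappa>: "\<And>b. b \<in> B \<Longrightarrow> (i, \<kappa> b) \<in> r \<and> app (FArr D (i,
        \<kappa> b)) (fst b) (app q (fst b) (snd b)) =
        app (FArr D (i, \<kappa> b)) (fst b) (app q' (fst b) (snd b))" by metis
    \<comment> \<open>Adding \<open>i\<close> itself keeps the common stage above \<open>i\<close>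
      even when there are no representatives.\<close>
    have "insert i (\<kappa> ` B) \<subseteq> I" using \<kappa> directed_poset_field[OF dir] i by blast
    then obtain k where k: "k \<in> I" "(i, k) \<in> r" "\<And>b. b \<in> B \<Longrightarrow> (\<kappa> b, k) \<in> r"
      using directed_poset_finite_upper[OF dir, of "insert i (\<kappa> ` B)"] finB by blast
    note ik = trans_Hom[OF k(2)]
    have "Comp PSh (FArr D (i, k)) q = Comp PSh (FArr D (i, k)) q'"
    proof (rule Hom_eq_on_cover[OF Comp_Hom[OF cat_PSh q ik] Comp_Hom[OF cat_PSh q' ik] B(1,2)])
      fix b assume b: "b \<in> B"
      note o = BO[OF b] and \<kappa>b = conjunct1[OF \<kappa>[OF b]]
      show "app (Comp PSh (FArr D (i, k)) q) (fst b) (snd b) = app (Comp PSh (FArr D (i,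
          k)) q') (fst b) (snd b)"
        using app_Comp[OF q ik o] app_Comp[OF q' ik o] \<kappa>[OF b]
          trans_Comp[OF \<kappa>b k(3)[OF b] o(1) PSh_HomD(3)[OF q o]]
          trans_Comp[OF \<kappa>b k(3)[OF b] o(1) PSh_HomD(3)[OF q' o]] by simp
    qed
    then show ?thesis using k(2) by blast
  qed
  show ?thesis by (rule hom_functor_preservesI[OF cat_PSh dir D(1) D(2) surj inj])
qed

text \<open>With monic transition maps the maps into the colimit are injective: two elements with
  the same image already agree at a stage, where the transition map separates them. So stabilizers
  in the colimit equal those at stage \<open>i\<close>.\<close>

lemma finite_orbits_imp_finitely_generated:
  assumes X: "X \<in> Obj PSh" and fin: "finite (orbits X)"
  shows "finitely_generated small PSh X"
  unfolding finitely_generated_def preserves_colimits_def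
proof (intro conjI X allI impI)
  fix I :: "'u set" and r D L c
  assume I: "small I" and dir: "directed_poset I r" and mono: "\<forall>p\<in>r. monic PSh (FArr D p)"
    and col: "is_colimit (poset_category I r) PSh D L c"
  note I' = small_imp_small_sized[OF I]
  note D = is_colimitD[OF col, unfolded poset_category_simps]
  show "is_colimit (poset_category I r) (set_category (\<lambda>_. True))
    (functor_comp (hom_functor PSh X) D) (FObj (hom_functor PSh X) L) (\<lambda>i. FArr (hom_functor PSh X)
        (c i))"
  proof (rule hom_preserves_directed_colimit[OF X fin I dir col])
    fix p i y assume p: "p \<in> pts X" and i: "i \<in> I" and y: "y \<in> FObj (FObj D i) (fst p)"
      and st: "stab X p \<subseteq> stab L (fst p, app (c i) (fst p) y)"
    have o: "fst p \<in> Obj G" using ptsD[OF p] by simp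
    have ii: "(i, i) \<in> r" using directed_poset_refl[OF dir i] .
    have inj: "inj_on (app (c i) (fst p)) (FObj (FObj D i) (fst p))"
    proof (rule inj_onI)
      fix x z assume x: "x \<in> FObj (FObj D i) (fst p)" and z: "z \<in> FObj (FObj D i) (fst p)"
        and "app (c i) (fst p) x = app (c i) (fst p) z"
      then obtain k where k: "(i, k) \<in> r" "app (FArr D (i, k)) (fst p) x = app (FArr D (i,
          k)) (fst p) z"
        using directed_colimit_inj[OF dir I' col o i i x z] by blast
      then show "x = z"
        using inj_onD[OF monic_inj[OF poset_transition_Hom[OF dir I' col k(1)] _ o] k(2) x z] mono
          by blast
    qed
    have "stab X p \<subseteq> stab (FObj D i) (fst p, y)"
      using stab_lift_inj[OF D(6)[OF i], of "(fst p, y)"] inj st y o by (simp add: pts_iff lift_def)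
    \<comment> \<open>The required conclusion mentions a transition map, so stage \<open>i\<close>
      is reached along the reflexive arrow \<open>(i, i)\<close>.\<close>
    moreover have "stab (FObj D i) (fst p, y) \<subseteq> stab (FObj D i) (fst p, app (FArr D (i,
        i)) (fst p) y)"
      using stab_lift[OF poset_transition_Hom[OF dir I' col ii], of "(fst p, y)"] y o
        by (simp add: pts_iff lift_def)
    ultimately show "\<exists>k. (i, k) \<in> r \<and> stab X p \<subseteq> stab (FObj D k) (fst p, app (FArr D (i,
        k)) (fst p) y)"
      using ii by blast
  qed
qed

text \<open>Each generator of the stabilizer fixes the image of the point at some later stage. A
  stage above these finitely many has a stabilizer containing all generators, hence the whole of
  \<open>stab X p\<close>.\<close>

lemma finitely_presentableI:
  assumes X: "X \<in> Obj PSh" and fin: "finite (orbits X)"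
    and fg: "\<And>p. p \<in> pts X \<Longrightarrow> fin_gen_subgroup (aut_group G (fst p)) (stab X p)"
  shows "finitely_presentable small PSh X"
  unfolding finitely_presentable_def preserves_colimits_def
proof (intro conjI X allI impI)
  fix I :: "'u set" and r D L c
  assume I: "small I" and dir: "directed_poset I r"
    and col: "is_colimit (poset_category I r) PSh D L c"
  note I' = small_imp_small_sized[OF I]
  note D = is_colimitD[OF col, unfolded poset_category_simps]
  note trans_Hom = poset_transition_Hom[OF dir I' col]
  show "is_colimit (poset_category I r) (set_category (\<lambda>_. True))
    (functor_comp (hom_functor PSh X) D) (FObj (hom_functor PSh X) L) (\<lambda>i. FArr (hom_functor PSh X)
        (c i))"
  proof (rule hom_preserves_directed_colimit[OF X fin I dir col])
    fix p i y assume p: "p \<in> pts X" and i: "i \<in> I" and y: "y \<in> FObj (FObj D i) (fst p)"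
      and st: "stab X p \<subseteq> stab L (fst p, app (c i) (fst p) y)"
    let ?a = "fst p"
    have o: "?a \<in> Obj G" using ptsD[OF p] by simp
    note Di = PSh_HomD(1)[OF D(6)[OF i]]
    obtain M where M: "finite M" "M \<subseteq> stab X p"
      "\<And>H'. subgroup H' (aut_group G ?a) \<Longrightarrow> M \<subseteq> H' \<Longrightarrow> stab X p \<subseteq> H'"
      using fg[OF p] unfolding fin_gen_subgroup_def by blast
    have MH: "g \<in> Hom G ?a ?a" if "g \<in> M" for g using M(2) that by (auto simp: stab_def)
    have "\<exists>k. (i, k) \<in> r \<and> app (FArr D (i, k)) ?a (act (FObj D i) g y) = app (FArr D (i, k)) ?a y"
      if g: "g \<in> M" for g
    proof -
      have gy: "act (FObj D i) g y \<in> FObj (FObj D i) ?a" using act_mem[OF Di MH[OF g] y] .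
      have "app (c i) ?a (act (FObj D i) g y) = app (c i) ?a y"
        using PSh_HomD(4)[OF D(6)[OF i] MH[OF g] y] st M(2) g by (auto simp: stab_def)
      then show ?thesis using directed_colimit_inj[OF dir I' col o i i gy y] by blast
    qed
    then obtain \<kappa> where \<kappa>: "\<And>g. g \<in> M \<Longrightarrow> (i, \<kappa> g) \<in> r \<and>
        app (FArr D (i, \<kappa> g)) ?a (act (FObj D i) g y) = app (FArr D (i, \<kappa> g)) ?a y" by metis
    have "insert i (\<kappa> ` M) \<subseteq> I" using \<kappa> directed_poset_field[OF dir] i by blast
    then obtain k where k: "k \<in> I" "(i, k) \<in> r" "\<And>g. g \<in> M \<Longrightarrow> (\<kappa> g, k) \<in> r"
      using directed_poset_finite_upper[OF dir, of "insert i (\<kappa> ` M)"] M(1) by blast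
    let ?z = "app (FArr D (i, k)) ?a y"
    have z: "?z \<in> FObj (FObj D k) ?a" using PSh_HomD(3)[OF trans_Hom[OF k(2)] o y] .
    have "M \<subseteq> stab (FObj D k) (?a, ?z)"
    proof
      fix g assume g: "g \<in> M"
      have gy: "act (FObj D i) g y \<in> FObj (FObj D i) ?a" using act_mem[OF Di MH[OF g] y] .
      have "act (FObj D k) g ?z = app (FArr D (i, k)) ?a (act (FObj D i) g y)"
        using PSh_HomD(4)[OF trans_Hom[OF k(2)] MH[OF g] y] by simp
      also have "\<dots> = ?z"
        using poset_transition_Comp[OF dir I' col _ k(3)[OF g] o gy] \<kappa>[OF g]
          poset_transition_Comp[OF dir I' col _ k(3)[OF g] o y] by simp
      finally show "g \<in> stab (FObj D k) (?a, ?z)" using MH[OF g] by (simp add: stab_def)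
    qed
    moreover have "subgroup (stab (FObj D k) (?a, ?z)) (aut_group G ?a)"
      using stab_subgroup[OF PSh_HomD(1)[OF D(6)[OF k(1)]], of "(?a, ?z)"] o z
        by (simp add: pts_iff)
    ultimately have "stab X p \<subseteq> stab (FObj D k) (?a, ?z)" using M(3) by blast
    then show "\<exists>k. (i, k) \<in> r \<and> stab X p \<subseteq> stab (FObj D k) (?a, app (FArr D (i, k)) ?a y)"
      using k(2) by blast
  qed
qed

lemma finitely_presentable_imp_finitely_generated:
  "finitely_presentable small C X \<Longrightarrow> finitely_generated small C X"
  unfolding finitely_presentable_def finitely_generated_def
  by (elim conjE, intro conjI allI impI) (assumption, elim allE, elim impE, assumption+)

text \<open>A subobject given by an arbitrary monomorphism with the right image, rather than by a
  canonical subpresheaf. This permits replacing \<open>S\<close> by an isomorphic presheaf from a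
  fixed small set.\<close>

definition generated_by where
  "generated_by X P S m \<longleftrightarrow> m \<in> Hom PSh S X \<and> (\<forall>a\<in>Obj G. inj_on (app m a) (FObj S a)) \<and>
     (\<forall>a\<in>Obj G. app m a ` FObj S a = {x. \<exists>p\<in>P. (a, x) \<in> orbit X p})"

lemma generated_byD:
  assumes "generated_by X P S m"
  shows "m \<in> Hom PSh S X" "\<And>a. a \<in> Obj G \<Longrightarrow> inj_on (app m a) (FObj S a)"
    "\<And>a. a \<in> Obj G \<Longrightarrow> app m a ` FObj S a = {x. \<exists>p\<in>P. (a, x) \<in> orbit X p}"
  using assms unfolding generated_by_def by simp_all

lemma generated_subpresheaf:
  assumes X: "X \<in> Obj PSh" and P: "P \<subseteq> pts X"
  shows "\<exists>S m. generated_by X P S m"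
proof -
  let ?X = "\<lambda>a. {x. \<exists>p\<in>P. (a, x) \<in> orbit X p}"
  obtain S m where m: "m \<in> Hom PSh S X" "\<And>a. a \<in> Obj G \<Longrightarrow> FObj S a = ?X a"
    "\<And>a x. a \<in> Obj G \<Longrightarrow> x \<in> ?X a \<Longrightarrow> app m a x = x"
  proof (rule subpresheaf[OF X, of ?X])
    show "?X a \<subseteq> FObj X a" for a
      using P orbit_subset_pts[OF X] by (auto simp: pts_def)
    show "act X f x \<in> ?X b" if f: "f \<in> Hom G b a" and x: "x \<in> ?X a" for f a b x
      using x P orbit_subset[OF X] orbitI[of f b "(a, x)" X] f by fastforce
  qed blast
  show ?thesis
    unfolding generated_by_def
  proof (intro exI[of _ S] exI[of _ m] conjI ballI m(1))
    fix a assume a: "a \<in> Obj G"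
    show "inj_on (app m a) (FObj S a)" using m(2,3)[OF a] by (simp add: inj_on_def)
    show "app m a ` FObj S a = ?X a" unfolding m(2)[OF a] using m(3)[OF a] by force
  qed
qed

text \<open>Indexing by finite sets of points, and not by subobjects, makes the index set small and
  its order plain inclusion. The parameter \<open>\<S>\<close> prescribes where the stages are taken
  from: anywhere for testing finite generation, from a small set of codes for local finite
  presentability.\<close>

lemma union_of_generated:
  assumes X: "X \<in> Obj PSh" and ex: "\<forall>P\<in>Fpow (pts X). \<exists>S m. S \<in> \<S> \<and> generated_by X P S m"
  shows "\<exists>(I :: 'u set) r D c. small I \<and> directed_poset I r \<and>
    is_colimit (poset_category I r) PSh D X c \<and>
    (\<forall>i\<in>I. FObj D i \<in> \<S> \<and> (\<exists>P\<in>Fpow (pts X). generated_by X P (FObj D i) (c i))) \<and>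
    (\<forall>p\<in>r. monic PSh (FArr D p))"
proof -
  obtain A m where Am: "\<And>P. P \<in> Fpow (pts X) \<Longrightarrow> A P \<in> \<S> \<and> generated_by X P (A P) (m P)"
    using ex by metis
  note g = generated_byD[OF conjunct2[OF Am]]
  note m = g(1) and inj = g(2) and im = g(3)
  let ?T = "Fpow (pts X)"
  have O: "A P \<in> Obj PSh" if "P \<in> ?T" for P using PSh_HomD(1)[OF m[OF that]] .
  have "\<exists>h. h \<in> Hom PSh (A P) (A Q) \<and> Comp PSh (m Q) h = m P"
    if P: "P \<in> ?T" and Q: "Q \<in> ?T" and PQ: "P \<subseteq> Q" for P Q
  proof -
    have "app (m P) a x \<in> app (m Q) a ` FObj (A Q) a" if a: "a \<in> Obj G" and x: "x \<in> FObj (A P) a"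
        for a x
      unfolding im[OF Q a] using im[OF P a] x PQ by blast
    then show ?thesis using factor_through_inj[OF m[OF P] m[OF Q] inj[OF Q]] by metis
  qed
  then obtain d where d: "\<And>P Q. P \<in> ?T \<Longrightarrow> Q \<in> ?T \<Longrightarrow> P \<subseteq> Q \<Longrightarrow>
      d P Q \<in> Hom PSh (A P) (A Q) \<and> Comp PSh (m Q) (d P Q) = m P" by metis
  \<comment> \<open>The stages are subobjects of \<open>X\<close>, so the functor laws of the
    diagram may be checked after composing with the inclusions.\<close>
  have cancel: "h = k" if Q: "Q \<in> ?T" and h: "h \<in> Hom PSh B (A Q)" and k: "k \<in> Hom PSh B (A Q)"
    and e: "Comp PSh (m Q) h = Comp PSh (m Q) k" for B Q h k
    using monicI[OF m[OF Q] inj[OF Q]] h k e m[OF Q] unfolding monic_def by (auto simp: Hom_iff)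
  obtain I :: "'u set" and r D c where res: "small I" "directed_poset I r"
    "is_colimit (poset_category I r) PSh D X c"
    "\<And>i. i \<in> I \<Longrightarrow> \<exists>P\<in>?T. FObj D i = A P \<and> c i = m P"
    "\<And>p. p \<in> r \<Longrightarrow> \<exists>P\<in>?T. \<exists>Q\<in>?T. P \<subseteq> Q \<and> FArr D p = d P Q"
  proof (rule directed_diagram[of ?T "(\<subseteq>)" A d m X])
    have "small_sized small (pts X)"
      unfolding pts_def by (rule small_sized_Sigma[OF small_Obj small_imp_small_sized[OF
        small_FObj[OF X]]])
    then show "small_sized small ?T" by (rule small_sized_Fpow)
    show "?T \<noteq> {}" by (auto simp: Fpow_def)
    show "\<exists>U\<in>?T. P \<subseteq> U \<and> Q \<subseteq> U" if "P \<in> ?T" "Q \<in> ?T" for P Q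
      by (rule bexI[of _ "P \<union> Q"]) (use that in \<open>auto simp: Fpow_def\<close>)
    show "d P P = Id PSh (A P)" if P: "P \<in> ?T" for P
    proof (rule cancel[OF P])
      show "Comp PSh (m P) (d P P) = Comp PSh (m P) (Id PSh (A P))"
        using d[OF P P] Comp_Id_right[OF cat_PSh m[OF P]] by simp
    qed (use d[OF P P] Id_Hom[OF cat_PSh O[OF P]] in auto)
    show "d P R = Comp PSh (d Q R) (d P Q)" if P: "P \<in> ?T" and Q: "Q \<in> ?T" and R: "R \<in> ?T"
      and PQ: "P \<subseteq> Q" and QR: "Q \<subseteq> R" for P Q R
    proof (rule cancel[OF R])
      note dd = d[OF P Q PQ] d[OF Q R QR] d[OF P R subset_trans[OF PQ QR]]
      show "d P R \<in> Hom PSh (A P) (A R)" "Comp PSh (d Q R) (d P Q) \<in> Hom PSh (A P) (A R)"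
        using dd Comp_Hom[OF cat_PSh] by blast+
      show "Comp PSh (m R) (d P R) = Comp PSh (m R) (Comp PSh (d Q R) (d P Q))"
        using dd Comp_assoc[OF cat_PSh, of "d P Q" "A P" "A Q" "d Q R" "A R" "m R" X] m[OF R]
          by simp
    qed
    show "\<exists>P\<in>?T. y \<in> app (m P) a ` FObj (A P) a" if a: "a \<in> Obj G" and y: "y \<in> FObj X a" for a y
    proof (rule bexI[of _ "{(a, y)}"])
      have ay: "(a, y) \<in> pts X" using a y by (simp add: pts_iff)
      then show P: "{(a, y)} \<in> ?T" by (simp add: Fpow_def)
      show "y \<in> app (m {(a, y)}) a ` FObj (A {(a, y)}) a"
        unfolding im[OF P a] using orbit_self[OF X ay] by simp
    qed
    show "\<exists>t\<in>?T. P \<subseteq> t \<and> app (d P t) a x = app (d P t) a y"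
      if a: "a \<in> Obj G" and P: "P \<in> ?T" and x: "x \<in> FObj (A P) a" and y: "y \<in> FObj (A P) a"
        and e: "app (m P) a x = app (m P) a y" for a P x y
      using inj_onD[OF inj[OF P a] e x y] P by blast
  qed (use O d m in auto)
  show ?thesis
  proof (intro exI[of _ I] exI[of _ r] exI[of _ D] exI[of _ c] conjI ballI res(1-3))
    fix i assume "i \<in> I"
    then show "FObj D i \<in> \<S>" "\<exists>P\<in>?T. generated_by X P (FObj D i) (c i)"
      using res(4) Am by metis+
  next
    fix p assume "p \<in> r"
    then obtain P Q where P: "P \<in> ?T" "Q \<in> ?T" "P \<subseteq> Q" "FArr D p = d P Q" using res(5) by blast
    note dPQ = d[OF P(1-3)]
    show "monic PSh (FArr D p)"
      unfolding P(4)
    proof (rule monicI[OF conjunct1[OF dPQ]])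
      fix a assume a: "a \<in> Obj G"
      show "inj_on (app (d P Q) a) (FObj (A P) a)"
      proof (rule inj_onI)
        fix x y assume x: "x \<in> FObj (A P) a" and y: "y \<in> FObj (A P) a"
            and "app (d P Q) a x = app (d P Q) a y"
        then have "app (m P) a x = app (m P) a y"
          using app_Comp[OF conjunct1[OF dPQ] m[OF P(2)] a x]
            app_Comp[OF conjunct1[OF dPQ] m[OF P(2)] a y] dPQ
          by simp
        then show "x = y" using inj_onD[OF inj[OF P(1) a] _ x y] by blast
      qed
    qed
  qed
qed

text \<open>\<open>X\<close> is the directed union of its finitely generated subpresheaves, so its
  identity factors through one of them. The finitely many generators of that stage meet every orbit
  of \<open>X\<close>.\<close>

lemma finitely_generated_imp_finite_orbits:
  assumes "finitely_generated small PSh X"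
  shows "X \<in> Obj PSh \<and> finite (orbits X)"
proof
  show X: "X \<in> Obj PSh" using assms by (simp add: finitely_generated_def)
  have ex: "\<forall>P\<in>Fpow (pts X). \<exists>S m. S \<in> UNIV \<and> generated_by X P S m"
    using generated_subpresheaf[OF X] by (simp add: Fpow_def)
  obtain I :: "'u set" and r D c where res: "small I" "directed_poset I r"
    "is_colimit (poset_category I r) PSh D X c"
    "\<forall>i\<in>I. FObj D i \<in> UNIV \<and> (\<exists>P\<in>Fpow (pts X). generated_by X P (FObj D i) (c i))"
    "\<forall>p\<in>r. monic PSh (FArr D p)"
    using union_of_generated[OF X ex] by (elim exE conjE)
  have "preserves_colimits (poset_category I r) PSh (set_category (\<lambda>_. True)) (hom_functor PSh X) D"
    using assms res(1,2,5) is_colimitD(1)[OF res(3)] unfolding finitely_generated_def by simp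
  then obtain i q where i: "i \<in> Obj (poset_category I r)" and q: "q \<in> Hom PSh X (FObj D i)"
    and e: "Comp PSh (c i) q = Id PSh X"
    by (rule preserves_colimits_factor[OF cat_PSh _ res(3) Id_Hom[OF cat_PSh X]]) blast
  obtain P where P: "P \<in> Fpow (pts X)" and gP: "generated_by X P (FObj D i) (c i)"
    using res(4) i by auto
  note m = generated_byD[OF gP]
  have "orbits X \<subseteq> orbit X ` P"
  proof
    fix W assume "W \<in> orbits X"
    then obtain a x where x: "a \<in> Obj G" "x \<in> FObj X a" "W = orbit X (a, x)"
        by (auto simp: orbits_def pts_def)
    have "app (c i) a (app q a x) = x"
      using app_Comp[OF q m(1) x(1,2)] e app_Id[OF X x(1,2)] by simp
    then have "x \<in> app (c i) a ` FObj (FObj D i) a" using PSh_HomD(3)[OF q x(1,2)] by force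
    then obtain p where p: "p \<in> P" "(a, x) \<in> orbit X p" using m(3)[OF x(1)] by blast
    then show "W \<in> orbit X ` P" using orbit_eq[OF X _ p(2)] P x(3) by (auto simp: Fpow_def)
  qed
  then show "finite (orbits X)" using P finite_surj by (auto simp: Fpow_def)
qed

text \<open>
  A presheaf with finitely many orbits is determined up to isomorphism by the stabilizers of orbit
  representatives. When these are finitely generated, finitely many objects and arrows suffice to
  record them.
\<close>

definition has_code :: "('o, _, 'u set, _) cat_functor \<Rightarrow> ('o \<times> 'm list) list \<Rightarrow> bool" where
  "has_code X c \<longleftrightarrow> X \<in> Obj PSh \<and> (\<exists>pt.
     (\<forall>i<length c. pt i \<in> pts X \<and> fst (pt i) = fst (c ! i) \<and> set (snd (c ! i)) \<subseteq> stab X (pt i) \<and>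
        (\<forall>H. subgroup H (aut_group G (fst (c ! i))) \<longrightarrow> set (snd (c ! i)) \<subseteq> H \<longrightarrow> stab X (pt i) \<subseteq> H)) \<and>
     (\<forall>i<length c. \<forall>j<length c. orbit X (pt i) = orbit X (pt j) \<longrightarrow> i = j) \<and>
     (\<forall>p\<in>pts X. \<exists>i<length c. p \<in> orbit X (pt i)))"

lemma has_code_finite_orbits: "has_code X c \<Longrightarrow> X \<in> Obj PSh \<and> finite (orbits X)"
proof
  assume h: "has_code X c"
  then show X: "X \<in> Obj PSh" by (simp add: has_code_def)
  obtain pt where pt: "\<forall>i<length c. pt i \<in> pts X \<and> fst (pt i) = fst (c ! i) \<and>
      set (snd (c ! i)) \<subseteq> stab X (pt i) \<and>
        (\<forall>H. subgroup H (aut_group G (fst (c ! i))) \<longrightarrow> set (snd (c ! i)) \<subseteq> H \<longrightarrow> stab X (pt i) \<subseteq> H)"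
      "\<forall>i<length c. \<forall>j<length c. orbit X (pt i) = orbit X (pt j) \<longrightarrow> i = j"
      "\<forall>p\<in>pts X. \<exists>i<length c. p \<in> orbit X (pt i)"
    using h unfolding has_code_def by blast
  have "orbits X \<subseteq> (\<lambda>i. orbit X (pt i)) ` {..<length c}"
  proof
    fix W assume "W \<in> orbits X"
    then obtain p where p: "p \<in> pts X" "W = orbit X p" by (auto simp: orbits_def)
    then obtain i where i: "i < length c" "p \<in> orbit X (pt i)" using pt(3) by blast
    then have "W = orbit X (pt i)" using orbit_eq[OF X] pt(1) p(2) by blast
    then show "W \<in> (\<lambda>i. orbit X (pt i)) ` {..<length c}" using i(1) by blast
  qed
  then show "finite (orbits X)" using finite_surj by blast
qed

text \<open>The code lists objects and generators of the stabilizers, and generators determine a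
  stabilizer as the least subgroup containing them. Hence representatives with the same position
  have the same stabilizer, and maps in both directions match them up.\<close>

lemma has_code_iso:
  assumes cX: "has_code X c" and cY: "has_code Y c"
  obtains h where "h \<in> Hom PSh X Y" "\<And>a. a \<in> Obj G \<Longrightarrow> bij_betw (app h a) (FObj X a) (FObj Y a)"
proof -
  \<comment> \<open>Stated for arbitrary \<open>X\<close> and \<open>Y\<close> because it is applied
    in both directions; of the target only the weaker fact is used that its stabilizers contain the
    listed generators.\<close>
  have map: "\<exists>h\<in>Hom PSh X Y. \<forall>i<length c. app h (fst (c ! i)) (snd (pt i)) = snd (pt' i)"
    if X: "X \<in> Obj PSh" and Y: "Y \<in> Obj PSh"
    and pt: "\<forall>i<length c. pt i \<in> pts X \<and> fst (pt i) = fst (c ! i) \<and>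
        set (snd (c ! i)) \<subseteq> stab X (pt i) \<and>
        (\<forall>H. subgroup H (aut_group G (fst (c ! i))) \<longrightarrow> set (snd (c ! i)) \<subseteq> H \<longrightarrow> stab X (pt i) \<subseteq> H)"
      "\<forall>i<length c. \<forall>j<length c. orbit X (pt i) = orbit X (pt j) \<longrightarrow> i = j"
      "\<forall>p\<in>pts X. \<exists>i<length c. p \<in> orbit X (pt i)"
    and pt': "\<forall>i<length c. pt' i \<in> pts Y \<and> fst (pt' i) = fst (c ! i) \<and>
        set (snd (c ! i)) \<subseteq> stab Y (pt' i)"
    for X Y pt pt'
  proof -
    obtain h where h: "h \<in> Hom PSh X Y"
      "\<And>i. i \<in> {..<length c} \<Longrightarrow> app h (fst (pt i)) (snd (pt i)) = snd (pt' i)"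
    proof (rule extend_map[OF X Y, of "{..<length c}" pt "\<lambda>i. snd (pt' i)"])
      show "snd (pt' i) \<in> FObj Y (fst (pt i))" if "i \<in> {..<length c}" for i
        using pt(1) pt' that ptsD(2)[of "pt' i" Y] by simp
      show "stab X (pt i) \<subseteq> stab Y (fst (pt i), snd (pt' i))" if i: "i \<in> {..<length c}" for i
      proof -
        have "(fst (pt i), snd (pt' i)) = pt' i" using pt(1) pt' i by (simp add: prod_eq_iff)
        moreover have "subgroup (stab Y (pt' i)) (aut_group G (fst (c ! i)))"
          using stab_subgroup[OF Y, of "pt' i"] pt' i by simp
        ultimately show ?thesis using pt(1) pt' i by simp
      qed
    qed (use pt in auto)
    then show ?thesis using pt(1) by (intro bexI[of _ h]) auto
  qed
  have X: "X \<in> Obj PSh" and Y: "Y \<in> Obj PSh" using cX cY by (auto simp: has_code_def)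
  obtain pt where pt: "\<forall>i<length c. pt i \<in> pts X \<and> fst (pt i) = fst (c ! i) \<and>
      set (snd (c ! i)) \<subseteq> stab X (pt i) \<and>
        (\<forall>H. subgroup H (aut_group G (fst (c ! i))) \<longrightarrow> set (snd (c ! i)) \<subseteq> H \<longrightarrow> stab X (pt i) \<subseteq> H)"
      "\<forall>i<length c. \<forall>j<length c. orbit X (pt i) = orbit X (pt j) \<longrightarrow> i = j"
      "\<forall>p\<in>pts X. \<exists>i<length c. p \<in> orbit X (pt i)"
    using cX unfolding has_code_def by blast
  obtain pt' where pt': "\<forall>i<length c. pt' i \<in> pts Y \<and> fst (pt' i) = fst (c ! i) \<and>
      set (snd (c ! i)) \<subseteq> stab Y (pt' i) \<and>
        (\<forall>H. subgroup H (aut_group G (fst (c ! i))) \<longrightarrow> set (snd (c ! i)) \<subseteq> H \<longrightarrow> stab Y (pt' i) \<subseteq> H)"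
      "\<forall>i<length c. \<forall>j<length c. orbit Y (pt' i) = orbit Y (pt' j) \<longrightarrow> i = j"
      "\<forall>p\<in>pts Y. \<exists>i<length c. p \<in> orbit Y (pt' i)"
    using cY unfolding has_code_def by blast
  obtain h where h: "h \<in> Hom PSh X Y" "\<And>i. i < length c \<Longrightarrow> app h (fst (c ! i)) (snd (pt i)) =
      snd (pt' i)"
    using map[OF X Y pt] pt'(1) by blast
  obtain k where k: "k \<in> Hom PSh Y X" "\<And>i. i < length c \<Longrightarrow> app k (fst (c ! i)) (snd (pt' i)) =
      snd (pt i)"
    using map[OF Y X pt'] pt(1) by blast
  have inv: "Comp PSh k h = Id PSh X"
    if X: "X \<in> Obj PSh" and h: "h \<in> Hom PSh X Y" and k: "k \<in> Hom PSh Y X"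
    and hk: "\<And>i. i < length c \<Longrightarrow> app k (fst (c ! i)) (app h (fst (c ! i)) (snd (pt i))) = snd (pt i)"
    and pt: "\<And>i. i < length c \<Longrightarrow> pt i \<in> pts X \<and> fst (pt i) = fst (c ! i)"
      "\<And>p. p \<in> pts X \<Longrightarrow> \<exists>i<length c. p \<in> orbit X (pt i)" for X Y h k pt
  proof (rule Hom_eq_on_cover[OF Comp_Hom[OF cat_PSh h k] Id_Hom[OF cat_PSh X],
      of "pt ` {..<length c}"])
    fix b assume "b \<in> pt ` {..<length c}"
    then obtain i where i: "i < length c" "b = pt i" by blast
    then have b: "fst b \<in> Obj G" "snd b \<in> FObj X (fst b)" using pt(1) ptsD by metis+
    show "app (Comp PSh k h) (fst b) (snd b) = app (Id PSh X) (fst b) (snd b)"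
      using app_Comp[OF h k b] app_Id[OF X b] hk[OF i(1)] pt(1)[OF i(1)] i(2) by simp
  next
    show "\<exists>b\<in>pt ` {..<length c}. p \<in> orbit X b" if "p \<in> pts X" for p
      using pt(2)[OF that] by auto
  qed (use pt(1) in auto)
  have "Comp PSh k h = Id PSh X"
    by (rule inv[OF X h(1) k(1)]) (use h(2) k(2) pt in auto)
  moreover have "Comp PSh h k = Id PSh Y"
    by (rule inv[OF Y k(1) h(1)]) (use h(2) k(2) pt' in auto)
  ultimately show ?thesis using that[OF h(1)] inverse_imp_bij[OF h(1) k(1)] by blast
qed

lemma has_code_exists:
  assumes X: "X \<in> Obj PSh" and fin: "finite (orbits X)"
    and fg: "\<And>p. p \<in> pts X \<Longrightarrow> fin_gen_subgroup (aut_group G (fst p)) (stab X p)"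
  shows "\<exists>c\<in>lists (Obj G \<times> lists (Arr G)). has_code X c"
proof -
  obtain B where B: "B \<subseteq> pts X" "\<And>p. p \<in> pts X \<Longrightarrow> \<exists>b\<in>B. p \<in> orbit X b"
    "\<And>b c. b \<in> B \<Longrightarrow> c \<in> B \<Longrightarrow> orbit X b = orbit X c \<Longrightarrow> b = c" and finB: "finite B"
    using transversal[OF X] fin by metis
  obtain bs where bs: "set bs = B" "distinct bs" using finite_distinct_list[OF finB] by blast
  have "\<exists>ms. set ms \<subseteq> stab X p \<and>
      (\<forall>H. subgroup H (aut_group G (fst p)) \<longrightarrow> set ms \<subseteq> H \<longrightarrow> stab X p \<subseteq> H)" if "p \<in> pts X" for p
    using fg[OF that] unfolding fin_gen_subgroup_def by (metis finite_list)
  then obtain gs where gs: "\<And>p. p \<in> pts X \<Longrightarrow> set (gs p) \<subseteq> stab X p \<and>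
      (\<forall>H. subgroup H (aut_group G (fst p)) \<longrightarrow> set (gs p) \<subseteq> H \<longrightarrow> stab X p \<subseteq> H)" by metis
  let ?c = "map (\<lambda>p. (fst p, gs p)) bs"
  have bp: "bs ! i \<in> pts X" if "i < length bs" for i using that bs(1) B(1) nth_mem by blast
  have "has_code X ?c"
    unfolding has_code_def
  proof (intro conjI X exI[of _ "\<lambda>i. bs ! i"])
    show "\<forall>i<length ?c. \<forall>j<length ?c. orbit X (bs ! i) = orbit X (bs ! j) \<longrightarrow> i = j"
      using B(3) bs nth_eq_iff_index_eq[OF bs(2)] by (metis length_map nth_mem)
    show "\<forall>p\<in>pts X. \<exists>i<length ?c. p \<in> orbit X (bs ! i)"
      using B(2) bs(1) by (metis in_set_conv_nth length_map)
  qed (use gs bp in auto)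
  moreover have "?c \<in> lists (Obj G \<times> lists (Arr G))"
  proof -
    have "gs p \<in> lists (Arr G)" if "p \<in> pts X" for p
      using gs[OF that] by (auto simp: stab_def Hom_iff)
    then show ?thesis using B(1) bs(1) ptsD(1) by fastforce
  qed
  ultimately show ?thesis by blast
qed

text \<open>Presheaves with finitely many orbits are controlled only up to isomorphism. One presheaf
  is chosen for each code, codes form a small-sized set, and the directed union of generated
  subpresheaves is rebuilt from the chosen ones.\<close>

lemma locally_finitely_presentable_PSh:
  assumes N: "\<And>a H. a \<in> Obj G \<Longrightarrow> subgroup H (aut_group G a) \<Longrightarrow> fin_gen_subgroup (aut_group G a) H"
  shows "locally_finitely_presentable small PSh"
proof -
  have fg: "fin_gen_subgroup (aut_group G (fst p)) (stab X p)" if "X \<in> Obj PSh" "p \<in> pts X" for X p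
    using N stab_subgroup[OF that] ptsD[OF that(2)] by blast
  let ?Cs = "{c \<in> lists (Obj G \<times> lists (Arr G)). \<exists>X. has_code X c}"
  define \<S> where "\<S> = (\<lambda>c. SOME X. has_code X c) ` ?Cs"
  have code: "has_code (SOME X. has_code X c) c" if "\<exists>X. has_code X c" for c
    using someI_ex[OF that] .
  have "small_sized small (lists (Obj G \<times> lists (Arr G)))"
    by (intro small_sized_lists small_sized_Sigma small_Obj small_Arr)
  then have S: "small_sized small \<S>"
    unfolding \<S>_def by (intro small_sized_image) (rule small_sized_subset, auto)
  have fp: "finitely_presentable small PSh X" if "X \<in> \<S>" for X
  proof -
    obtain c where "has_code X c" using \<open>X \<in> \<S>\<close> code unfolding \<S>_def by auto
    then have "X \<in> Obj PSh" "finite (orbits X)" using has_code_finite_orbits by blast+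
    then show ?thesis using finitely_presentableI fg by blast
  qed
  have "\<exists>(I :: 'u set) r D c. small I \<and> directed_poset I r \<and> (\<forall>i\<in>I. FObj D i \<in> \<S>) \<and>
      is_colimit (poset_category I r) PSh D X c" if X: "X \<in> Obj PSh" for X
  proof -
    have ex: "\<forall>P\<in>Fpow (pts X). \<exists>S m. S \<in> \<S> \<and> generated_by X P S m"
    proof
      fix P assume P: "P \<in> Fpow (pts X)"
      have P': "P \<subseteq> pts X" "finite P" using P by (auto simp: Fpow_def)
      obtain S m where gP: "generated_by X P S m" using generated_subpresheaf[OF X P'(1)] by blast
      note m = generated_byD[OF gP]
      have "image (lift m) ` orbits S \<subseteq> orbit X ` P"
      proof
        fix W assume "W \<in> image (lift m) ` orbits S"
        then obtain q where q: "q \<in> pts S" "W = orbit X (lift m q)"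
          using lift_orbit[OF m(1)] by (auto simp: orbits_def)
        then have "snd (lift m q) \<in> app m (fst q) ` FObj S (fst q)" using ptsD[OF q(1)]
            by (simp add: lift_def)
        then obtain p where p: "p \<in> P" "lift m q \<in> orbit X p"
          using m(3)[OF ptsD(1)[OF q(1)]] by (auto simp: lift_def)
        then show "W \<in> orbit X ` P" using orbit_eq[OF X _ p(2)] P'(1) q(2) by blast
      qed
      then have "finite (image (lift m) ` orbits S)" using P'(2) finite_surj by blast
      then have fin: "finite (orbits S)" using finite_imageD lift_orbits_inj[OF m(1,2)] by blast
      have S: "S \<in> Obj PSh" using PSh_HomD(1)[OF m(1)] .
      then obtain c where c: "c \<in> lists (Obj G \<times> lists (Arr G))" "has_code S c"
        using has_code_exists[OF S fin fg[OF S]] by blast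
      \<comment> \<open>The chosen presheaf with the code of \<open>S\<close> takes the place of
        \<open>S\<close>; composing \<open>m\<close> with the isomorphism leaves its image
        unchanged.\<close>
      define Z where "Z = (SOME X. has_code X c)"
      have Z: "Z \<in> \<S>" "has_code Z c" unfolding Z_def \<S>_def using c code[of c] by auto
      obtain h where h: "h \<in> Hom PSh Z S" "\<And>a. a \<in> Obj G \<Longrightarrow> bij_betw (app h a) (FObj Z a) (FObj S a)"
        by (rule has_code_iso[OF Z(2) c(2)]) blast
      have mh: "app (Comp PSh m h) a x = app m a (app h a x)" if "a \<in> Obj G" "x \<in> FObj Z a" for a x
        using app_Comp[OF h(1) m(1) that] .
      have "inj_on (app (Comp PSh m h) a) (FObj Z a)" if a: "a \<in> Obj G" for a
      proof -
        have "inj_on (app m a \<circ> app h a) (FObj Z a)"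
          using h(2)[OF a] m(2)[OF a] by (auto simp: bij_betw_def intro: comp_inj_on)
        then show ?thesis using mh[OF a] by (simp add: inj_on_def)
      qed
      moreover have "app (Comp PSh m h) a ` FObj Z a = {x. \<exists>p\<in>P. (a, x) \<in> orbit X p}"
          if a: "a \<in> Obj G" for a
      proof -
        have "app (Comp PSh m h) a ` FObj Z a = app m a ` app h a ` FObj Z a"
          unfolding image_image using mh[OF a] by (rule image_cong[OF HOL.refl])
        then show ?thesis using h(2)[OF a] m(3)[OF a] by (simp add: bij_betw_def)
      qed
      ultimately have "generated_by X P Z (Comp PSh m h)"
        unfolding generated_by_def using Comp_Hom[OF cat_PSh h(1) m(1)] by blast
      then show "\<exists>S m. S \<in> \<S> \<and> generated_by X P S m" using Z(1) by blast
    qed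
    from union_of_generated[OF X ex]
    show ?thesis by (elim exE conjE) (intro exI conjI ballI; blast)
  qed
  then show ?thesis
    unfolding locally_finitely_presentable_def
    using cat_PSh cocomplete_PSh S fp by (intro conjI exI[of _ \<S>] ballI)
qed

end

section \<open>Chains of subgroups\<close>

text \<open>If \<open>H\<close> is not finitely generated, every finite subset of \<open>H\<close>
  generates a subgroup missing some element of \<open>H\<close>. Adding such elements one at a time
  yields a strictly ascending sequence of subgroups.\<close>

lemma noetherian_group_fin_gen:
  assumes K: "group K" and noeth: "noetherian_group K" and H: "subgroup H K"
  shows "fin_gen_subgroup K H"
proof (rule ccontr)
  assume not: "\<not> fin_gen_subgroup K H"
  have "\<exists>g. g \<in> H \<and> g \<notin> generate K M" if M: "finite M" "M \<subseteq> H" for M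
  proof -
    have "\<not> (\<forall>H'. subgroup H' K \<longrightarrow> M \<subseteq> H' \<longrightarrow> H \<subseteq> H')"
      using not M unfolding fin_gen_subgroup_def by simp
    then obtain H' where H': "subgroup H' K" "M \<subseteq> H'" "\<not> H \<subseteq> H'" by blast
    show ?thesis using group.generate_subgroup_incl[OF K H'(2,1)] H'(3) by blast
  qed
  then obtain g where g: "\<And>M. finite M \<Longrightarrow> M \<subseteq> H \<Longrightarrow> g M \<in> H \<and> g M \<notin> generate K M" by metis
  define M where "M = rec_nat {} (\<lambda>_ N. insert (g N) N)"
  have Ms: "M (Suc n) = insert (g (M n)) (M n)" for n by (simp add: M_def)
  have M: "finite (M n) \<and> M n \<subseteq> H" for n
  proof (induction n)
    case 0
    show ?case by (simp add: M_def)
  next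
    case (Suc n)
    then show ?case using g[of "M n"] Ms by simp
  qed
  have Mc: "M n \<subseteq> carrier K" for n using M subgroup.subset[OF H] by blast
  have "subgroup (generate K (M n)) K \<and> generate K (M n) \<subset> generate K (M (Suc n))" for n
  proof
    show "subgroup (generate K (M n)) K" using group.generate_is_subgroup[OF K Mc] .
    have "generate K (M n) \<subseteq> generate K (M (Suc n))"
        by (rule group.mono_generate[OF K]) (simp add: Ms subset_insertI)
    moreover have "g (M n) \<in> generate K (M (Suc n))" by (rule generate.incl) (simp add: Ms)
    ultimately show "generate K (M n) \<subset> generate K (M (Suc n))" using g M by blast
  qed
  then have "\<exists>S :: nat \<Rightarrow> 'a set. \<forall>n. subgroup (S n) K \<and> S n \<subset> S (Suc n)"
    by (intro exI[of _ "\<lambda>n. generate K (M n)"] allI)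
  then show False using noeth[unfolded noetherian_group_def] by contradiction
qed

lemma ascending_mono:
  assumes "\<And>n. S n \<subset> S (Suc n)" and "m < n" shows "S m \<subset> (S n :: 'a set)"
  using lift_Suc_mono_less[of S, OF assms] .

lemma ascending_Union_subgroup:
  assumes K: "group K" and S: "\<And>n. subgroup (S n) K \<and> S n \<subset> S (Suc n)"
  shows "subgroup (\<Union>n. S n) K"
proof (rule group.subgroupI[OF K])
  show "(\<Union>n. S n) \<subseteq> carrier K" using S subgroup.subset by blast
  show "(\<Union>n. S n) \<noteq> {}" using subgroup.one_closed[of "S 0" K] S by blast
  show "inv\<^bsub>K\<^esub> g \<in> (\<Union>n. S n)" if "g \<in> (\<Union>n. S n)" for g
    using that S subgroup.m_inv_closed by fastforce
  show "g \<otimes>\<^bsub>K\<^esub> h \<in> (\<Union>n. S n)" if gh: "g \<in> (\<Union>n. S n)" "h \<in> (\<Union>n. S n)" for g h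
  proof -
    obtain m n where mn: "g \<in> S m" "h \<in> S n" using gh by blast
    have "S i \<subseteq> S (max m n)" if "i = m \<or> i = n" for i
      using lift_Suc_mono_le[of S i "max m n"] S that
        by (metis max.cobounded1 max.cobounded2 psubset_imp_subset)
    then show ?thesis using mn subgroup.m_closed[of "S (max m n)" K g h] S by blast
  qed
qed

lemma only_finite_chains_imp_noetherian:
  assumes "only_finite_subgroup_chains K"
  shows "noetherian_group K"
  unfolding noetherian_group_def
proof
  assume "\<exists>S :: nat \<Rightarrow> 'a set. \<forall>n. subgroup (S n) K \<and> S n \<subset> S (Suc n)"
  then obtain S :: "nat \<Rightarrow> 'a set" where S: "\<And>n. subgroup (S n) K" "\<And>n. S n \<subset> S (Suc n)" by blast
  have lt: "S m \<subset> S n" if "m < n" for m n using ascending_mono[of S, OF S(2) that] .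
  then have "inj S" by (metis injI linorder_neqE_nat psubset_eq)
  moreover have "subgroup_chain K (range S)"
    unfolding subgroup_chain_def subset_chain_def
    using S(1) lt by (auto) (metis linorder_neqE_nat psubset_eq subsetD)
  ultimately show False
    using assms infinite_UNIV_nat finite_imageD unfolding only_finite_subgroup_chains_def by blast
qed

lemma finite_longest_imp_only_finite_chains:
  "finite_longest_subgroup_chain K \<Longrightarrow> only_finite_subgroup_chains K"
  unfolding finite_longest_subgroup_chain_def only_finite_subgroup_chains_def by (elim exE) simp

text \<open>The members of the sequence form a chain and are therefore finitely many; the sequence
  is constant from any index at which the smallest member occurs.\<close>

lemma descending_subgroups_stabilize:
  assumes fin: "only_finite_subgroup_chains K" and S: "\<And>n. subgroup (S n) K" "\<And>n. S (Suc n) \<subseteq> S n"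
  shows "\<exists>N. \<forall>n\<ge>N. S n = S N"
proof -
  have le: "S n \<subseteq> S m" if "m \<le> n" for m n using lift_Suc_antimono_le[of S, OF S(2) that] .
  have "subgroup_chain K (range S)"
    unfolding subgroup_chain_def subset_chain_def
    using S(1) le by auto (metis nat_le_linear subsetD)
  then have "finite (range S)" using fin unfolding only_finite_subgroup_chains_def by blast
  then obtain N where "\<And>n. \<not> S n \<subset> S N"
    using finite_has_minimal[of "range S"]
      by (metis UNIV_not_empty image_is_empty image_iff psubset_eq rangeI)
  then show ?thesis using le by (metis psubsetI)
qed

text \<open>If some nonempty subfamily has no minimal member, descend in it forever. Otherwise the
  chain is well-ordered by inclusion, and stepping repeatedly to the least member of what remains
  above gives an ascending sequence.\<close>

lemma infinite_chain_sequence: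
  assumes inf: "infinite \<C>" and chain: "\<And>X Y. X \<in> \<C> \<Longrightarrow> Y \<in> \<C> \<Longrightarrow> X \<subseteq> Y \<or> Y \<subseteq> X"
  obtains (ascending) S :: "nat \<Rightarrow> 'a set" where "\<And>n. S n \<in> \<C>" "\<And>n. S n \<subset> S (Suc n)"
    | (descending) S :: "nat \<Rightarrow> 'a set" where "\<And>n. S n \<in> \<C>" "\<And>n. S (Suc n) \<subset> S n"
proof -
  show ?thesis
  proof (cases "\<exists>A\<subseteq>\<C>. A \<noteq> {} \<and> (\<forall>x\<in>A. \<exists>y\<in>A. y \<subset> x)")
    case True
    then obtain A where A: "A \<subseteq> \<C>" "A \<noteq> {}" "\<And>x. x \<in> A \<Longrightarrow> \<exists>y\<in>A. y \<subset> x" by blast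
    obtain S where "\<And>n :: nat. S n \<in> A" "\<And>n. S (Suc n) \<subset> S n"
      using dependent_nat_choice[of "\<lambda>_ x. x \<in> A" "\<lambda>_ x y. y \<subset> x"] A(2,3) by (metis ex_in_conv)
    then show ?thesis using descending A(1) by blast
  next
    case False
    have least: "\<exists>x\<in>A. \<forall>y\<in>A. y \<noteq> x \<longrightarrow> x \<subset> y" if A: "A \<subseteq> \<C>" "A \<noteq> {}" for A
    proof -
      have "\<not> (\<forall>x\<in>A. \<exists>y\<in>A. y \<subset> x)" using False A by metis
      then obtain x where x: "x \<in> A" "\<And>y. y \<in> A \<Longrightarrow> \<not> y \<subset> x" by metis
      then have "y \<noteq> x \<longrightarrow> x \<subset> y" if "y \<in> A" for y
        using that chain[of x y] A(1) by (metis psubsetI subsetD)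
      then show ?thesis using x(1) by metis
    qed
    let ?up = "\<lambda>x. {y \<in> \<C>. x \<subset> y}"
    \<comment> \<open>The least member of an infinite subfamily has all other members above it.
      Keeping this remainder infinite is the invariant of the ascending construction.\<close>
    have step: "\<exists>x\<in>A. infinite (?up x)" if A: "A \<subseteq> \<C>" "infinite A" for A
    proof -
      have "A \<noteq> {}" using A(2) by auto
      then obtain x where x: "x \<in> A" "\<forall>y\<in>A. y \<noteq> x \<longrightarrow> x \<subset> y" using least[OF A(1)] by blast
      then have "A - {x} \<subseteq> ?up x" using A(1) by blast
      then have "infinite (?up x)" using A(2) infinite_super infinite_remove by metis
      then show ?thesis using x(1) by blast
    qed
    have "\<exists>x. x \<in> \<C> \<and> infinite (?up x)" using step[of \<C>] inf by blast
    moreover have "\<exists>y. (y \<in> \<C> \<and> infinite (?up y)) \<and> x \<subset> y" if "x \<in> \<C> \<and> infinite (?up x)" for x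
      using step[of "?up x"] that by blast
    ultimately have "\<exists>S. \<forall>n :: nat. (S n \<in> \<C> \<and> infinite (?up (S n))) \<and> S n \<subset> S (Suc n)"
      by (rule dependent_nat_choice[of "\<lambda>_ x. x \<in> \<C> \<and> infinite (?up x)" "\<lambda>_ x y. x \<subset> y"])
    then obtain S where S: "\<forall>n :: nat. (S n \<in> \<C> \<and> infinite (?up (S n))) \<and> S n \<subset> S (Suc n)" ..
    show ?thesis by (rule ascending[of S]) (use S in simp_all)
  qed
qed

section \<open>Necessity of the chain conditions\<close>

context groupoid_presheaves
begin

text \<open>Describes \<open>G(-, a)/H\<close> with its generator \<open>w\<close> by properties
  that determine it up to isomorphism: one orbit, and stabilizer \<open>H\<close> at
  \<open>w\<close>.\<close>

definition coset_of where
  "coset_of a H Q w \<longleftrightarrow> Q \<in> Obj PSh \<and> w \<in> FObj Q a \<and> stab Q (a, w) = H \<and> pts Q = orbit Q (a, w)"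

lemma coset_ofD:
  assumes "coset_of a H Q w"
  shows "Q \<in> Obj PSh" "w \<in> FObj Q a" "stab Q (a, w) = H" "pts Q = orbit Q (a, w)"
  using assms by (auto simp: coset_of_def)

lemma coset_of_exists: "a \<in> Obj G \<Longrightarrow> subgroup H (aut_group G a) \<Longrightarrow> \<exists>Q w. coset_of a H Q w"
  unfolding coset_of_def by (rule coset_presheaf) blast+

lemma coset_of_elem:
  assumes Q: "coset_of a H Q w" and b: "b \<in> Obj G" and x: "x \<in> FObj Q b"
  obtains f where "f \<in> Hom G b a" "x = act Q f w"
proof -
  have "(b, x) \<in> pts Q" using b x by (simp add: pts_iff)
  then have "(b, x) \<in> orbit Q (a, w)" using coset_ofD(4)[OF Q] by simp
  then show ?thesis using that by (auto simp: orbit_iff)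
qed

lemma coset_of_hom:
  assumes Q: "coset_of a H Q w" and R: "coset_of a K R v" and HK: "H \<subseteq> K" and a: "a \<in> Obj G"
  shows "\<exists>h\<in>Hom PSh Q R. app h a w = v"
  using coset_map[OF coset_ofD(1,2,4)[OF Q] a coset_ofD(1,2)[OF R]] coset_ofD(3)[OF Q]
    coset_ofD(3)[OF R] HK
  by metis

lemma coset_of_hom_surj:
  assumes h: "h \<in> Hom PSh Q R" and hw: "app h a w = v" and w: "w \<in> FObj Q a"
    and R: "coset_of a K R v" and b: "b \<in> Obj G"
  shows "app h b ` FObj Q b = FObj R b"
proof
  show "app h b ` FObj Q b \<subseteq> FObj R b" using PSh_HomD(3)[OF h b] by blast
  show "FObj R b \<subseteq> app h b ` FObj Q b"
  proof
    fix y assume "y \<in> FObj R b"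
    then obtain f where f: "f \<in> Hom G b a" "y = act R f v" by (rule coset_of_elem[OF R b])
    then have "y = app h b (act Q f w)" using PSh_HomD(4)[OF h f(1) w] hw by simp
    then show "y \<in> app h b ` FObj Q b" using act_mem[OF PSh_HomD(1)[OF h] f(1) w] by blast
  qed
qed

text \<open>Converse to \<open>coset_of_hom\<close>: maps of coset presheaves that respect
  generators correspond to inclusions of subgroups.\<close>

lemma coset_of_hom_subset:
  assumes h: "h \<in> Hom PSh Q R" and hw: "app h a w = v" and Q: "coset_of a H Q w"
    and R: "coset_of a K R v" and a: "a \<in> Obj G"
  shows "H \<subseteq> K"
proof -
  have "(a, w) \<in> pts Q" using coset_ofD(2)[OF Q] a by (simp add: pts_iff)
  from stab_lift[OF h this] show ?thesis
    using coset_ofD(3)[OF Q] coset_ofD(3)[OF R] hw by (simp add: lift_def)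
qed

lemma coset_of_finite_orbits:
  assumes Q: "coset_of a H Q w" and a: "a \<in> Obj G"
  shows "finite (orbits Q)"
proof -
  have "(a, w) \<in> pts Q" using coset_ofD(2)[OF Q] a by (simp add: pts_iff)
  then have "orbits Q \<subseteq> {orbit Q (a, w)}"
    using orbit_eq[OF coset_ofD(1)[OF Q]] coset_ofD(4)[OF Q] unfolding orbits_def by blast
  then show ?thesis using finite_subset by blast
qed

text \<open>Every stabilizer is conjugate to the trivial one, hence itself trivial and generated by
  the empty set.\<close>

lemma representable_finitely_presentable:
  assumes P: "coset_of a {Id G a} P u" and a: "a \<in> Obj G"
  shows "finitely_presentable small PSh P"
proof (rule finitely_presentableI[OF coset_ofD(1)[OF P] coset_of_finite_orbits[OF P a]])
  fix p assume p: "p \<in> pts P"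
  obtain f where f: "f \<in> Hom G (fst p) a" "snd p = act P f u"
    using coset_of_elem[OF P ptsD(1)[OF p] ptsD(2)[OF p]] by blast
  have "g = Id G (fst p)" if g: "g \<in> stab P p" for g
  proof -
    have gH: "g \<in> Hom G (fst p) (fst p)" using g by (simp add: stab_def)
    have "p = (fst p, act P f u)" using f(2) by (simp add: prod_eq_iff)
    then have "Comp G f (Comp G g (ginv f)) = Id G a"
      using stab_conj[OF coset_ofD(1)[OF P] f(1) coset_ofD(2)[OF P] gH] g coset_ofD(3)[OF P] by simp
    moreover have "Comp G f (Comp G g (ginv f)) = Comp G (Comp G f g) (ginv f)"
      using G_assoc[OF ginv(1)[OF f(1)] gH f(1)] .
    ultimately have "Comp G (Comp G (Comp G f g) (ginv f)) f = f" using G_Id_left[OF f(1)] by simp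
    then have fg: "Comp G f g = f"
      using G_assoc[OF f(1) ginv(1)[OF f(1)] G_Comp[OF gH f(1)]] ginv(2)[OF f(1)]
        G_Id_right[OF G_Comp[OF gH f(1)]]
      by simp
    have "Comp G (ginv f) (Comp G f g) = g"
      using G_assoc[OF gH f(1) ginv(1)[OF f(1)]] ginv(2)[OF f(1)] G_Id_left[OF gH] by simp
    then show ?thesis using fg ginv(2)[OF f(1)] by simp
  qed
  then have "stab P p \<subseteq> H'" if "subgroup H' (aut_group G (fst p))" for H'
    using aut_subgroupD(2)[OF that ptsD(1)[OF p]] by blast
  then show "fin_gen_subgroup (aut_group G (fst p)) (stab P p)"
    unfolding fin_gen_subgroup_def by (intro exI[of _ "{}"]) simp
qed

text \<open>
  The coset presheaf of an ascending union of subgroups is the colimit of the coset presheaves of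
  these subgroups, and its identity would have to factor through one of them.
\<close>

lemma coset_of_ascending_union_not_fp:
  fixes S :: "nat \<Rightarrow> 'm set"
  assumes a: "a \<in> Obj G" and S: "\<And>n. subgroup (S n) (aut_group G a) \<and> S n \<subset> S (Suc n)"
    and Q: "coset_of a (\<Union>n. S n) Q w"
  shows "\<not> finitely_presentable small PSh Q"
proof
  assume fp: "finitely_presentable small PSh Q"
  have Sle: "S m \<subseteq> S n" if "m \<le> n" for m n
    using lift_Suc_mono_le[of S, OF _ that] S by blast
  have "\<exists>P u. coset_of a (S n) P u" for n using coset_of_exists[OF a conjunct1[OF S]] .
  then obtain P u where P: "\<And>n. coset_of a (S n) (P n) (u n)" by metis
  have PO: "P n \<in> Obj PSh" and un: "u n \<in> FObj (P n) a" and Pst: "stab (P n) (a, u n) = S n"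
    and Pp: "pts (P n) = orbit (P n) (a, u n)" for n
    using coset_ofD[OF P] by auto
  have "\<exists>h\<in>Hom PSh (P m) (P n). app h a (u m) = u n" if "m \<le> n" for m n
    using coset_of_hom[OF P P Sle[OF that] a] .
  then obtain d where d: "\<And>m n. m \<le> n \<Longrightarrow> d m n \<in> Hom PSh (P m) (P n) \<and> app (d m n) a (u m) = u n"
    by metis
  have "\<exists>h\<in>Hom PSh (P n) Q. app h a (u n) = w" for n
    using coset_of_hom[OF P Q _ a] by blast
  then obtain c where c: "\<And>n. c n \<in> Hom PSh (P n) Q" "\<And>n. app (c n) a (u n) = w" by metis
  have eqI: "h = k" if "h \<in> Hom PSh (P n) X" "k \<in> Hom PSh (P n) X" "app h a (u n) = app k a (u n)"
      for h k n X
    by (rule coset_Hom_eq[OF that(1,2) Pp a un that(3)])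
  obtain I :: "'u set" and r D c' where res: "small I" "directed_poset I r"
    "is_colimit (poset_category I r) PSh D Q c'"
    "\<And>i. i \<in> I \<Longrightarrow> \<exists>n\<in>UNIV. FObj D i = P n \<and> c' i = c n"
  proof (rule directed_diagram[of "UNIV :: nat set" "(\<le>)" P d c Q])
    show "small_sized small (UNIV :: nat set)" by (rule small_sized_nat)
    show "\<exists>k\<in>UNIV. m \<le> k \<and> n \<le> k" for m n :: nat by (rule bexI[of _ "max m n"]) auto
    show "d n n = Id PSh (P n)" for n
      by (rule eqI[OF _ Id_Hom[OF cat_PSh PO]]) (use d[of n n] app_Id[OF PO a un] in auto)
    show "d m k = Comp PSh (d n k) (d m n)" if "m \<le> n" "n \<le> k" for m n k
    proof (rule eqI)
      note dd = d[OF that(1)] d[OF that(2)] d[OF order_trans[OF that]]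
      show "d m k \<in> Hom PSh (P m) (P k)" using dd by blast
      show "Comp PSh (d n k) (d m n) \<in> Hom PSh (P m) (P k)" using dd Comp_Hom[OF cat_PSh] by blast
      show "app (d m k) a (u m) = app (Comp PSh (d n k) (d m n)) a (u m)"
        using dd app_Comp[of "d m n" "P m" "P n" "d n k" "P k" a "u m"] a un by simp
    qed
    show "Comp PSh (c n) (d m n) = c m" if "m \<le> n" for m n
    proof (rule eqI)
      show "Comp PSh (c n) (d m n) \<in> Hom PSh (P m) Q" using d[OF that] c Comp_Hom[OF cat_PSh]
          by blast
      show "app (Comp PSh (c n) (d m n)) a (u m) = app (c m) a (u m)"
        using d[OF that] app_Comp[of "d m n" "P m" "P n" "c n" Q a "u m"] a un c by simp
    qed (rule c)
    show "\<exists>n\<in>UNIV. y \<in> app (c n) b ` FObj (P n) b" if b: "b \<in> Obj G" and y: "y \<in> FObj Q b" for b y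
      using coset_of_hom_surj[OF c(1) c(2) un Q b] y by blast
    show "\<exists>t\<in>UNIV. n \<le> t \<and> app (d n t) b x = app (d n t) b y"
      if b: "b \<in> Obj G" and x: "x \<in> FObj (P n) b" and y: "y \<in> FObj (P n) b"
        and e: "app (c n) b x = app (c n) b y" for b n x y
    proof -
      obtain f where f: "f \<in> Hom G b a" "x = act (P n) f (u n)" by (rule coset_of_elem[OF P b x])
      obtain g where g: "g \<in> Hom G b a" "y = act (P n) g (u n)" by (rule coset_of_elem[OF P b y])
      note QO = coset_ofD(1)[OF Q] and wQ = coset_ofD(2)[OF Q]
      have gf: "Comp G g (ginv f) \<in> Hom G a a" using G_Comp[OF ginv(1)[OF f(1)] g(1)] .
      have "act Q f w = act Q g w"
        using e f g PSh_HomD(4)[OF c(1) f(1) un] PSh_HomD(4)[OF c(1) g(1) un] c(2) by simp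
      then have "act Q (Comp G g (ginv f)) w = w"
        using act_Comp[OF QO ginv(1)[OF f(1)] g(1) wQ] act_ginv(1)[OF QO f(1) wQ] by simp
      then have "Comp G g (ginv f) \<in> stab Q (a, w)" using gf by (simp add: stab_def)
      then obtain k where "Comp G g (ginv f) \<in> S k" using coset_ofD(3)[OF Q] by blast
      \<comment> \<open>Two arrows with the same class modulo the union differ by an element of some
        \<open>S k\<close>, which identifies them at stage \<open>k\<close>. The maximum with
        \<open>n\<close> makes this stage also later than the given one.\<close>
      then have k: "Comp G g (ginv f) \<in> S (max n k)" using Sle[of k "max n k"] by auto
      let ?t = "max n k"
      have "Comp G g (ginv f) \<in> stab (P ?t) (a, u ?t)" using k Pst[of ?t] by simp
      then have "act (P ?t) (ginv f) (act (P ?t) g (u ?t)) = u ?t"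
        using act_Comp[OF PO ginv(1)[OF f(1)] g(1) un] by (auto simp: stab_def)
      then have "act (P ?t) g (u ?t) = act (P ?t) f (u ?t)"
        using act_ginv(2)[OF PO f(1) act_mem[OF PO g(1) un], of ?t] by simp
      moreover have "app (d n ?t) b (act (P n) h (u n)) = act (P ?t) h (u ?t)" if "h \<in> Hom G b a"
          for h
        using PSh_HomD(4)[of "d n ?t" "P n" "P ?t" h b a "u n"] d[of n ?t] that un by simp
      ultimately have "app (d n ?t) b x = app (d n ?t) b y" using f g by simp
      then show ?thesis by (intro bexI[of _ ?t]) auto
    qed
  qed (use PO d c in auto)
  have "preserves_colimits (poset_category I r) PSh (set_category (\<lambda>_. True)) (hom_functor PSh Q) D"
    using fp res(1,2) is_colimitD(1)[OF res(3)] unfolding finitely_presentable_def by simp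
  then obtain i q where i: "i \<in> Obj (poset_category I r)" and q: "q \<in> Hom PSh Q (FObj D i)"
    and e: "Comp PSh (c' i) q = Id PSh Q"
    by (rule preserves_colimits_factor[OF cat_PSh _ res(3) Id_Hom[OF cat_PSh coset_ofD(1)[OF Q]]])
      blast
  obtain n where n: "FObj D i = P n" "c' i = c n" using res(4) i by auto
  note q = q[unfolded n(1)] and wQ = coset_ofD(2)[OF Q]
  let ?U = "\<Union>n. S n"
  have U: "subgroup ?U (aut_group G a)"
      by (rule ascending_Union_subgroup[of _ S, OF group_aut[OF a] S])
  note UD = aut_subgroupD[OF U a]
  \<comment> \<open>The section \<open>q\<close> need not send \<open>w\<close> to the generator
    \<open>u n\<close>, but only to a translate of it by an automorphism \<open>f\<close>. Mapping
    back to \<open>Q\<close> shows that \<open>f\<close> belongs to the union.\<close>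
  obtain f where f: "f \<in> Hom G a a" "app q a w = act (P n) f (u n)"
    by (rule coset_of_elem[OF P a PSh_HomD(3)[OF q a wQ]])
  have "app (c n) a (app q a w) = w"
    using app_Comp[OF q c(1) a wQ] e n(2) app_Id[OF coset_ofD(1)[OF Q] a wQ] by simp
  then have "act Q f w = w" using f PSh_HomD(4)[OF c(1) f(1) un] c(2) by simp
  then have fU: "f \<in> ?U" using f(1) coset_ofD(3)[OF Q] by (auto simp: stab_def)
  have "?U \<subseteq> S n"
  proof
    \<comment> \<open>The stabilizer of the translate is a conjugate of \<open>S n\<close> by
      \<open>f\<close>. It is tested on the conjugate of \<open>h\<close> by \<open>f\<close>, again
      a member of the union, so that undoing the conjugation returns \<open>h\<close>.\<close>
    fix h assume h: "h \<in> ?U"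
    then have hH: "h \<in> Hom G a a" using UD(1) by blast
    let ?g = "Comp G (ginv f) (Comp G h f)"
    have hf: "Comp G h f \<in> Hom G a a" using G_Comp[OF f(1) hH] .
    have gH: "?g \<in> Hom G a a" using G_Comp[OF hf ginv(1)[OF f(1)]] .
    have "?g \<in> ?U" by (intro UD(3,4) fU h)
    then have "?g \<in> stab (P n) (a, act (P n) f (u n))"
      using stab_lift[OF q, of "(a, w)"] coset_ofD(3)[OF Q] f(2) wQ a
        by (auto simp: lift_def pts_iff)
    then have "Comp G f (Comp G ?g (ginv f)) \<in> S n"
      using stab_conj[OF PO f(1) un gH] Pst by simp
    moreover have "Comp G f (Comp G ?g (ginv f)) = h"
    proof -
      have "Comp G f (Comp G ?g (ginv f)) = Comp G (Comp G f ?g) (ginv f)"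
        using G_assoc[OF ginv(1)[OF f(1)] gH f(1)] .
      also have "Comp G f ?g = Comp G h f"
        using G_assoc[OF hf ginv(1)[OF f(1)] f(1)] ginv(3)[OF f(1)] G_Id_left[OF hf] by simp
      also have "Comp G (Comp G h f) (ginv f) = h"
        using G_assoc[OF ginv(1)[OF f(1)] f(1) hH] ginv(3)[OF f(1)] G_Id_right[OF hH] by simp
      finally show ?thesis .
    qed
    ultimately show "h \<in> S n" by simp
  qed
  then show False using S[of n] by blast
qed

lemma fg_fp_imp_noetherian:
  assumes fgfp: "\<And>F. finitely_generated small PSh F \<Longrightarrow> finitely_presentable small PSh F"
      and a: "a \<in> Obj G"
  shows "noetherian_group (aut_group G a)"
  unfolding noetherian_group_def
proof
  assume "\<exists>S :: nat \<Rightarrow> 'm set. \<forall>n. subgroup (S n) (aut_group G a) \<and> S n \<subset> S (Suc n)"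
  then obtain S :: "nat \<Rightarrow> 'm set" where S: "\<And>n. subgroup (S n) (aut_group G a) \<and> S n \<subset> S (Suc n)"
      by blast
  obtain Q w where Q: "coset_of a (\<Union>n. S n) Q w"
    using coset_of_exists[OF a ascending_Union_subgroup[of _ S, OF group_aut[OF a] S]] by blast
  have "finitely_presentable small PSh Q"
    using fgfp finite_orbits_imp_finitely_generated[OF coset_ofD(1)[OF Q] coset_of_finite_orbits[OF
      Q a]] .
  then show False using coset_of_ascending_union_not_fp[OF a S Q] by blast
qed

section \<open>Coset presheaves as quotients of representables\<close>

lemma trivial_subgroup: "a \<in> Obj G \<Longrightarrow> subgroup {Id G a} (aut_group G a)"
  using group.triv_subgroup[OF group_aut] by (simp add: aut_group_def)

lemma coset_of_quotient:
  assumes P: "coset_of a {Id G a} P u" and Q: "coset_of a H Q w" and a: "a \<in> Obj G"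
    and H: "subgroup H (aut_group G a)"
  shows "\<exists>e\<in>Hom PSh P Q. app e a u = w \<and> strong_epic PSh e"
proof -
  have "{Id G a} \<subseteq> H" using aut_subgroupD(2)[OF H a] by simp
  then obtain e where e: "e \<in> Hom PSh P Q" "app e a u = w" using coset_of_hom[OF P Q _ a] by blast
  have "strong_epic PSh e"
    by (rule strong_epicI[OF e(1)]) (rule coset_of_hom_surj[OF e coset_ofD(2)[OF P] Q])
  then show ?thesis using e by blast
qed

lemma dcc_categoryD:
  assumes dcc: "dcc_category small C" and A: "finitely_presentable small C A"
  shows "\<And>e. strong_epic C e \<Longrightarrow> Dom C e = A \<Longrightarrow> finitely_presentable small C (Cod C e)"
    and "\<And>e. \<forall>n. strong_epic C (e n) \<and> Dom C (e n) = A \<Longrightarrow> \<not> strictly_descending (quot_le C) e"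
proof -
  note D = spec[OF conjunct2[OF dcc[unfolded dcc_category_def]], of A, THEN mp, OF A]
  note D = conjunct2[OF conjunct2[OF D]]
  show "finitely_presentable small C (Cod C e)" if "strong_epic C e" "Dom C e = A" for e
    using spec[OF conjunct1[OF D], of e] that by blast
  show "\<not> strictly_descending (quot_le C) e" if "\<forall>n. strong_epic C (e n) \<and> Dom C (e n) = A" for e
    using conjunct2[OF D] that by blast
qed

text \<open>An infinite chain of subgroups contains a strictly monotone sequence. An ascending one
  produces a quotient of the representable that is not finitely presentable, a descending one a
  strictly descending chain of quotients.\<close>

lemma dcc_imp_only_finite_chains:
  assumes dcc: "dcc_category small PSh" and a: "a \<in> Obj G"
  shows "only_finite_subgroup_chains (aut_group G a)"
  unfolding only_finite_subgroup_chains_def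
proof (intro allI impI, rule ccontr)
  fix \<C> assume "subgroup_chain (aut_group G a) \<C>" and inf: "infinite \<C>"
  then have sub: "\<And>H. H \<in> \<C> \<Longrightarrow> subgroup H (aut_group G a)"
    and chain: "\<And>X Y. X \<in> \<C> \<Longrightarrow> Y \<in> \<C> \<Longrightarrow> X \<subseteq> Y \<or> Y \<subseteq> X"
    unfolding subgroup_chain_def subset_chain_def by auto
  obtain P u where P: "coset_of a {Id G a} P u" using coset_of_exists[OF a trivial_subgroup[OF a]]
      by blast
  have fpP: "finitely_presentable small PSh P" by (rule representable_finitely_presentable[OF P a])
  note quot = dcc_categoryD(1)[OF dcc fpP] and nodesc = dcc_categoryD(2)[OF dcc fpP]
  show False
  proof (rule infinite_chain_sequence[OF inf chain])
    fix S :: "nat \<Rightarrow> 'm set" assume SC: "\<And>n. S n \<in> \<C>" and asc: "\<And>n. S n \<subset> S (Suc n)"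
    have S: "subgroup (S n) (aut_group G a) \<and> S n \<subset> S (Suc n)" for n using sub SC asc by blast
    have U: "subgroup (\<Union>n. S n) (aut_group G a)"
        by (rule ascending_Union_subgroup[of _ S, OF group_aut[OF a] S])
    obtain Q w where Q: "coset_of a (\<Union>n. S n) Q w" using coset_of_exists[OF a U] by blast
    obtain e where e: "e \<in> Hom PSh P Q" "strong_epic PSh e" using coset_of_quotient[OF P Q a U]
        by blast
    have "finitely_presentable small PSh Q" using quot[OF e(2)] e(1) by (simp add: Hom_iff)
    then show False using coset_of_ascending_union_not_fp[OF a S Q] by blast
  next
    fix S :: "nat \<Rightarrow> 'm set" assume SC: "\<And>n. S n \<in> \<C>" and desc: "\<And>n. S (Suc n) \<subset> S n"
    obtain Q w where Q: "\<And>n. coset_of a (S n) (Q n) (w n)" using coset_of_exists[OF a sub[OF SC]]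
        by metis
    have "\<exists>e. e \<in> Hom PSh P (Q n) \<and> app e a u = w n \<and> strong_epic PSh e" for n
      using coset_of_quotient[OF P Q a sub[OF SC]] by blast
    then obtain e where e: "\<And>n. e n \<in> Hom PSh P (Q n) \<and> app (e n) a u = w n \<and> strong_epic PSh (e n)"
        by metis
    have eH: "e n \<in> Hom PSh P (Q n)" and eu: "app (e n) a u = w n" for n using e by auto
    have De: "Dom PSh (e n) = P" "Cod PSh (e n) = Q n" for n using eH by (auto simp: Hom_iff)
    note uP = coset_ofD(2)[OF P]
    \<comment> \<open>Larger subgroups give larger quotients for \<open>quot_le\<close>, so a
      descending sequence of subgroups is also descending as a sequence of quotients.\<close>
    have "quot_le PSh (e (Suc n)) (e n)" for n
    proof -
      obtain h where h: "h \<in> Hom PSh (Q (Suc n)) (Q n)" "app h a (w (Suc n)) = w n"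
        using coset_of_hom[OF Q Q _ a] desc by blast
      have "e n = Comp PSh h (e (Suc n))"
        by (rule coset_Hom_eq[OF eH Comp_Hom[OF cat_PSh eH h(1)] coset_ofD(4)[OF P] a uP])
           (use app_Comp[OF eH h(1) a uP] eu h(2) in simp)
      then show ?thesis unfolding quot_le_def De using h(1) by blast
    qed
    moreover have "\<not> quot_le PSh (e n) (e (Suc n))" for n
    proof
      assume "quot_le PSh (e n) (e (Suc n))"
      then obtain h where h: "h \<in> Hom PSh (Q n) (Q (Suc n))" "e (Suc n) = Comp PSh h (e n)"
        unfolding quot_le_def De by blast
      have "app h a (w n) = w (Suc n)" using app_Comp[OF eH h(1) a uP] eu h(2) by metis
      then have "S n \<subseteq> S (Suc n)" using coset_of_hom_subset[OF h(1) _ Q Q a] by blast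
      then show False using desc by blast
    qed
    ultimately have "strictly_descending (quot_le PSh) e" unfolding strictly_descending_def by blast
    moreover have "\<forall>n. strong_epic PSh (e n) \<and> Dom PSh (e n) = P" using e De by simp
    ultimately show False using nodesc by blast
  qed
qed

text \<open>The grade of \<open>G(-, a)/H\<close> strictly decreases as \<open>H\<close> grows and
  never exceeds the grade of \<open>G(-, a)\<close>, so along a chain of subgroups it takes distinct
  values in a bounded range.\<close>

lemma graduated_imp_finite_longest:
  assumes grad: "graduated small PSh" and a: "a \<in> Obj G"
  shows "finite_longest_subgroup_chain (aut_group G a)"
proof -
  obtain P u where P: "coset_of a {Id G a} P u" using coset_of_exists[OF a trivial_subgroup[OF a]]
      by blast
  have fpP: "finitely_presentable small PSh P" by (rule representable_finitely_presentable[OF P a])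
  obtain grade :: "_ \<Rightarrow> nat" where grade: "\<And>X e. finitely_presentable small PSh X \<Longrightarrow>
      strong_epic PSh e \<Longrightarrow> Dom PSh e = X \<Longrightarrow>
      finitely_presentable small PSh (Cod PSh e) \<and> grade (Cod PSh e) \<le> grade X \<and>
        (\<not> iso_arr PSh e \<longrightarrow> grade (Cod PSh e) < grade X)"
    using grad unfolding graduated_def by metis
  have "\<forall>H. \<exists>Q w. subgroup H (aut_group G a) \<longrightarrow> coset_of a H Q w" using coset_of_exists[OF a]
      by blast
  then obtain Q w where Q: "\<And>H. subgroup H (aut_group G a) \<Longrightarrow> coset_of a H (Q H) (w H)" by metis
  have Qfp: "finitely_presentable small PSh (Q H) \<and> grade (Q H) \<le> grade P"
      if H: "subgroup H (aut_group G a)" for H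
  proof -
    obtain e where e: "e \<in> Hom PSh P (Q H)" "strong_epic PSh e"
        using coset_of_quotient[OF P Q[OF H] a H] by blast
    then show ?thesis using grade[OF fpP e(2)] by (simp add: Hom_iff)
  qed
  have lt: "grade (Q K) < grade (Q H)"
    if H: "subgroup H (aut_group G a)" and K: "subgroup K (aut_group G a)" and HK: "H \<subset> K" for H K
  proof -
    obtain e where e: "e \<in> Hom PSh (Q H) (Q K)" "app e a (w H) = w K"
      using coset_of_hom[OF Q[OF H] Q[OF K] _ a] HK by blast
    have se: "strong_epic PSh e"
      by (rule strong_epicI[OF e(1)]) (rule coset_of_hom_surj[OF e coset_ofD(2)[OF Q[OF H]] Q[OF
        K]])
    have "\<not> iso_arr PSh e"
    proof
      assume "iso_arr PSh e"
      then have "inj_on (app e a) (FObj (Q H) a)" using iso_arr_iff[OF e(1)] a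
          by (auto simp: bij_betw_def)
      then have "stab (Q K) (lift e (a, w H)) = stab (Q H) (a, w H)"
        using stab_lift_inj[OF e(1), of "(a, w H)"] coset_ofD(2)[OF Q[OF H]] a
          by (simp add: pts_iff)
      then have "K = H" using coset_ofD(3)[OF Q[OF H]] coset_ofD(3)[OF Q[OF K]] e(2)
          by (simp add: lift_def)
      then show False using HK by blast
    qed
    moreover have "Dom PSh e = Q H" "Cod PSh e = Q K" using e(1) by (simp_all add: Hom_iff)
    ultimately show ?thesis using grade[OF conjunct1[OF Qfp[OF H]] se] by simp
  qed
  \<comment> \<open>The grades lie between 0 and \<open>grade P\<close> inclusive, which accounts
    for the successor.\<close>
  have "finite \<C> \<and> card \<C> \<le> Suc (grade P)" if "subgroup_chain (aut_group G a) \<C>" for \<C>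
  proof -
    have sub: "\<And>H. H \<in> \<C> \<Longrightarrow> subgroup H (aut_group G a)"
      and chain: "\<And>X Y. X \<in> \<C> \<Longrightarrow> Y \<in> \<C> \<Longrightarrow> X \<subseteq> Y \<or> Y \<subseteq> X"
      using that unfolding subgroup_chain_def subset_chain_def by auto
    have inj: "inj_on (\<lambda>H. grade (Q H)) \<C>"
    proof (rule inj_onI)
      fix H K assume "H \<in> \<C>" "K \<in> \<C>" "grade (Q H) = grade (Q K)"
      then show "H = K" using lt[of H K] lt[of K H] sub chain[of H K]
          by (metis less_irrefl psubsetI)
    qed
    have im: "(\<lambda>H. grade (Q H)) ` \<C> \<subseteq> {..grade P}" using Qfp sub by auto
    have "finite \<C>" using inj_on_finite[OF inj im] by simp
    moreover have "card \<C> \<le> Suc (grade P)" using card_inj_on_le[OF inj im] by simp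
    ultimately show ?thesis by blast
  qed
  then show ?thesis unfolding finite_longest_subgroup_chain_def by blast
qed

end

section \<open>Heights of subgroups\<close>

definition chains_above where
  "chains_above K H = {\<C>. subgroup_chain K \<C> \<and> (\<forall>L\<in>\<C>. H \<subseteq> L)}"

text \<open>The members of a chain are counted, not its strict steps. So even the whole group has
  height 1, and every orbit will contribute a positive amount to the grade. The maximum is
  meaningful when chain lengths are bounded; the empty chain then ensures that the set of lengths is
  not empty.\<close>

definition height :: "'a monoid \<Rightarrow> 'a set \<Rightarrow> nat" where
  "height K H = Max (card ` chains_above K H)"

lemma chains_above_finite:
  assumes "finite_longest_subgroup_chain K"
  shows "finite (card ` chains_above K H)" "\<And>\<C>. \<C> \<in> chains_above K H \<Longrightarrow> finite \<C>"
proof -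
  obtain n where n: "\<forall>\<C>. subgroup_chain K \<C> \<longrightarrow> finite \<C> \<and> card \<C> \<le> n"
    using assms unfolding finite_longest_subgroup_chain_def ..
  have "card ` chains_above K H \<subseteq> {..n}" using n by (auto simp: chains_above_def)
  then show "finite (card ` chains_above K H)" using finite_subset by blast
  show "finite \<C>" if "\<C> \<in> chains_above K H" for \<C> using n that by (simp add: chains_above_def)
qed

lemma empty_chain_above: "{} \<in> chains_above K H"
  by (simp add: chains_above_def subgroup_chain_def subset_chain_def)

lemma height_ge: "finite_longest_subgroup_chain K \<Longrightarrow> \<C> \<in> chains_above K H \<Longrightarrow> card \<C> \<le> height K H"
  unfolding height_def by (rule Max_ge[OF chains_above_finite(1)]) simp_all

lemma height_attained:
  assumes "finite_longest_subgroup_chain K"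
  obtains \<C> where "\<C> \<in> chains_above K H" "card \<C> = height K H"
proof -
  have "height K H \<in> card ` chains_above K H"
    unfolding height_def by (rule Max_in[OF chains_above_finite(1)[OF assms]]) (use
      empty_chain_above in blast)
  then show ?thesis using that by auto
qed

lemma height_antimono:
  assumes K: "finite_longest_subgroup_chain K" and "H \<subseteq> H'"
  shows "height K H' \<le> height K H"
proof -
  obtain \<C> where \<C>: "\<C> \<in> chains_above K H'" "card \<C> = height K H'" using height_attained[OF K] .
  then have "\<C> \<in> chains_above K H" using assms(2) by (auto simp: chains_above_def)
  then show ?thesis using height_ge[OF K] \<C>(2) by metis
qed

text \<open>A longest chain above \<open>H'\<close> is extended at the bottom by
  \<open>H\<close>.\<close>

lemma height_strict:
  assumes K: "finite_longest_subgroup_chain K" and H: "subgroup H K" and HH: "H \<subset> H'"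
  shows "height K H' < height K H"
proof -
  obtain \<C> where \<C>: "\<C> \<in> chains_above K H'" "card \<C> = height K H'" using height_attained[OF K] .
  then have above: "\<And>L. L \<in> \<C> \<Longrightarrow> H \<subset> L" using HH by (auto simp: chains_above_def)
  then have "insert H \<C> \<in> chains_above K H"
    using \<C>(1) H unfolding chains_above_def subgroup_chain_def subset_chain_def by auto
  moreover have "card (insert H \<C>) = Suc (card \<C>)"
    using above chains_above_finite(2)[OF K \<C>(1)] by (subst card_insert_disjoint) auto
  ultimately show ?thesis using height_ge[OF K] \<C>(2) by (metis Suc_le_lessD)
qed

text \<open>The chain consisting of \<open>H\<close> alone. Positivity makes the omission of an
  orbit lower the grade strictly.\<close>

lemma height_pos:
  assumes K: "finite_longest_subgroup_chain K" and H: "subgroup H K"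
  shows "0 < height K H"
proof -
  have "{H} \<in> chains_above K H"
    using H by (simp add: chains_above_def subgroup_chain_def subset_chain_def)
  from height_ge[OF K this] show ?thesis by simp
qed

section \<open>Sufficiency of the chain conditions\<close>

context groupoid_presheaves
begin

text \<open>Conjugation by an arrow identifies the automorphism groups at its ends; chains of
  subgroups are moved along an orbit by it.\<close>

lemma conj_subgroup:
  assumes f: "f \<in> Hom G b a" and H: "subgroup H (aut_group G b)"
  shows "subgroup ((\<lambda>g. Comp G f (Comp G g (ginv f))) ` H) (aut_group G a)"
proof (rule aut_subgroupI)
  have o: "a \<in> Obj G" "b \<in> Obj G" using G_Hom_Obj[OF f] by auto
  show "a \<in> Obj G" by fact
  let ?c = "\<lambda>g. Comp G f (Comp G g (ginv f))"
  note fi = ginv(1)[OF f] and HD = aut_subgroupD[OF H o(2)]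
  have hom: "?c g \<in> Hom G a a" if "g \<in> Hom G b b" for g using G_Comp[OF G_Comp[OF fi that] f] .
  have mult: "Comp G (?c g) (?c h) = ?c (Comp G g h)" if g: "g \<in> Hom G b b" and h: "h \<in> Hom G b b"
      for g h
  proof -
    have hi: "Comp G h (ginv f) \<in> Hom G a b" using G_Comp[OF fi h] .
    have gi: "Comp G g (ginv f) \<in> Hom G a b" using G_Comp[OF fi g] .
    have "Comp G (?c g) (?c h) = Comp G f (Comp G (Comp G g (ginv f)) (?c h))"
      using G_assoc[OF hom[OF h] gi f] by simp
    also have "Comp G (Comp G g (ginv f)) (?c h) = Comp G g (Comp G (ginv f) (?c h))"
      using G_assoc[OF hom[OF h] fi g] by simp
    also have "Comp G (ginv f) (?c h) = Comp G h (ginv f)"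
      using G_assoc[OF hi f fi] ginv(2)[OF f] G_Id_left[OF hi] by simp
    also have "Comp G g (Comp G h (ginv f)) = Comp G (Comp G g h) (ginv f)"
      using G_assoc[OF fi h g] .
    finally show ?thesis .
  qed
  show "?c ` H \<subseteq> Hom G a a" using hom HD(1) by blast
  have "?c (Id G b) = Id G a" using G_Id_left[OF fi] ginv(3)[OF f] by simp
  then show idc: "Id G a \<in> ?c ` H" using HD(2) by force
  show "Comp G g h \<in> ?c ` H" if "g \<in> ?c ` H" "h \<in> ?c ` H" for g h
    using that mult HD(1,3) by (auto intro!: image_eqI)
  show "ginv k \<in> ?c ` H" if "k \<in> ?c ` H" for k
  proof -
    obtain g where g: "g \<in> H" "k = ?c g" using \<open>k \<in> ?c ` H\<close> by blast
    have gH: "g \<in> Hom G b b" using HD(1) g(1) by blast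
    have kH: "k \<in> Hom G a a" using hom[OF gH] g(2) by simp
    have cH: "?c (ginv g) \<in> Hom G a a" using hom[OF ginv(1)[OF gH]] .
    have "Comp G (?c (ginv g)) k = ?c (Comp G (ginv g) g)" using mult[OF ginv(1)[OF gH] gH] g(2)
        by simp
    also have "\<dots> = Id G a" using ginv(2)[OF gH] G_Id_left[OF fi] ginv(3)[OF f] by simp
    finally have "ginv k = ?c (ginv g)"
      using G_assoc[OF ginv(1)[OF kH] kH cH] ginv(3)[OF kH] G_Id_left[OF ginv(1)[OF kH]]
        G_Id_right[OF cH] by simp
    then show ?thesis using HD(4)[OF g(1)] by blast
  qed
qed

lemma conj_inj: "f \<in> Hom G b a \<Longrightarrow> inj_on (\<lambda>g. Comp G f (Comp G g (ginv f))) (Hom G b b)"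
proof (rule inj_onI)
  fix g h assume f: "f \<in> Hom G b a" and g: "g \<in> Hom G b b" and h: "h \<in> Hom G b b"
    and e: "Comp G f (Comp G g (ginv f)) = Comp G f (Comp G h (ginv f))"
  note fi = ginv(1)[OF f]
  have "Comp G (ginv f) (Comp G (Comp G f (Comp G k (ginv f))) f) = k" if k: "k \<in> Hom G b b" for k
  proof -
    have ki: "Comp G k (ginv f) \<in> Hom G a b" using G_Comp[OF fi k] .
    have "Comp G (Comp G f (Comp G k (ginv f))) f = Comp G f (Comp G (Comp G k (ginv f)) f)"
      using G_assoc[OF f ki f] by simp
    also have "Comp G (Comp G k (ginv f)) f = k"
      using G_assoc[OF f fi k] ginv(2)[OF f] G_Id_right[OF k] by simp
    also have "Comp G (ginv f) (Comp G f k) = k"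
      using G_assoc[OF k f fi] ginv(2)[OF f] G_Id_left[OF k] by simp
    finally show ?thesis
      using G_assoc[OF k f fi] ginv(2)[OF f] G_Id_left[OF k] by simp
  qed
  then show "g = h" using g h e by metis
qed

text \<open>Conjugation by \<open>f\<close> turns a chain above the stabilizer of
  \<open>act F f x\<close> into an equally long chain above the stabilizer of \<open>x\<close>. The
  opposite inequality comes from the symmetry of orbits.\<close>

lemma height_stab_le:
  assumes F: "F \<in> Obj PSh" and f: "f \<in> Hom G b a" and x: "x \<in> FObj F a"
    and fin: "\<And>c. c \<in> Obj G \<Longrightarrow> finite_longest_subgroup_chain (aut_group G c)"
  shows "height (aut_group G b) (stab F (b, act F f x)) \<le> height (aut_group G a) (stab F (a, x))"
proof -
  have o: "a \<in> Obj G" "b \<in> Obj G" using G_Hom_Obj[OF f] by auto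
  let ?c = "\<lambda>g. Comp G f (Comp G g (ginv f))"
  obtain \<C> where \<C>: "\<C> \<in> chains_above (aut_group G b) (stab F (b, act F f x))"
    "card \<C> = height (aut_group G b) (stab F (b, act F f x))"
    using height_attained[OF fin[OF o(2)]] .
  have sub: "subgroup H (aut_group G b)" "stab F (b, act F f x) \<subseteq> H" "H \<subseteq> Hom G b b" if "H \<in> \<C>"
      for H
    using \<C>(1) that aut_subgroupD(1)[OF _ o(2)]
    unfolding chains_above_def subgroup_chain_def subset_chain_def by auto
  have chain: "H \<subseteq> L \<or> L \<subseteq> H" if "H \<in> \<C>" "L \<in> \<C>" for H L
    using \<C>(1) that unfolding chains_above_def subgroup_chain_def subset_chain_def by auto
  have "stab F (a, x) \<subseteq> ?c ` H" if H: "H \<in> \<C>" for H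
  proof
    fix k assume k: "k \<in> stab F (a, x)"
    then have kH: "k \<in> Hom G a a" by (simp add: stab_def)
    have fi: "ginv f \<in> Hom G a b" by (rule ginv(1)[OF f])
    have kf: "Comp G k f \<in> Hom G b a" using G_Comp[OF f kH] .
    let ?g = "Comp G (ginv f) (Comp G k f)"
    have g: "?g \<in> Hom G b b" using G_Comp[OF kf fi] .
    have "?c ?g = Comp G (Comp G f ?g) (ginv f)" using G_assoc[OF fi g f] .
    also have "Comp G f ?g = Comp G k f" using G_assoc[OF kf fi f] ginv(3)[OF f] G_Id_left[OF kf]
        by simp
    also have "Comp G (Comp G k f) (ginv f) = k"
        using G_assoc[OF fi f kH] ginv(3)[OF f] G_Id_right[OF kH] by simp
    finally have ck: "?c ?g = k" .
    then have "?g \<in> stab F (b, act F f x)" using stab_conj[OF F f x g] k by simp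
    then show "k \<in> ?c ` H" using sub(2)[OF H] ck by force
  qed
  moreover have "?c ` H \<subseteq> ?c ` L \<or> ?c ` L \<subseteq> ?c ` H" if "H \<in> \<C>" "L \<in> \<C>" for H L
    using chain[OF that] image_mono[of H L ?c] image_mono[of L H ?c] by blast
  ultimately have "image ?c ` \<C> \<in> chains_above (aut_group G a) (stab F (a, x))"
    using conj_subgroup[OF f sub(1)]
    unfolding chains_above_def subgroup_chain_def subset_chain_def by (simp add: image_subset_iff)
  moreover have "card (image ?c ` \<C>) = card \<C>"
  proof (rule card_image)
    show "inj_on (image ?c) \<C>"
      by (rule inj_on_subset[OF inj_on_image_Pow[OF conj_inj[OF f]]]) (use sub(3) in blast)
  qed
  ultimately show ?thesis using height_ge[OF fin[OF o(1)]] \<C>(2) by metis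
qed

text \<open>Makes the height of the stabilizer an invariant of the orbit, whatever representative is
  used.\<close>

lemma height_stab_orbit:
  assumes F: "F \<in> Obj PSh" and p: "p \<in> pts F" and q: "q \<in> orbit F p"
    and fin: "\<And>c. c \<in> Obj G \<Longrightarrow> finite_longest_subgroup_chain (aut_group G c)"
  shows "height (aut_group G (fst q)) (stab F q) = height (aut_group G (fst p)) (stab F p)"
proof -
  have le: "height (aut_group G (fst q)) (stab F q) \<le> height (aut_group G (fst p)) (stab F p)"
    if p: "p \<in> pts F" and q: "q \<in> orbit F p" for p q
  proof -
    obtain f where f: "f \<in> Hom G (fst q) (fst p)" "snd q = act F f (snd p)" using q by (rule orbitE)
    have "(fst q, act F f (snd p)) = q" using f(2) by (simp add: prod_eq_iff)
    then show ?thesis using height_stab_le[OF F f(1) ptsD(2)[OF p] fin] by simp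
  qed
  show ?thesis
    using le[OF p q] le[OF subsetD[OF orbit_subset_pts[OF F p] q] orbit_sym[OF F p q]] by simp
qed

text \<open>The image of an orbit is an entire orbit, so meeting every orbit of \<open>X\<close>
  means reaching every point.\<close>

lemma inj_orbits_surj_imp_surj:
  assumes h: "h \<in> Hom PSh Y X" and im: "image (lift h) ` orbits Y = orbits X" and a: "a \<in> Obj G"
  shows "app h a ` FObj Y a = FObj X a"
proof
  show "app h a ` FObj Y a \<subseteq> FObj X a" using PSh_HomD(3)[OF h a] by blast
  show "FObj X a \<subseteq> app h a ` FObj Y a"
  proof
    fix x assume x: "x \<in> FObj X a"
    then have ax: "(a, x) \<in> pts X" using a by (simp add: pts_iff)
    then have "orbit X (a, x) \<in> image (lift h) ` orbits Y" unfolding im by (simp add: orbits_def)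
    then obtain q where q: "q \<in> pts Y" "orbit X (a, x) = lift h ` orbit Y q"
        by (auto simp: orbits_def)
    then have "(a, x) \<in> lift h ` orbit Y q" using orbit_self[OF PSh_HomD(2)[OF h] ax] by simp
    then obtain r where r: "r \<in> orbit Y q" "(a, x) = lift h r" by blast
    have "r \<in> pts Y" using orbit_subset_pts[OF PSh_HomD(1)[OF h] q(1)] r(1) by blast
    then show "x \<in> app h a ` FObj Y a" using r(2) ptsD[of r Y] by (auto simp: lift_def)
  qed
qed

text \<open>Equal finite numbers make the surjection on orbits injective, so two points
  \<open>x\<close> and \<open>y\<close> with the same image lie in one orbit, say
  \<open>y = act Y g x\<close>. Then \<open>g\<close> fixes the image of \<open>x\<close>.
  Conjugated to the representative \<open>b\<close>, it lies in a stabilizer that \<open>h\<close>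
  does not enlarge, and hence it fixes \<open>x\<close>.\<close>

lemma surj_orbit_stab_imp_inj:
  assumes h: "h \<in> Hom PSh Y Z" and surj: "\<And>a. a \<in> Obj G \<Longrightarrow> app h a ` FObj Y a = FObj Z a"
    and fin: "finite (orbits Y)" and card: "card (orbits Y) = card (orbits Z)"
    and B: "B \<subseteq> pts Y" and cover: "\<And>p. p \<in> pts Y \<Longrightarrow> \<exists>b\<in>B. p \<in> orbit Y b"
    and st: "\<And>b. b \<in> B \<Longrightarrow> stab Z (lift h b) \<subseteq> stab Y b" and a: "a \<in> Obj G"
  shows "inj_on (app h a) (FObj Y a)"
proof (rule inj_onI)
  note Y = PSh_HomD(1)[OF h] and Z = PSh_HomD(2)[OF h]
  fix x y assume x: "x \<in> FObj Y a" and y: "y \<in> FObj Y a" and e: "app h a x = app h a y"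
  have px: "(a, x) \<in> pts Y" and py: "(a, y) \<in> pts Y" using x y a by (simp_all add: pts_iff)
  have inj: "inj_on (image (lift h)) (orbits Y)"
    using lift_orbits_surj[OF h surj] card by (intro eq_card_imp_inj_on[OF fin]) simp
  have "lift h ` orbit Y (a, x) = lift h ` orbit Y (a, y)"
    using lift_orbit[OF h px] lift_orbit[OF h py] e by (simp add: lift_def)
  then have oxy: "orbit Y (a, x) = orbit Y (a, y)"
    by (rule inj_onD[OF inj]) (use px py in \<open>auto simp: orbits_def\<close>)
  then have "(a, y) \<in> orbit Y (a, x)" using orbit_self[OF Y py] by simp
  then obtain g where g: "g \<in> Hom G a a" "y = act Y g x" by (auto simp: orbit_iff)
  obtain b where b: "b \<in> B" "(a, x) \<in> orbit Y b" using cover[OF px] by blast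
  obtain f where f: "f \<in> Hom G a (fst b)" "x = act Y f (snd b)" using orbitE[OF b(2)] by auto
  have bp: "b \<in> pts Y" using b(1) B by blast
  note bs = ptsD[OF bp]
  have hb: "app h a x = act Z f (app h (fst b) (snd b))" using PSh_HomD(4)[OF h f(1) bs(2)] f(2)
      by simp
  have "act Z g (app h a x) = app h a x" using PSh_HomD(4)[OF h g(1) x] g(2) e by simp
  then have "g \<in> stab Z (a, act Z f (app h (fst b) (snd b)))" using g(1) hb by (simp add: stab_def)
  then have "Comp G f (Comp G g (ginv f)) \<in> stab Z (lift h b)"
    using stab_conj[OF Z f(1) PSh_HomD(3)[OF h bs] g(1)] by (simp add: lift_def)
  then have "Comp G f (Comp G g (ginv f)) \<in> stab Y (fst b, snd b)" using st[OF b(1)] by auto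
  then have "g \<in> stab Y (a, x)" using stab_conj[OF Y f(1) bs(2) g(1)] f(2) by simp
  then show "x = y" using g(2) by (simp add: stab_def)
qed

section \<open>Counting orbits in subobjects and quotients\<close>

lemma subobject_finite_orbits:
  assumes m: "m \<in> Hom PSh Y X" and mono: "monic PSh m" and fin: "finite (orbits X)"
  shows "finite (orbits Y)"
  using finite_imageD[OF finite_subset[OF lift_orbits[OF m] fin] lift_orbits_inj[OF m monic_inj[OF m
    mono]]] .

lemma quotient_finite_orbits:
  assumes e: "e \<in> Hom PSh X Q" and se: "strong_epic PSh e" and fin: "finite (orbits X)"
  shows "finite (orbits Q)"
  using lift_orbits_surj[OF e strong_epic_surj[OF e se]] finite_imageI[OF fin, of "image (lift e)"]
    by simp

lemma monic_orbits_surj_iso: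
  assumes m: "m \<in> Hom PSh Y X" and mono: "monic PSh m"
      and im: "image (lift m) ` orbits Y = orbits X"
  shows "iso_arr PSh m"
  unfolding iso_arr_iff[OF m] bij_betw_def
  using monic_inj[OF m mono] inj_orbits_surj_imp_surj[OF m im] by blast

text \<open>The map between consecutive subobjects is injective on points and on orbits. Were it
  also surjective on orbits, it would be invertible and the step not strict; so each step loses an
  orbit.\<close>

lemma no_descending_subobjects:
  assumes fin: "finite (orbits A)" and m: "\<And>n. monic PSh (m n) \<and> Cod PSh (m n) = A"
  shows "\<not> strictly_descending (subobj_le PSh) m"
proof
  assume sd: "strictly_descending (subobj_le PSh) m"
  let ?Y = "\<lambda>n. Dom PSh (m n)"
  have mH: "m n \<in> Hom PSh (?Y n) A" for n using m[of n] by (simp add: Hom_iff monic_def)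
  have finY: "finite (orbits (?Y n))" for n
      using subobject_finite_orbits[OF mH conjunct1[OF m] fin] .
  have lt: "card (orbits (?Y (Suc n))) < card (orbits (?Y n))" for n
  proof -
    obtain h where h: "h \<in> Hom PSh (?Y (Suc n)) (?Y n)" "m (Suc n) = Comp PSh (m n) h"
      using sd unfolding strictly_descending_def subobj_le_def by blast
    have inj: "inj_on (app h a) (FObj (?Y (Suc n)) a)" if a: "a \<in> Obj G" for a
    proof (rule inj_onI)
      fix x y assume x: "x \<in> FObj (?Y (Suc n)) a" and y: "y \<in> FObj (?Y (Suc n)) a"
          and "app h a x = app h a y"
      then have "app (m (Suc n)) a x = app (m (Suc n)) a y"
        unfolding h(2) app_Comp[OF h(1) mH a x] app_Comp[OF h(1) mH a y] by simp
      then show "x = y" using inj_onD[OF monic_inj[OF mH conjunct1[OF m] a]] x y by blast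
    qed
    note sub = lift_orbits[OF h(1)] and injo = lift_orbits_inj[OF h(1) inj]
    have "image (lift h) ` orbits (?Y (Suc n)) \<noteq> orbits (?Y n)"
    proof
      assume "image (lift h) ` orbits (?Y (Suc n)) = orbits (?Y n)"
      then have "bij_betw (app h a) (FObj (?Y (Suc n)) a) (FObj (?Y n) a)" if "a \<in> Obj G" for a
        using inj[OF that] inj_orbits_surj_imp_surj[OF h(1) _ that] by (simp add: bij_betw_def)
      then obtain k where k: "k \<in> Hom PSh (?Y n) (?Y (Suc n))" "Comp PSh h k = Id PSh (?Y n)"
        using iso_arrI[OF h(1)] by blast
      have "m n = Comp PSh (m (Suc n)) k"
        using Comp_assoc[OF cat_PSh k(1) h(1) mH] k(2) h(2) Comp_Id_right[OF cat_PSh mH] by simp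
      then have "subobj_le PSh (m n) (m (Suc n))" unfolding subobj_le_def using k(1) by blast
      then show False using sd unfolding strictly_descending_def by blast
    qed
    then have "image (lift h) ` orbits (?Y (Suc n)) \<subset> orbits (?Y n)" using sub by blast
    then have "card (image (lift h) ` orbits (?Y (Suc n))) < card (orbits (?Y n))"
      by (rule psubset_card_mono[OF finY])
    then show ?thesis using card_image[OF injo] by simp
  qed
  have "card (orbits (?Y n)) + n \<le> card (orbits (?Y 0))" for n
  proof (induction n)
    case (Suc n)
    then show ?case using lt[of n] by simp
  qed simp
  \<comment> \<open>A chain with one more step than the first member has orbits would leave a
    negative number of them.\<close>
  from this[of "Suc (card (orbits (?Y 0)))"] show False by simp
qed

lemma bounded_incseq_stabilizes:
  fixes f :: "nat \<Rightarrow> nat"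
  assumes "\<And>n. f n \<le> f (Suc n)" and "\<And>n. f n \<le> B"
  shows "\<exists>N. \<forall>n\<ge>N. f n = f N"
proof -
  have "range f \<subseteq> {..B}" using assms(2) by auto
  then have "finite (range f)" using finite_subset by blast
  then obtain N where "f N = Max (range f)" using Max_in[of "range f"] by fastforce
  then have "f n \<le> f N" for n using \<open>finite (range f)\<close> by simp
  moreover have "f N \<le> f n" if "N \<le> n" for n using lift_Suc_mono_le[of f, OF assms(1) that] .
  ultimately show ?thesis by (metis le_antisym)
qed

text \<open>Descending in \<open>quot_le\<close> means that each quotient maps onto its predecessor.
  Hence the number of orbits increases, bounded by that of \<open>A\<close>, while the stabilizer of
  the image of a fixed point of \<open>A\<close> decreases. Once both are constant,
  \<open>surj_orbit_stab_imp_inj\<close> makes a step invertible.\<close>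

lemma no_descending_quotients:
  assumes fin: "finite (orbits A)" and e: "\<And>n. strong_epic PSh (e n) \<and> Dom PSh (e n) = A"
    and chains: "\<And>a. a \<in> Obj G \<Longrightarrow> only_finite_subgroup_chains (aut_group G a)"
  shows "\<not> strictly_descending (quot_le PSh) e"
proof
  assume sd: "strictly_descending (quot_le PSh) e"
  let ?Q = "\<lambda>n. Cod PSh (e n)"
  have eH: "e n \<in> Hom PSh A (?Q n)" for n using e[of n]
      by (simp add: Hom_iff strong_epic_def epic_def)
  note es = strong_epic_surj[OF eH conjunct1[OF e]]
  have A: "A \<in> Obj PSh" using PSh_HomD(1)[OF eH] .
  have QO: "?Q n \<in> Obj PSh" for n using PSh_HomD(2)[OF eH] .
  have finQ: "finite (orbits (?Q n))" for n
      using quotient_finite_orbits[OF eH conjunct1[OF e] fin] .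
  have "\<exists>h. h \<in> Hom PSh (?Q (Suc n)) (?Q n) \<and> e n = Comp PSh h (e (Suc n))" for n
    using sd unfolding strictly_descending_def quot_le_def by blast
  then obtain h where h: "\<And>n. h n \<in> Hom PSh (?Q (Suc n)) (?Q n)"
      "\<And>n. e n = Comp PSh (h n) (e (Suc n))" by metis
  have eh: "app (e n) a x = app (h n) a (app (e (Suc n)) a x)" if "a \<in> Obj G" "x \<in> FObj A a"
      for n a x
    using app_Comp[OF eH h(1) that] h(2) by metis
  have hs: "app (h n) a ` FObj (?Q (Suc n)) a = FObj (?Q n) a" if a: "a \<in> Obj G" for n a
  proof
    show "app (h n) a ` FObj (?Q (Suc n)) a \<subseteq> FObj (?Q n) a" using PSh_HomD(3)[OF h(1) a] by blast
    show "FObj (?Q n) a \<subseteq> app (h n) a ` FObj (?Q (Suc n)) a"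
    proof
      fix y assume "y \<in> FObj (?Q n) a"
      then obtain x where x: "x \<in> FObj A a" "y = app (e n) a x" using es[OF a, of n] by blast
      then show "y \<in> app (h n) a ` FObj (?Q (Suc n)) a"
          using eh[OF a x(1)] PSh_HomD(3)[OF eH a x(1)] by blast
    qed
  qed
  have "card (orbits (?Q n)) \<le> card (orbits (?Q (Suc n)))" for n
    using lift_orbits_surj[OF h(1) hs, of n] card_image_le[OF finQ] by metis
  moreover have "card (orbits (?Q n)) \<le> card (orbits A)" for n
    using lift_orbits_surj[OF eH es, of n] card_image_le[OF fin] by metis
  ultimately obtain N0 where N0: "\<And>n. N0 \<le> n \<Longrightarrow> card (orbits (?Q n)) = card (orbits (?Q N0))"
    using bounded_incseq_stabilizes[of "\<lambda>n. card (orbits (?Q n))"] by metis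
  obtain B where B: "B \<subseteq> pts A" "\<And>p. p \<in> pts A \<Longrightarrow> \<exists>b\<in>B. p \<in> orbit A b" and finB: "finite B"
    using transversal[OF A] fin by metis
  have lh: "lift (h n) (lift (e (Suc n)) p) = lift (e n) p" if "p \<in> pts A" for n p
    by (simp add: lift_def eh[OF ptsD[OF that], symmetric])
  \<comment> \<open>For a fixed representative \<open>b\<close> of \<open>A\<close> the map
    \<open>h n\<close> carries its image in one quotient to its image in the preceding one, so the
    stabilizers descend.\<close>
  have "\<exists>N. \<forall>n\<ge>N. stab (?Q n) (lift (e n) b) = stab (?Q N) (lift (e N) b)" if b: "b \<in> B" for b
  proof (rule descending_subgroups_stabilize)
    have bp: "b \<in> pts A" using B(1) b by blast
    show "only_finite_subgroup_chains (aut_group G (fst b))" using chains[OF ptsD(1)[OF bp]] .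
    show "subgroup (stab (?Q n) (lift (e n) b)) (aut_group G (fst b))" for n
      using stab_subgroup[OF QO lift_pts[OF eH bp]] by simp
    show "stab (?Q (Suc n)) (lift (e (Suc n)) b) \<subseteq> stab (?Q n) (lift (e n) b)" for n
      using stab_lift[OF h(1) lift_pts[OF eH bp]] lh[OF bp] by metis
  qed
  then obtain N1 where N1: "\<And>b n. b \<in> B \<Longrightarrow> N1 b \<le> n \<Longrightarrow>
      stab (?Q n) (lift (e n) b) = stab (?Q (N1 b)) (lift (e (N1 b)) b)" by metis
  \<comment> \<open>The representatives are finitely many, so one index lies beyond all thresholds;
    there the step from \<open>n\<close> to \<open>Suc n\<close> changes neither orbits nor
    stabilizers.\<close>
  obtain n where n: "N0 \<le> n" "\<And>b. b \<in> B \<Longrightarrow> N1 b \<le> n"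
    using finite_nat_set_iff_bounded_le[of "insert N0 (N1 ` B)"] finB by auto
  have "inj_on (app (h n) a) (FObj (?Q (Suc n)) a)" if a: "a \<in> Obj G" for a
  proof (rule surj_orbit_stab_imp_inj[OF h(1) hs finQ _ _ _ _ a])
    show "card (orbits (?Q (Suc n))) = card (orbits (?Q n))" using N0 n(1) by (metis le_SucI)
    show "lift (e (Suc n)) ` B \<subseteq> pts (?Q (Suc n))" using lift_pts[OF eH] B(1) by blast
    \<comment> \<open>The images of the representatives of \<open>A\<close> reach every orbit of the
      quotient. Several may share an orbit, which \<open>surj_orbit_stab_imp_inj\<close>
      permits.\<close>
    show "\<exists>b\<in>lift (e (Suc n)) ` B. p \<in> orbit (?Q (Suc n)) b" if p: "p \<in> pts (?Q (Suc n))" for p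
    proof -
      obtain x where x: "x \<in> FObj A (fst p)" "snd p = app (e (Suc n)) (fst p) x"
        using es[OF ptsD(1)[OF p], of "Suc n"] ptsD(2)[OF p] by blast
      have q: "(fst p, x) \<in> pts A" "lift (e (Suc n)) (fst p, x) = p"
        using x ptsD(1)[OF p] by (simp_all add: pts_iff lift_def prod_eq_iff)
      obtain b where b: "b \<in> B" "(fst p, x) \<in> orbit A b" using B(2)[OF q(1)] by blast
      have "p \<in> lift (e (Suc n)) ` orbit A b" using b(2) q(2) by force
      then show ?thesis using lift_orbit[OF eH, of b "Suc n"] b(1) B(1) by blast
    qed
    show "stab (?Q n) (lift (h n) b') \<subseteq> stab (?Q (Suc n)) b'" if b': "b' \<in> lift (e (Suc n)) ` B"
        for b'
    proof -
      obtain b where b: "b \<in> B" "b' = lift (e (Suc n)) b" using b' by blast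
      have "stab (?Q n) (lift (e n) b) = stab (?Q (Suc n)) (lift (e (Suc n)) b)"
        using N1[OF b(1) n(2)[OF b(1)]] N1[OF b(1) le_SucI[OF n(2)[OF b(1)]]] by simp
      then show ?thesis using lh[of b n] b B(1) by auto
    qed
  qed
  then have "bij_betw (app (h n) a) (FObj (?Q (Suc n)) a) (FObj (?Q n) a)" if "a \<in> Obj G" for a
    using hs[OF that] that by (simp add: bij_betw_def)
  then obtain k where k: "k \<in> Hom PSh (?Q n) (?Q (Suc n))" "Comp PSh k (h n) = Id PSh (?Q (Suc n))"
    using iso_arrI[OF h(1)] by blast
  have "Comp PSh k (Comp PSh (h n) (e (Suc n))) = e (Suc n)"
    using Comp_assoc[OF cat_PSh eH h(1) k(1)] k(2) Comp_Id_left[OF cat_PSh eH] by simp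
  then have "e (Suc n) = Comp PSh k (e n)" using h(2)[of n] by simp
  then have "quot_le PSh (e n) (e (Suc n))" unfolding quot_le_def using k(1) by blast
  then show False using sd unfolding strictly_descending_def by blast
qed

section \<open>From chain conditions on groups to DCC and graduated categories\<close>

lemma noetherian_fin_gen:
  assumes "\<And>a. a \<in> Obj G \<Longrightarrow> noetherian_group (aut_group G a)"
      and "a \<in> Obj G" "subgroup H (aut_group G a)"
  shows "fin_gen_subgroup (aut_group G a) H"
  using noetherian_group_fin_gen[OF group_aut[OF assms(2)] assms(1)[OF assms(2)] assms(3)] .

text \<open>All stabilizers are finitely generated here, so finite presentability reduces to
  finiteness of the set of orbits, which subobjects and quotients inherit.\<close>

lemma noetherian_finitely_presentable_iff:
  assumes "\<And>a. a \<in> Obj G \<Longrightarrow> noetherian_group (aut_group G a)"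
  shows "finitely_presentable small PSh X \<longleftrightarrow> X \<in> Obj PSh \<and> finite (orbits X)"
proof
  assume "finitely_presentable small PSh X"
  then show "X \<in> Obj PSh \<and> finite (orbits X)"
    by (intro finitely_generated_imp_finite_orbits finitely_presentable_imp_finitely_generated)
next
  assume X: "X \<in> Obj PSh \<and> finite (orbits X)"
  show "finitely_presentable small PSh X"
    by (rule finitely_presentableI)
       (use X noetherian_fin_gen[OF assms ptsD(1) stab_subgroup] in auto)
qed

lemma only_finite_chains_imp_dcc:
  assumes chains: "\<And>a. a \<in> Obj G \<Longrightarrow> only_finite_subgroup_chains (aut_group G a)"
  shows "dcc_category small PSh"
proof -
  have N: "noetherian_group (aut_group G a)" if "a \<in> Obj G" for a
    using only_finite_chains_imp_noetherian[OF chains[OF that]] .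
  have fp: "finitely_presentable small PSh X \<longleftrightarrow> X \<in> Obj PSh \<and> finite (orbits X)" for X
    by (rule noetherian_finitely_presentable_iff[OF N])
  show ?thesis
    unfolding dcc_category_def
  proof (intro conjI allI impI)
    show "locally_finitely_presentable small PSh"
      by (rule locally_finitely_presentable_PSh) (rule noetherian_fin_gen[OF N])
    fix A assume "finitely_presentable small PSh A"
    then have A: "finite (orbits A)" using fp by blast
    show "finitely_presentable small PSh (Dom PSh m)" if m: "monic PSh m \<and> Cod PSh m = A" for m
    proof -
      have "m \<in> Hom PSh (Dom PSh m) A" using m by (simp add: Hom_iff monic_def)
      then show ?thesis unfolding fp using subobject_finite_orbits m A PSh_HomD(1) by blast
    qed
    show "finitely_presentable small PSh (Cod PSh e)" if e: "strong_epic PSh e \<and> Dom PSh e = A"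
        for e
    proof -
      have "e \<in> Hom PSh A (Cod PSh e)" using e by (simp add: Hom_iff strong_epic_def epic_def)
      then show ?thesis unfolding fp using quotient_finite_orbits e A PSh_HomD(2) by blast
    qed
    show "\<nexists>m. (\<forall>n. monic PSh (m n) \<and> Cod PSh (m n) = A) \<and> strictly_descending (subobj_le PSh) m"
    proof
      assume "\<exists>m. (\<forall>n. monic PSh (m n) \<and> Cod PSh (m n) = A) \<and> strictly_descending (subobj_le PSh) m"
      then obtain m where m: "\<And>n. monic PSh (m n) \<and> Cod PSh (m n) = A"
        "strictly_descending (subobj_le PSh) m" by metis
      have "\<not> strictly_descending (subobj_le PSh) m" by (rule no_descending_subobjects[OF A m(1)])
      then show False using m(2) by contradiction
    qed
    show "\<nexists>e. (\<forall>n. strong_epic PSh (e n) \<and> Dom PSh (e n) = A) \<and> strictly_descending (quot_le PSh) e"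
    proof
      assume "\<exists>e. (\<forall>n. strong_epic PSh (e n) \<and> Dom PSh (e n) = A) \<and>
          strictly_descending (quot_le PSh) e"
      then obtain e where e: "\<And>n. strong_epic PSh (e n) \<and> Dom PSh (e n) = A"
        "strictly_descending (quot_le PSh) e" by metis
      have "\<not> strictly_descending (quot_le PSh) e"
          by (rule no_descending_quotients[OF A e(1) chains])
      then show False using e(2) by contradiction
    qed
  qed
qed

text \<open>Evaluated at a chosen representative; invariance of heights under conjugation makes the
  choice immaterial when chain lengths are bounded.\<close>

definition weight where
  "weight F W = (let p = SOME p. p \<in> pts F \<and> orbit F p = W in height (aut_group G (fst p)) (stab F
      p))"

lemma weight_orbit:
  assumes F: "F \<in> Obj PSh" and p: "p \<in> pts F"
    and fin: "\<And>c. c \<in> Obj G \<Longrightarrow> finite_longest_subgroup_chain (aut_group G c)"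
  shows "weight F (orbit F p) = height (aut_group G (fst p)) (stab F p)"
proof -
  define q where "q = (SOME q. q \<in> pts F \<and> orbit F q = orbit F p)"
  have "q \<in> pts F \<and> orbit F q = orbit F p"
    unfolding q_def by (rule someI[of "\<lambda>q. q \<in> pts F \<and> orbit F q = orbit F p" p]) (use p in simp)
  then have "q \<in> orbit F p" using orbit_self[OF F, of q] by simp
  from height_stab_orbit[OF F p this fin] show ?thesis unfolding weight_def q_def[symmetric] by simp
qed

text \<open>A subobject keeps the weights of its orbits, so its grade is a partial sum of positive
  terms. For a quotient, each orbit is compared with one orbit above it, whose weight is at least as
  large; strictness comes from an orbit left out or from a stabilizer that grows.\<close>

lemma finite_longest_imp_graduated:
  assumes fin: "\<And>a. a \<in> Obj G \<Longrightarrow> finite_longest_subgroup_chain (aut_group G a)"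
  shows "graduated small PSh"
proof -
  have chains: "only_finite_subgroup_chains (aut_group G a)" if "a \<in> Obj G" for a
    using finite_longest_imp_only_finite_chains[OF fin[OF that]] .
  have N: "noetherian_group (aut_group G a)" if "a \<in> Obj G" for a
    using only_finite_chains_imp_noetherian[OF chains[OF that]] .
  have fp: "finitely_presentable small PSh X \<longleftrightarrow> X \<in> Obj PSh \<and> finite (orbits X)" for X
    by (rule noetherian_finitely_presentable_iff[OF N])
  have wo: "weight F (orbit F p) = height (aut_group G (fst p)) (stab F p)"
      if "F \<in> Obj PSh" "p \<in> pts F" for F p
    by (rule weight_orbit[OF that fin])
  have pos: "0 < weight F W" if F: "F \<in> Obj PSh" and W: "W \<in> orbits F" for F W
  proof -
    obtain p where p: "p \<in> pts F" "W = orbit F p" using W by (auto simp: orbits_def)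
    show ?thesis unfolding p(2) wo[OF F p(1)]
        by (rule height_pos[OF fin[OF ptsD(1)[OF p(1)]] stab_subgroup[OF F p(1)]])
  qed
  \<comment> \<open>Over infinitely many orbits this sum has the default value 0; grades are
    compared only where the orbits are finite in number.\<close>
  let ?grade = "\<lambda>F. \<Sum>W\<in>orbits F. weight F W"
  have sub: "finitely_presentable small PSh (Dom PSh m) \<and> ?grade (Dom PSh m) \<le> ?grade X \<and>
      (\<not> iso_arr PSh m \<longrightarrow> ?grade (Dom PSh m) < ?grade X)"
    if X: "finite (orbits X)" and m: "monic PSh m \<and> Cod PSh m = X" for X m
  proof -
    let ?Y = "Dom PSh m"
    have mH: "m \<in> Hom PSh ?Y X" using m by (simp add: Hom_iff monic_def)
    note mono = conjunct1[OF m] and YO = PSh_HomD(1)[OF mH] and XO = PSh_HomD(2)[OF mH]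
    have Yfin: "finite (orbits ?Y)" using subobject_finite_orbits[OF mH mono X] .
    have w: "weight X (lift m ` W) = weight ?Y W" if W: "W \<in> orbits ?Y" for W
    proof -
      obtain p where p: "p \<in> pts ?Y" "W = orbit ?Y p" using W by (auto simp: orbits_def)
      show ?thesis
        unfolding p(2) lift_orbit[OF mH p(1)] wo[OF YO p(1)] wo[OF XO lift_pts[OF mH p(1)]]
        using stab_lift_inj[OF mH p(1) monic_inj[OF mH mono ptsD(1)[OF p(1)]]] by simp
    qed
    let ?I = "image (lift m) ` orbits ?Y"
    have "?grade ?Y = (\<Sum>W\<in>orbits ?Y. weight X (lift m ` W))" using w by simp
    also have "\<dots> = sum (weight X) ?I"
      by (subst sum.reindex[OF lift_orbits_inj[OF mH monic_inj[OF mH mono]]]) simp_all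
    finally have g: "?grade ?Y = sum (weight X) ?I" .
    have I: "?I \<subseteq> orbits X" by (rule lift_orbits[OF mH])
    have "?grade ?Y \<le> ?grade X" unfolding g by (rule sum_mono2[OF X I]) simp
    moreover have "?grade ?Y < ?grade X" if not_iso: "\<not> iso_arr PSh m"
    proof -
      have "?I \<noteq> orbits X" using monic_orbits_surj_iso[OF mH mono] not_iso by metis
      then obtain V where V: "V \<in> orbits X - ?I" using I by blast
      show ?thesis unfolding g by (rule sum_strict_mono2[OF X I V]) (use pos[OF XO] V in auto)
    qed
    ultimately show ?thesis unfolding fp using YO Yfin by blast
  qed
  have quot: "finitely_presentable small PSh (Cod PSh e) \<and> ?grade (Cod PSh e) \<le> ?grade X \<and>
      (\<not> iso_arr PSh e \<longrightarrow> ?grade (Cod PSh e) < ?grade X)"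
    if X: "finite (orbits X)" and e: "strong_epic PSh e \<and> Dom PSh e = X" for X e
  proof -
    let ?Q = "Cod PSh e"
    have eH: "e \<in> Hom PSh X ?Q" using e by (simp add: Hom_iff strong_epic_def epic_def)
    note se = conjunct1[OF e] and XO = PSh_HomD(1)[OF eH] and QO = PSh_HomD(2)[OF eH]
    note es = strong_epic_surj[OF eH se]
    have Qfin: "finite (orbits ?Q)" using quotient_finite_orbits[OF eH se X] .
    note im = lift_orbits_surj[OF eH es]
    \<comment> \<open>A section of the surjection on orbits. It embeds the orbits of the quotient
      into those of \<open>X\<close>, which allows the two sums to be compared termwise.\<close>
    let ?s = "inv_into (orbits X) (image (lift e))"
    have s: "?s V \<in> orbits X" "lift e ` ?s V = V" if "V \<in> orbits ?Q" for V
    proof -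
      have V: "V \<in> image (lift e) ` orbits X" using im that by simp
      show "?s V \<in> orbits X" by (rule inv_into_into[OF V])
      show "lift e ` ?s V = V" by (rule f_inv_into_f[OF V])
    qed
    have w: "weight ?Q (lift e ` W) \<le> weight X W" if W: "W \<in> orbits X" for W
    proof -
      obtain p where p: "p \<in> pts X" "W = orbit X p" using W by (auto simp: orbits_def)
      show ?thesis
        unfolding p(2) lift_orbit[OF eH p(1)] wo[OF XO p(1)] wo[OF QO lift_pts[OF eH p(1)]] fst_lift
        by (rule height_antimono[OF fin[OF ptsD(1)[OF p(1)]] stab_lift[OF eH p(1)]])
    qed
    have ws: "weight ?Q V \<le> weight X (?s V)" if "V \<in> orbits ?Q" for V
      using w[OF s(1)[OF that]] s(2)[OF that] by simp
    have injs: "inj_on ?s (orbits ?Q)" by (rule inj_on_inv_into) (simp add: im)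
    let ?I = "?s ` orbits ?Q"
    have I: "?I \<subseteq> orbits X" using s(1) by blast
    have gI: "(\<Sum>V\<in>orbits ?Q. weight X (?s V)) = sum (weight X) ?I"
      by (subst sum.reindex[OF injs]) simp_all
    have g1: "?grade ?Q \<le> sum (weight X) ?I" unfolding gI[symmetric] by (rule sum_mono[OF ws])
    have g2: "sum (weight X) ?I \<le> ?grade X" by (rule sum_mono2[OF X I]) simp
    \<comment> \<open>If the section misses an orbit, its positive weight is lost. Otherwise orbits
      correspond one to one; then some stabilizer must grow, since \<open>e\<close> would be an
      isomorphism if none did, and the weight of that orbit drops.\<close>
    have "?grade ?Q < ?grade X" if not_iso: "\<not> iso_arr PSh e"
    proof (cases "?I = orbits X")
      case False
      then obtain V where V: "V \<in> orbits X - ?I" using I by blast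
      have "sum (weight X) ?I < ?grade X"
          by (rule sum_strict_mono2[OF X I V]) (use pos[OF XO] V in auto)
      then show ?thesis using g1 by simp
    next
      case True
      then have card: "card (orbits X) = card (orbits ?Q)" using card_image[OF injs] by simp
      \<comment> \<open>Here all points of \<open>X\<close> serve as the covering set in
        \<open>surj_orbit_stab_imp_inj\<close>, since each lies in its own orbit.\<close>
      have "\<exists>p\<in>pts X. \<not> stab ?Q (lift e p) \<subseteq> stab X p"
      proof (rule ccontr)
        assume "\<not> (\<exists>p\<in>pts X. \<not> stab ?Q (lift e p) \<subseteq> stab X p)"
        then have "inj_on (app e a) (FObj X a)" if "a \<in> Obj G" for a
          by (intro surj_orbit_stab_imp_inj[OF eH es X card order_refl _ _ that])
             (use orbit_self[OF XO] in blast)+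
        then show False using not_iso es unfolding iso_arr_iff[OF eH] bij_betw_def by blast
      qed
      then obtain p where p: "p \<in> pts X" "\<not> stab ?Q (lift e p) \<subseteq> stab X p" by blast
      have injl: "inj_on (image (lift e)) (orbits X)"
        using im card by (intro eq_card_imp_inj_on[OF X]) simp
      let ?V = "lift e ` orbit X p"
      have oX: "orbit X p \<in> orbits X" using p(1) by (simp add: orbits_def)
      then have V: "?V \<in> orbits ?Q" using im by blast
      have sV: "?s ?V = orbit X p" using inv_into_f_f[OF injl oX] .
      have "weight ?Q ?V < weight X (?s ?V)"
        unfolding sV unfolding lift_orbit[OF eH p(1)] wo[OF XO p(1)] wo[OF QO lift_pts[OF eH p(1)]]
          fst_lift
        by (rule height_strict[OF fin[OF ptsD(1)[OF p(1)]] stab_subgroup[OF XO p(1)]])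
           (use stab_lift[OF eH p(1)] p(2) in blast)
      then have "?grade ?Q < (\<Sum>V\<in>orbits ?Q. weight X (?s V))"
        by (intro sum_strict_mono_ex1[OF Qfin]) (use ws V in auto)
      then show ?thesis using gI g2 by simp
    qed
    moreover have "?grade ?Q \<le> ?grade X" using g1 g2 by simp
    ultimately show ?thesis unfolding fp using QO Qfin by blast
  qed
  have lfp: "locally_finitely_presentable small PSh"
    by (rule locally_finitely_presentable_PSh) (rule noetherian_fin_gen[OF N])
  show ?thesis
    unfolding graduated_def
  proof (intro conjI[OF lfp] exI[of _ ?grade] allI impI)
    fix X assume "finitely_presentable small PSh X"
    then have X: "finite (orbits X)" using fp by blast
    show "(\<forall>m. monic PSh m \<and> Cod PSh m = X \<longrightarrow>
        finitely_presentable small PSh (Dom PSh m) \<and> ?grade (Dom PSh m) \<le> ?grade X \<and>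
        (\<not> iso_arr PSh m \<longrightarrow> ?grade (Dom PSh m) < ?grade X)) \<and>
      (\<forall>e. strong_epic PSh e \<and> Dom PSh e = X \<longrightarrow>
        finitely_presentable small PSh (Cod PSh e) \<and> ?grade (Cod PSh e) \<le> ?grade X \<and>
        (\<not> iso_arr PSh e \<longrightarrow> ?grade (Cod PSh e) < ?grade X))"
      using sub[OF X] quot[OF X] by (intro conjI[OF allI allI] impI)
  qed
qed

end

theorem corollary4p10:
  fixes small :: "'u set \<Rightarrow> bool" and G :: "('o, 'm) category"
  assumes "set_universe small"
    and "groupoid G"
    and "small_category small G"
  shows "((\<forall>F. finitely_generated small (presheaves small G) F \<longrightarrow>
               finitely_presentable small (presheaves small G) F) \<longleftrightarrow>
            (\<forall>a\<in>Obj G. noetherian_group (aut_group G a))) \<and>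
         (dcc_category small (presheaves small G) \<longleftrightarrow>
            (\<forall>a\<in>Obj G. only_finite_subgroup_chains (aut_group G a))) \<and>
         (graduated small (presheaves small G) \<longleftrightarrow>
            (\<forall>a\<in>Obj G. finite_longest_subgroup_chain (aut_group G a)))"
proof -
  interpret groupoid_presheaves small G
    using assms by (simp add: groupoid_presheaves_def groupoid_presheaves_axioms_def)
  show ?thesis
  proof (intro conjI iffI ballI allI impI)
    show "noetherian_group (aut_group G a)"
      if "\<forall>F. finitely_generated small PSh F \<longrightarrow> finitely_presentable small PSh F" "a \<in> Obj G" for a
      using fg_fp_imp_noetherian that by blast
    show "finitely_presentable small PSh F"
      if "\<forall>a\<in>Obj G. noetherian_group (aut_group G a)" "finitely_generated small PSh F" for F
      \<comment> \<open>Finite generation gives finitely many orbits over any groupoid; the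
        Noetherian hypothesis turns that count into finite presentability.\<close>
      using that noetherian_finitely_presentable_iff finitely_generated_imp_finite_orbits by blast
    show "only_finite_subgroup_chains (aut_group G a)" if "dcc_category small PSh" "a \<in> Obj G" for a
      using dcc_imp_only_finite_chains that .
    show "dcc_category small PSh" if "\<forall>a\<in>Obj G. only_finite_subgroup_chains (aut_group G a)"
      using only_finite_chains_imp_dcc that by blast
    show "finite_longest_subgroup_chain (aut_group G a)" if "graduated small PSh" "a \<in> Obj G" for a
      using graduated_imp_finite_longest that .
    show "graduated small PSh" if "\<forall>a\<in>Obj G. finite_longest_subgroup_chain (aut_group G a)"
      using finite_longest_imp_graduated that by blast
  qed
qed

end
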